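(* Let $\alpha\in(1/2,1)$ and $n\ge 1$. Let $L\in C(\mathbb{R},\mathbb{R}^{n\times n})$ and $W:\mathbb{R}\times\mathbb{R}^n\to\mathbb{R}$ satisfy: (L) $L(t)$ is a positive definite symmetric matrix for all $t\in\mathbb{R}$, and there exists $l\in C(\mathbb{R},(0,\infty))$ with $l(t)\to+\infty$ as $|t|\to\infty$ such that $(L(t)x,x)\ge l(t)|x|^2$ for all $t\in\mathbb{R}$, $x\in\mathbb{R}^n$; (W1) $W\in C^1(\mathbb{R}\times\mathbb{R}^n,\mathbb{R})$ and there is a constant $\mu>2$ such that $0<\mu W(t,x)\le (x,\nabla W(t,x))$ for all $t\in\mathbb{R}$ and $x\in\mathbb{R}^n\setminus\{0\}$; (W2) $|\nabla W(t,x)|=o(|x|)$ as $x\to 0$, uniformly with respect to $t\in\mathbb{R}$; (W3) there exists $\overline{W}\in C(\mathbb{R}^n,\mathbb{R})$ such that $|W(t,x)|+|\nabla W(t,x)|\le|\overline{W}(x)|$ for all $x\in\mathbb{R}^n$, $t\in\mathbb{R}$. Then the fractional Hamiltonian system $$ {}_{t}D_{\infty}^{\alpha}\big({}_{-\infty}D_{t}^{\alpha}u(t)\big)+L(t)u(t)=\nabla W(t,u(t)),\qquad t\in\mathbb{R},$$ possesses at least one nontrivial (weak) solution, i.e. there exists $u\in X^\alpha$, $u\neq 0$, which is a critical point of the functional $$I(u)=\frac12\int_{\mathbb{R}}\big[|{}_{-\infty}D_t^{\alpha}u(t)|^2+(L(t)u(t),u(t))\big]\,dt-\int_{\mathbb{R}}W(t,u(t))\,dt$$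 on $X^\alpha$; equivalently $\int_{\mathbb{R}}[({}_{-\infty}D_t^\alpha u,{}_{-\infty}D_t^\alpha v)+(L(t)u,v)]\,dt=\int_{\mathbb{R}}(\nabla W(t,u),v)\,dt$ for all $v\in X^\alpha$.
   Context: $\widehat{u}(w)=\int_{\mathbb{R}}e^{-ixw}u(x)\,dx$ denotes the Fourier transform (componentwise for $\mathbb{R}^n$-valued functions). The Liouville–Weyl derivatives are ${}_{-\infty}D_x^\alpha u=\frac{d}{dx}\,{}_{-\infty}I_x^{1-\alpha}u$ and ${}_xD_\infty^\alpha u=-\frac{d}{dx}\,{}_xI_\infty^{1-\alpha}u$, where ${}_{-\infty}I_x^{\beta}u(x)=\frac1{\Gamma(\beta)}\int_{-\infty}^x(x-\xi)^{\beta-1}u(\xi)d\xi$ and ${}_xI_\infty^{\beta}u(x)=\frac1{\Gamma(\beta)}\int_x^{\infty}(\xi-x)^{\beta-1}u(\xi)d\xi$; in Fourier terms $\widehat{{}_{-\infty}D_x^\alpha u}(w)=(iw)^\alpha\widehat u(w)$. $H^\alpha(\mathbb{R},\mathbb{R}^n)$ is the closure of $C_0^\infty(\mathbb{R},\mathbb{R}^n)$ under the norm $\|u\|_\alpha=(\|u\|_{L^2}^2+\||w|^\alpha\widehat u\|_{L^2}^2)^{1/2}$, equivalently under $(\|u\|_{L^2}^2+\|{}_{-\infty}D_t^\alpha u\|_{L^2}^2)^{1/2}$. $X^\alpha=\{u\in H^\alpha(\mathbb{R},\mathbb{R}^n):\int_{\mathbb{R}}|{}_{-\infty}D_t^\alpha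 u|^2+(L(t)u(t),u(t))\,dt<\infty\}$ with inner product $\langle u,v\rangle_{X^\alpha}=\int_{\mathbb{R}}({}_{-\infty}D_t^\alpha u,{}_{-\infty}D_t^\alpha v)+(L(t)u,v)\,dt$ and norm $\|u\|_{X^\alpha}=\langle u,u\rangle^{1/2}$. *)

theory Defs
  imports "HOL-Analysis.Analysis"
begin

definition L2 :: "(real \<Rightarrow> 'a::euclidean_space) \<Rightarrow> bool" where
  "L2 f \<longleftrightarrow> f \<in> borel_measurable lborel \<and> integrable lborel (\<lambda>t. (norm (f t))\<^sup>2)"

definition test_fun :: "(real \<Rightarrow> real^'n) \<Rightarrow> bool" where
  "test_fun \<phi> \<longleftrightarrow>
     (\<exists>D. D 0 = \<phi> \<and> (\<forall>k t. (D k has_vector_derivative D (Suc k) t) (at t)))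
     \<and> (\<exists>R. \<forall>t. R < \<bar>t\<bar> \<longrightarrow> \<phi> t = 0)"

definition LW_left_int :: "real \<Rightarrow> (real \<Rightarrow> real^'n) \<Rightarrow> real \<Rightarrow> real^'n" where
  "LW_left_int \<beta> u x =
     integral\<^sup>L lborel (\<lambda>\<xi>. (indicator {..<x} \<xi> * (x - \<xi>) powr (\<beta> - 1) / Gamma \<beta>) *\<^sub>R u \<xi>)"

definition LW_left_deriv :: "real \<Rightarrow> (real \<Rightarrow> real^'n) \<Rightarrow> real \<Rightarrow> real^'n" where
  "LW_left_deriv \<alpha> u x = vector_derivative (LW_left_int (1 - \<alpha>) u) (at x)"

text \<open>frac_H alpha u Du: u belongs to H^alpha (closure of the test functions under the norm
  (||u||_2^2 + ||D^alpha u||_2^2)^(1/2)) and Du is its (a.e. determined) fractional derivative.\<close>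
definition frac_H :: "real \<Rightarrow> (real \<Rightarrow> real^'n) \<Rightarrow> (real \<Rightarrow> real^'n) \<Rightarrow> bool" where
  "frac_H \<alpha> u Du \<longleftrightarrow> L2 u \<and> L2 Du \<and>
     (\<exists>\<phi>. (\<forall>k. test_fun (\<phi> k) \<and> L2 (\<phi> k) \<and> L2 (LW_left_deriv \<alpha> (\<phi> k)))
        \<and> (\<lambda>k. integral\<^sup>L lborel (\<lambda>t. (norm (\<phi> k t - u t))\<^sup>2)) \<longlonglongrightarrow> 0
        \<and> (\<lambda>k. integral\<^sup>L lborel (\<lambda>t. (norm (LW_left_deriv \<alpha> (\<phi> k) t - Du t))\<^sup>2)) \<longlonglongrightarrow> 0)"

definition in_X :: "real \<Rightarrow> (real \<Rightarrow> real^'n^'n) \<Rightarrow> (real \<Rightarrow> real^'n) \<Rightarrow> bool" where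
  "in_X \<alpha> L u \<longleftrightarrow> (\<exists>Du. frac_H \<alpha> u Du) \<and> integrable lborel (\<lambda>t. (L t *v u t) \<bullet> u t)"

definition C1_pair :: "(real \<Rightarrow> real^'n \<Rightarrow> real) \<Rightarrow> bool" where
  "C1_pair W \<longleftrightarrow> (\<exists>DW :: real \<times> (real^'n) \<Rightarrow> (real \<times> (real^'n)) \<Rightarrow>\<^sub>L real.
      continuous_on UNIV DW \<and>
      (\<forall>p. ((\<lambda>q. W (fst q) (snd q)) has_derivative blinfun_apply (DW p)) (at p)))"

definition nablaW :: "(real \<Rightarrow> real^'n \<Rightarrow> real) \<Rightarrow> real \<Rightarrow> real^'n \<Rightarrow> real^'n" where
  "nablaW W t x = (\<chi> i. deriv (\<lambda>s. W t (x + s *\<^sub>R axis i 1)) 0)"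

end

theory Submission
  imports Defs "HOL-Library.Function_Algebras" "HOL-Complex_Analysis.Great_Picard"
begin

text \<open>
  The solution is a critical point of mountain pass type of the functional \<open>I\<close> on the energy space of
  pairs \<open>(u, Du)\<close>, so that the derivative never has to be recovered from the function. Since
  \<open>\<nabla> I\<close> is uniformly continuous on bounded sets, an almost optimal path from \<open>0\<close> to a point
  of negative energy that met no almost critical point could be pushed below the minimax level by finitely many
  small gradient steps; this yields a Palais--Smale sequence without a gradient flow. The
  Ambrosetti--Rabinowitz condition bounds the sequence.

  Compactness rests on \<open>c \<phi> = k\<^sub>\<alpha> * D\<^sup>\<alpha> \<phi>\<close> for test functions, where the shifts of the kernel
  \<open>k\<^sub>\<alpha>(s) = s\<^sub>+\<^sup>\<alpha>\<^sup>-\<^sup>1\<close> are Hoelder continuous in \<open>L\<^sup>2\<close> because \<open>\<alpha> > 1/2\<close>. This bounds the functions uniformly and makes them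
  equicontinuous, while the coercivity of \<open>L\<close> controls their tails. Hence bounded sequences have
  subsequences converging in \<open>L\<^sup>2\<close>, and \<open>\<nabla> I\<close> is a compact perturbation of the identity.
\<close>

section \<open>The mountain pass theorem in a semi-inner product space\<close>

text \<open>Elements of the energy space are functions, not classes modulo null sets, so the energy
  form vanishes on some nonzero vectors. The abstract part therefore allows a degenerate form:
  limits are unique only up to \<open>nrm\<close> zero, and criticality means
  \<open>nrm (G u) = 0\<close>, which Cauchy--Schwarz turns into the weak equation.

  Two obstacles shape the analysis. The domain is the whole line, so compactness can be lost at
  infinity, and only the weight \<open>l\<close> prevents this. And (W3) allows any growth of
  \<open>W\<close> in \<open>x\<close>; it is the uniform bound on the functions that confines their
  values to a ball, where the gradient grows at most linearly. On that ball the gradient is known to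
  be continuous but not Lipschitz, so every estimate of its increments has the shape \<epsilon> plus
  a multiple of the \<open>L2\<close> distance.

  The zero function is excluded by energy: the minimax level is positive, whereas a solution that
  vanishes almost everywhere would have energy at most zero.\<close>

locale semi_inner =
  fixes S :: "'v::real_vector set" and B :: "'v \<Rightarrow> 'v \<Rightarrow> real"
  assumes sub: "subspace S"
    and sym: "\<lbrakk>x \<in> S; y \<in> S\<rbrakk> \<Longrightarrow> B x y = B y x"
    and add_left: "\<lbrakk>x \<in> S; y \<in> S; z \<in> S\<rbrakk> \<Longrightarrow> B (x + y) z = B x z + B y z"
    and scale_left: "\<lbrakk>x \<in> S; z \<in> S\<rbrakk> \<Longrightarrow> B (c *\<^sub>R x) z = c * B x z"
    and nonneg: "x \<in> S \<Longrightarrow> 0 \<le> B x x"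
begin

definition nrm :: "'v \<Rightarrow> real" where "nrm x = sqrt (B x x)"

lemma mem_add [simp]: "\<lbrakk>x \<in> S; y \<in> S\<rbrakk> \<Longrightarrow> x + y \<in> S"
  and mem_diff [simp]: "\<lbrakk>x \<in> S; y \<in> S\<rbrakk> \<Longrightarrow> x - y \<in> S"
  and mem_scale [simp]: "x \<in> S \<Longrightarrow> c *\<^sub>R x \<in> S"
  and mem_neg [simp]: "x \<in> S \<Longrightarrow> - x \<in> S"
  and mem_zero [simp]: "0 \<in> S"
  using sub by (simp_all add: subspace_add subspace_diff subspace_scale subspace_neg subspace_0)

lemma add_right: "\<lbrakk>x \<in> S; y \<in> S; z \<in> S\<rbrakk> \<Longrightarrow> B z (x + y) = B z x + B z y"
  using add_left[of x y z] by (simp add: sym)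

lemma scale_right: "\<lbrakk>x \<in> S; z \<in> S\<rbrakk> \<Longrightarrow> B z (c *\<^sub>R x) = c * B z x"
  using scale_left[of x z c] by (simp add: sym)

lemma neg_left: "\<lbrakk>x \<in> S; z \<in> S\<rbrakk> \<Longrightarrow> B (- x) z = - B x z"
  using scale_left[of x z "-1"] by simp

lemma neg_right: "\<lbrakk>x \<in> S; z \<in> S\<rbrakk> \<Longrightarrow> B z (- x) = - B z x"
  using scale_right[of x z "-1"] by simp

lemma diff_left: "\<lbrakk>x \<in> S; y \<in> S; z \<in> S\<rbrakk> \<Longrightarrow> B (x - y) z = B x z - B y z"
  using add_left[of x "- y" z] by (simp add: neg_left)

lemma diff_right: "\<lbrakk>x \<in> S; y \<in> S; z \<in> S\<rbrakk> \<Longrightarrow> B z (x - y) = B z x - B z y"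
  using add_right[of x "- y" z] by (simp add: neg_right)

lemmas bil = add_left add_right scale_left scale_right neg_left neg_right diff_left diff_right

lemma zero_left [simp]: "x \<in> S \<Longrightarrow> B 0 x = 0"
  using scale_left[of 0 x 0] by simp

lemma nrm_nonneg [simp]: "x \<in> S \<Longrightarrow> 0 \<le> nrm x"
  by (simp add: nrm_def nonneg)

lemma nrm_sq: "x \<in> S \<Longrightarrow> (nrm x)\<^sup>2 = B x x"
  by (simp add: nrm_def nonneg)

lemma nrm_zero [simp]: "nrm 0 = 0"
  by (simp add: nrm_def)

lemma nrm_scale: "x \<in> S \<Longrightarrow> nrm (c *\<^sub>R x) = \<bar>c\<bar> * nrm x"
  by (simp add: nrm_def bil real_sqrt_mult power2_eq_square flip: mult.assoc)

lemma nrm_minus [simp]: "x \<in> S \<Longrightarrow> nrm (- x) = nrm x"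
  using nrm_scale[of x "-1"] by simp

lemma nrm_commute: "\<lbrakk>x \<in> S; y \<in> S\<rbrakk> \<Longrightarrow> nrm (x - y) = nrm (y - x)"
  using nrm_minus[of "x - y"] by simp

text \<open>The quadratic \<open>B (x + t *R y) (x + t *R y)\<close> in \<open>t\<close> is
  nonnegative. If \<open>B y y = 0\<close>, which may happen for a nonzero \<open>y\<close>, it is
  affine and its slope must vanish; otherwise it is evaluated at its minimum.\<close>

lemma cauchy_schwarz:
  assumes x: "x \<in> S" and y: "y \<in> S"
  shows "\<bar>B x y\<bar> \<le> nrm x * nrm y"
proof -
  have q: "0 \<le> B x x + 2 * t * B x y + t\<^sup>2 * B y y" for t
    using nonneg[of "x + t *\<^sub>R y"] x y by (simp add: bil sym[of y x] power2_eq_square algebra_simps)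
  have "(B x y)\<^sup>2 \<le> B x x * B y y"
  proof (cases "B y y = 0")
    case True
    have "B x y = 0"
    proof (rule ccontr)
      assume n: "B x y \<noteq> 0"
      \<comment> \<open>At this value of \<open>t\<close> the affine function equals -1.\<close>
      have "0 \<le> B x x + 2 * (- (B x x + 1) / (2 * B x y)) * B x y"
        using q[of "- (B x x + 1) / (2 * B x y)"] True by simp
      thus False using n by (simp add: field_simps)
    qed
    thus ?thesis using True by simp
  next
    case False
    hence p: "B y y > 0" using nonneg[OF y] by simp
    have "0 \<le> B x x - (B x y)\<^sup>2 / B y y"
      using q[of "- B x y / B y y"] p by (simp add: power2_eq_square field_simps)
    thus ?thesis using p by (simp add: field_simps)
  qed
  hence "sqrt ((B x y)\<^sup>2) \<le> sqrt (B x x * B y y)" by (rule real_sqrt_le_mono)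
  thus ?thesis by (simp add: nrm_def real_sqrt_mult)
qed

lemma nrm_triangle:
  assumes x: "x \<in> S" and y: "y \<in> S"
  shows "nrm (x + y) \<le> nrm x + nrm y"
proof (rule power2_le_imp_le)
  have "(nrm (x + y))\<^sup>2 = B x x + 2 * B x y + B y y"
    using x y by (simp add: nrm_sq bil sym[of y x])
  also have "\<dots> \<le> (nrm x)\<^sup>2 + 2 * (nrm x * nrm y) + (nrm y)\<^sup>2"
    using cauchy_schwarz[OF x y] x y by (simp add: nrm_sq)
  finally show "(nrm (x + y))\<^sup>2 \<le> (nrm x + nrm y)\<^sup>2" by (simp add: power2_sum)
qed (use x y in simp)

lemma nrm_triangle_diff: "\<lbrakk>x \<in> S; y \<in> S\<rbrakk> \<Longrightarrow> nrm (x - y) \<le> nrm x + nrm y"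
  using nrm_triangle[of x "- y"] by simp

lemma nrm_diff_ineq: "\<lbrakk>x \<in> S; y \<in> S\<rbrakk> \<Longrightarrow> \<bar>nrm x - nrm y\<bar> \<le> nrm (x - y)"
  using nrm_triangle[of "x - y" y] nrm_triangle[of "y - x" x] nrm_commute[of x y] by simp

lemma tendsto_nrm:
  assumes ev: "\<forall>\<^sub>F s in Z. f s \<in> S" and x: "x \<in> S" and lim: "((\<lambda>s. nrm (f s - x)) \<longlongrightarrow> 0) Z"
  shows "((\<lambda>s. nrm (f s)) \<longlongrightarrow> nrm x) Z"
proof -
  have "((\<lambda>s. nrm (f s) - nrm x) \<longlongrightarrow> 0) Z"
  proof (rule tendsto_0_le[where K = 1, OF lim])
    show "\<forall>\<^sub>F s in Z. norm (nrm (f s) - nrm x) \<le> norm (nrm (f s - x)) * 1"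
      using ev by eventually_elim (use nrm_diff_ineq x in auto)
  qed
  thus ?thesis using Lim_null by blast
qed

end

section \<open>Completeness and Riesz representation in the degenerate setting\<close>

locale semi_hilbert = semi_inner S B for S :: "'v::real_vector set" and B +
  assumes complete: "\<lbrakk>\<And>k::nat. f k \<in> S; \<And>\<epsilon>. \<epsilon> > 0 \<Longrightarrow> \<exists>N. \<forall>i\<ge>N. \<forall>j\<ge>N. B (f i - f j) (f i - f j) < \<epsilon>\<rbrakk>
      \<Longrightarrow> \<exists>x\<in>S. (\<lambda>k. B (f k - x) (f k - x)) \<longlonglongrightarrow> 0"
begin

lemma complete_nrm:
  assumes f: "\<And>k::nat. f k \<in> S"
    and c: "\<And>\<epsilon>. \<epsilon> > 0 \<Longrightarrow> \<exists>N. \<forall>i\<ge>N. \<forall>j\<ge>N. nrm (f i - f j) < \<epsilon>"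
  shows "\<exists>x\<in>S. (\<lambda>k. nrm (f k - x)) \<longlonglongrightarrow> 0"
proof -
  have "\<exists>N. \<forall>i\<ge>N. \<forall>j\<ge>N. B (f i - f j) (f i - f j) < \<epsilon>" if "\<epsilon> > 0" for \<epsilon>
    using c[of "sqrt \<epsilon>"] that by (simp add: nrm_def)
  from complete[OF f this] obtain x where x: "x \<in> S" "(\<lambda>k. B (f k - x) (f k - x)) \<longlonglongrightarrow> 0" by blast
  have "(\<lambda>k. nrm (f k - x)) \<longlonglongrightarrow> 0"
    unfolding nrm_def using tendsto_real_sqrt[OF x(2)] by simp
  with x(1) show ?thesis by blast
qed

text \<open>The representative is a minimiser of \<open>J v = B v v - 2 * F v\<close>. Completing
  the square bounds \<open>J\<close> below, the parallelogram identity makes a minimising sequence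
  Cauchy, and the first order condition at the limit is the claim. Degeneracy does no harm, because
  the bound on \<open>F\<close> by \<open>nrm\<close> makes \<open>F\<close> vanish wherever
  \<open>nrm\<close> does.\<close>

lemma riesz:
  assumes Fadd: "\<And>u v. \<lbrakk>u \<in> S; v \<in> S\<rbrakk> \<Longrightarrow> F (u + v) = F u + F v"
    and Fscale: "\<And>u c. u \<in> S \<Longrightarrow> F (c *\<^sub>R u) = c * F u"
    and Fbd: "\<And>u. u \<in> S \<Longrightarrow> \<bar>F u\<bar> \<le> C * nrm u"
  shows "\<exists>g\<in>S. \<forall>v\<in>S. B g v = F v"
proof -
  define J where "J v = B v v - 2 * F v" for v
  have Fdiff: "F (u - v) = F u - F v" if "u \<in> S" "v \<in> S" for u v
    using Fadd[of u "- v"] Fscale[of v "-1"] that by simp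
  have low: "- (C\<^sup>2) \<le> J v" if v: "v \<in> S" for v
  proof -
    have "J v \<ge> (nrm v)\<^sup>2 - 2 * (C * nrm v)"
      using Fbd[OF v] v by (simp add: J_def nrm_sq)
    moreover have "0 \<le> (nrm v - C)\<^sup>2" by simp
    ultimately show ?thesis by (simp add: power2_diff algebra_simps)
  qed
  define m where "m = Inf (J ` S)"
  have bdd: "bdd_below (J ` S)" using low by (auto intro!: bdd_belowI)
  have mle: "m \<le> J v" if "v \<in> S" for v
    unfolding m_def using that bdd by (intro cInf_lower) auto
  have "\<exists>v\<in>S. J v < m + 1 / real (Suc k)" for k
  proof -
    have "Inf (J ` S) < m + 1 / real (Suc k)" by (simp add: m_def)
    from cInf_lessD[OF _ this] show ?thesis using mem_zero by blast
  qed
  then obtain f where f: "\<And>k. f k \<in> S" and fJ: "\<And>k. J (f k) < m + 1 / real (Suc k)" by metis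
  have par: "B (a - b) (a - b) \<le> 2 * (J a - m) + 2 * (J b - m)" if a: "a \<in> S" and b: "b \<in> S" for a b
  proof -
    have "B (a - b) (a - b) = 2 * J a + 2 * J b - 4 * J ((1/2) *\<^sub>R (a + b))"
      using a b by (simp add: J_def bil Fadd Fscale sym[of b a] algebra_simps)
    moreover have "m \<le> J ((1/2) *\<^sub>R (a + b))" using a b by (intro mle) simp
    ultimately show ?thesis by simp
  qed
  have "\<exists>N. \<forall>i\<ge>N. \<forall>j\<ge>N. B (f i - f j) (f i - f j) < \<epsilon>" if e: "\<epsilon> > 0" for \<epsilon>
  proof -
    obtain N where N: "1 / real (Suc N) < \<epsilon> / 4" using e nat_approx_posE[of "\<epsilon>/4"] by auto
    have small: "J (f i) - m < \<epsilon> / 4" if "i \<ge> N" for i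
    proof -
      have "1 / real (Suc i) \<le> 1 / real (Suc N)" using that by (simp add: frac_le)
      with fJ[of i] N show ?thesis by linarith
    qed
    have "B (f i - f j) (f i - f j) < \<epsilon>" if "i \<ge> N" "j \<ge> N" for i j
      using par[OF f f, of i j] small[OF that(1)] small[OF that(2)] by argo
    thus ?thesis by blast
  qed
  from complete[OF f this] obtain g where g: "g \<in> S" and lim: "(\<lambda>k. B (f k - g) (f k - g)) \<longlonglongrightarrow> 0" by blast
  have nl: "(\<lambda>k. nrm (f k - g)) \<longlonglongrightarrow> 0"
    unfolding nrm_def using tendsto_real_sqrt[OF lim] by simp
  have eq: "J (f k) = J g + B (f k - g) (f k - g) + 2 * B g (f k - g) - 2 * F (f k - g)" for k
    using f[of k] g by (simp add: J_def bil Fdiff sym[of g "f k"])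
  have l2: "(\<lambda>k. B g (f k - g)) \<longlonglongrightarrow> 0"
  proof (rule tendsto_0_le[where K = "nrm g"])
    show "(\<lambda>k. nrm (f k - g)) \<longlonglongrightarrow> 0" by (rule nl)
    show "\<forall>\<^sub>F k in sequentially. norm (B g (f k - g)) \<le> norm (nrm (f k - g)) * nrm g"
      using cauchy_schwarz[OF g, of "f k - g" for k] f g by (intro always_eventually) (simp add: mult.commute)
  qed
  have l3: "(\<lambda>k. F (f k - g)) \<longlonglongrightarrow> 0"
  proof (rule tendsto_0_le[where K = C])
    show "(\<lambda>k. nrm (f k - g)) \<longlonglongrightarrow> 0" by (rule nl)
    show "\<forall>\<^sub>F k in sequentially. norm (F (f k - g)) \<le> norm (nrm (f k - g)) * C"
      using Fbd f g by (auto simp: mult.commute)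
  qed
  have "(\<lambda>k. J g + B (f k - g) (f k - g) + 2 * B g (f k - g) - 2 * F (f k - g)) \<longlonglongrightarrow> J g + 0 + 2 * 0 - 2 * 0"
    by (intro tendsto_intros lim l2 l3)
  hence Jl: "(\<lambda>k. J (f k)) \<longlonglongrightarrow> J g" by (simp add: eq)
  have "(\<lambda>k. m + 1 / real (Suc k)) \<longlonglongrightarrow> m + 0"
    by (intro tendsto_add tendsto_const LIMSEQ_Suc[OF lim_1_over_n])
  hence Jg: "J g \<le> m"
    using LIMSEQ_le[OF Jl, of "\<lambda>k. m + 1 / real (Suc k)" m] fJ by (auto simp: less_imp_le)
  have "B g v = F v" if v: "v \<in> S" for v
  proof -
    define d where "d = B g v - F v"
    have pos: "0 \<le> t\<^sup>2 * B v v + 2 * t * d" for t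
    proof -
      have "J (g + t *\<^sub>R v) = J g + t\<^sup>2 * B v v + 2 * t * d"
        using g v by (simp add: J_def d_def bil Fadd Fscale sym[of v g] power2_eq_square algebra_simps)
      moreover have "m \<le> J (g + t *\<^sub>R v)" using g v by (intro mle) simp
      ultimately show ?thesis using Jg by simp
    qed
    \<comment> \<open>Nearly the minimiser of the quadratic in \<open>pos\<close>; the added 1 keeps
      the denominator positive when \<open>B v v = 0\<close>. The outcome \<open>t = 0\<close> is
      equivalent to \<open>d = 0\<close>.\<close>
    define t where "t = - d / (B v v + 1)"
    have p: "B v v + 1 > 0" using nonneg[OF v] by simp
    have td: "d = - t * (B v v + 1)" using p by (simp add: t_def)
    have "0 \<le> t\<^sup>2 * B v v - 2 * t\<^sup>2 * (B v v + 1)"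
      using pos[of t] unfolding td by (simp add: power2_eq_square algebra_simps)
    hence "t\<^sup>2 * (B v v + 2) \<le> 0" by (simp add: algebra_simps)
    moreover have "0 \<le> t\<^sup>2 * (B v v + 2)" using nonneg[OF v] by simp
    ultimately have "t\<^sup>2 * (B v v + 2) = 0" by linarith
    hence "t = 0" using nonneg[OF v] by auto
    thus ?thesis using td by (simp add: d_def)
  qed
  thus ?thesis using g by blast
qed

end

text \<open>\<open>G\<close> plays the role of the gradient of \<open>I\<close>. Both uniformity
  assumptions concern bounded sets: the one on \<open>I\<close> yields a single step size that works
  for all points of a bounded path at once, and the one on \<open>G\<close> makes a gradient step
  map paths to paths.\<close>

locale smooth_functional = semi_hilbert S B for S :: "'v::real_vector set" and B +
  fixes I :: "'v \<Rightarrow> real" and G :: "'v \<Rightarrow> 'v"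
  assumes G_mem [simp]: "u \<in> S \<Longrightarrow> G u \<in> S"
    and G_unif: "\<epsilon> > 0 \<Longrightarrow> \<exists>\<delta>>0. \<forall>u\<in>S. \<forall>v\<in>S. nrm u \<le> R \<and> nrm v \<le> R \<and> nrm (u - v) \<le> \<delta> \<longrightarrow> nrm (G u - G v) \<le> \<epsilon>"
    and I_unif: "\<epsilon> > 0 \<Longrightarrow> \<exists>\<delta>>0. \<forall>u\<in>S. \<forall>v\<in>S. nrm u \<le> R \<and> nrm v \<le> \<delta> \<longrightarrow> \<bar>I (u + v) - I u - B (G u) v\<bar> \<le> \<epsilon> * nrm v"
begin

lemma tendsto_G:
  assumes ev: "\<forall>\<^sub>F s in Z. f s \<in> S" and x: "x \<in> S" and lim: "((\<lambda>s. nrm (f s - x)) \<longlongrightarrow> 0) Z"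
  shows "((\<lambda>s. nrm (G (f s) - G x)) \<longlongrightarrow> 0) Z"
proof (rule tendstoI)
  fix e :: real assume e: "e > 0"
  obtain d where d: "d > 0" and dd: "\<And>u v. \<lbrakk>u \<in> S; v \<in> S; nrm u \<le> nrm x + 1; nrm v \<le> nrm x + 1; nrm (u - v) \<le> d\<rbrakk> \<Longrightarrow> nrm (G u - G v) \<le> e / 2"
    using G_unif[of "e / 2" "nrm x + 1"] e by (metis half_gt_zero)
  have "\<forall>\<^sub>F s in Z. dist (nrm (f s - x)) 0 < min d 1" using lim d by (intro tendstoD) auto
  thus "\<forall>\<^sub>F s in Z. dist (nrm (G (f s) - G x)) 0 < e"
    using ev
  proof eventually_elim
    case (elim s)
    hence "nrm (f s) \<le> nrm x + 1" using nrm_diff_ineq[of "f s" x] x by auto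
    hence "nrm (G (f s) - G x) \<le> e / 2" using elim x by (intro dd) auto
    thus ?case using e elim x by simp
  qed
qed

lemma tendsto_I:
  assumes ev: "\<forall>\<^sub>F s in Z. f s \<in> S" and x: "x \<in> S" and lim: "((\<lambda>s. nrm (f s - x)) \<longlongrightarrow> 0) Z"
  shows "((\<lambda>s. I (f s)) \<longlongrightarrow> I x) Z"
proof -
  obtain d where d: "d > 0" and dd: "\<And>u v. \<lbrakk>u \<in> S; v \<in> S; nrm u \<le> nrm x; nrm v \<le> d\<rbrakk> \<Longrightarrow> \<bar>I (u + v) - I u - B (G u) v\<bar> \<le> 1 * nrm v"
    using I_unif[of 1 "nrm x"] by (metis zero_less_one)
  have "\<forall>\<^sub>F s in Z. dist (nrm (f s - x)) 0 < d" using lim d by (intro tendstoD) auto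
  hence "\<forall>\<^sub>F s in Z. norm (I (f s) - I x) \<le> norm (nrm (f s - x)) * (1 + nrm (G x))"
    using ev
  proof eventually_elim
    case (elim s)
    have "\<bar>I (x + (f s - x)) - I x - B (G x) (f s - x)\<bar> \<le> 1 * nrm (f s - x)"
      using elim x by (intro dd) auto
    moreover have "\<bar>B (G x) (f s - x)\<bar> \<le> nrm (G x) * nrm (f s - x)"
      using elim x by (intro cauchy_schwarz) auto
    ultimately show ?case using elim x by (simp add: algebra_simps)
  qed
  hence "((\<lambda>s. I (f s) - I x) \<longlongrightarrow> 0) Z" by (rule tendsto_0_le[OF lim])
  thus ?thesis using Lim_null by blast
qed

text \<open>Continuity is expressed through \<open>nrm\<close>, since the type of vectors carries no
  topology that matches \<open>B\<close>.\<close>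

definition curve :: "'v \<Rightarrow> (real \<Rightarrow> 'v) \<Rightarrow> bool" where
  "curve e p \<longleftrightarrow> p 0 = 0 \<and> p 1 = e \<and> (\<forall>s\<in>{0..1}. p s \<in> S \<and> ((\<lambda>s'. nrm (p s' - p s)) \<longlongrightarrow> 0) (at s within {0..1}))"

lemma
  assumes "curve e p"
  shows curve_mem: "\<And>s. s \<in> {0..1} \<Longrightarrow> p s \<in> S"
    and curve_start: "p 0 = 0" and curve_end: "p 1 = e"
    and curve_lim: "\<And>s. s \<in> {0..1} \<Longrightarrow> ((\<lambda>s'. nrm (p s' - p s)) \<longlongrightarrow> 0) (at s within {0..1})"
    and curve_ev: "\<And>s. \<forall>\<^sub>F s' in at s within {0..1}. p s' \<in> S"
    and curve_nrm: "continuous_on {0..1} (\<lambda>s. nrm (p s))"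
    and curve_I: "continuous_on {0..1} (\<lambda>s. I (p s))"
proof -
  show m: "\<And>s. s \<in> {0..1} \<Longrightarrow> p s \<in> S"
    and "p 0 = 0" "p 1 = e"
    and l: "\<And>s. s \<in> {0..1} \<Longrightarrow> ((\<lambda>s'. nrm (p s' - p s)) \<longlongrightarrow> 0) (at s within {0..1})"
    using assms by (auto simp: curve_def)
  show ev: "\<And>s. \<forall>\<^sub>F s' in at s within {0..1}. p s' \<in> S"
    using m by (auto simp: eventually_at_filter)
  show "continuous_on {0..1} (\<lambda>s. nrm (p s))"
    unfolding continuous_on_def using tendsto_nrm[OF ev m l] by blast
  show "continuous_on {0..1} (\<lambda>s. I (p s))"
    unfolding continuous_on_def using tendsto_I[OF ev m l] by blast
qed

text \<open>Every admissible path crosses the sphere of radius \<open>r\<close>, so the minimax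
  level is at least \<rho>. If no point within \<epsilon> of that level were \<epsilon>-critical,
  gradient steps could lower a nearly optimal path strictly below the level.\<close>

lemma mountain_pass:
  assumes I0: "I 0 = 0" and r: "r > 0" and rho: "\<rho> > 0"
    and sphere: "\<And>u. \<lbrakk>u \<in> S; nrm u = r\<rbrakk> \<Longrightarrow> \<rho> \<le> I u"
    and e: "e \<in> S" "nrm e > r" "I e \<le> 0"
  shows "\<exists>c\<ge>\<rho>. \<forall>\<epsilon>>0. \<exists>u\<in>S. \<bar>I u - c\<bar> \<le> \<epsilon> \<and> nrm (G u) \<le> \<epsilon>"
proof -
  \<comment> \<open>All upper bounds of \<open>I\<close> along paths are collected, rather than the
    maxima; the infimum is the same minimax level, and membership of a smaller bound is easy to
    exhibit.\<close>
  define A where "A = {b. \<exists>p. curve e p \<and> (\<forall>s\<in>{0..1}. I (p s) \<le> b)}"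
  have low: "\<rho> \<le> b" if "b \<in> A" for b
  proof -
    from that obtain p where p: "curve e p" and b: "\<And>s. s \<in> {0..1} \<Longrightarrow> I (p s) \<le> b" by (auto simp: A_def)
    have "\<exists>s\<ge>0. s \<le> 1 \<and> nrm (p s) = r"
      by (rule IVT') (use curve_start[OF p] curve_end[OF p] r e curve_nrm[OF p] in auto)
    then obtain s where "s \<in> {0..1}" "nrm (p s) = r" by auto
    thus ?thesis using sphere[of "p s"] b[of s] curve_mem[OF p] by force
  qed
  have bdd: "bdd_below A" using low by (rule bdd_belowI)
  have line: "curve e (\<lambda>s. s *\<^sub>R e)"
  proof -
    have "((\<lambda>s'. nrm (s' *\<^sub>R e - s *\<^sub>R e)) \<longlongrightarrow> 0) (at s within {0..1})" for s
    proof -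
      have "((\<lambda>s'. \<bar>s' - s\<bar> * nrm e) \<longlongrightarrow> \<bar>s - s\<bar> * nrm e) (at s within {0..1})" by (intro tendsto_intros)
      thus ?thesis using e(1) by (simp flip: scaleR_left_diff_distrib add: nrm_scale)
    qed
    thus ?thesis using e by (auto simp: curve_def)
  qed
  obtain b where "b \<in> A"
  proof -
    have "compact ((\<lambda>s. I (s *\<^sub>R e)) ` {0..1})"
      by (rule compact_continuous_image[OF curve_I[OF line]]) auto
    hence "bdd_above ((\<lambda>s. I (s *\<^sub>R e)) ` {0..1})"
      by (intro bounded_imp_bdd_above compact_imp_bounded)
    then obtain b where "\<forall>s\<in>{0..1}. I (s *\<^sub>R e) \<le> b" unfolding bdd_above_def by blast
    with line have "b \<in> A" unfolding A_def by blast
    thus ?thesis by (rule that)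
  qed
  hence ne: "A \<noteq> {}" by auto
  define c where "c = Inf A"
  have c: "\<rho> \<le> c" unfolding c_def using ne low by (intro cInf_greatest)
  have "\<exists>u\<in>S. \<bar>I u - c\<bar> \<le> \<epsilon> \<and> nrm (G u) \<le> \<epsilon>" if \<epsilon>: "\<epsilon> > 0" for \<epsilon>
  proof (rule ccontr)
    assume "\<not> ?thesis"
    hence big: "\<And>u. \<lbrakk>u \<in> S; \<bar>I u - c\<bar> \<le> \<epsilon>\<rbrakk> \<Longrightarrow> \<epsilon> < nrm (G u)" by force
    \<comment> \<open>\<open>\<eta> \<le> \<epsilon>\<close> places the slab of energies between
      \<open>c - \<eta>\<close> and \<open>c + \<eta>\<close> where the gradient is large;
      \<open>\<eta> < \<rho>\<close> gives \<open>c - \<eta> > 0\<close>, so that the end points,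
      with energy at most 0, are never moved.\<close>
    define \<eta> where "\<eta> = min \<epsilon> (\<rho> / 2)"
    have \<eta>: "\<eta> > 0" "\<eta> \<le> \<epsilon>" "\<eta> < \<rho>" using \<epsilon> rho by (auto simp: \<eta>_def)
    have "Inf A < c + \<eta>" using \<eta> by (simp add: c_def)
    from cInf_lessD[OF ne this] obtain b' where b': "b' \<in> A" "b' < c + \<eta>" by blast
    then obtain p where p: "curve e p" and pb: "\<forall>s\<in>{0..1}. I (p s) \<le> b'" by (auto simp: A_def)
    have pI: "I (p s) \<le> c + \<eta>" if "s \<in> {0..1}" for s using pb b' that by force
    have "compact ((\<lambda>s. nrm (p s)) ` {0..1})"
      by (rule compact_continuous_image[OF curve_nrm[OF p]]) auto
    hence "bdd_above ((\<lambda>s. nrm (p s)) ` {0..1})"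
      by (intro bounded_imp_bdd_above compact_imp_bounded)
    then obtain R0 where R0: "\<And>s. s \<in> {0..1} \<Longrightarrow> nrm (p s) \<le> R0" unfolding bdd_above_def by blast
    \<comment> \<open>The total length of the deformation. Travelling a unit of length lowers the
      energy by at least \<open>\<epsilon> / 2\<close>, so length \<open>T\<close> lowers it by
      \<open>3 * \<eta> / 2\<close>, from \<open>c + \<eta>\<close> to
      \<open>c - \<eta> / 2\<close>. The ball of radius \<open>R0 + T\<close> contains all
      intermediate paths.\<close>
    define T where "T = 3 * \<eta> / \<epsilon>"
    have T: "T > 0" using \<eta> \<epsilon> by (simp add: T_def)
    define R where "R = R0 + T"
    obtain d where d: "d > 0" and dd: "\<And>u v. \<lbrakk>u \<in> S; v \<in> S; nrm u \<le> R; nrm v \<le> d\<rbrakk> \<Longrightarrow> \<bar>I (u + v) - I u - B (G u) v\<bar> \<le> \<epsilon> / 2 * nrm v"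
      using I_unif[of "\<epsilon> / 2" R] \<epsilon> by (metis half_gt_zero)
    obtain N :: nat where N: "N > 0" "T / real N \<le> d"
    proof -
      obtain N :: nat where "T / d < real N" using reals_Archimedean2 by blast
      hence N: "T < real N * d" using d by (simp add: field_simps)
      hence "N > 0" using T by (cases N) auto
      thus ?thesis using N by (intro that[of N]) (auto simp: field_simps)
    qed
    define h where "h = T / real N"
    have h: "h > 0" "h \<le> d" "real N * h = T" using N T by (auto simp: h_def)
    \<comment> \<open>A continuous cutoff in the energy: 0 below \<open>c - \<eta>\<close> and 1
      above \<open>c - \<eta> / 2\<close>. In \<open>a\<close> the maximum with \<epsilon> keeps the
      normalising factor positive everywhere; at the energies where the step acts the gradient
      exceeds \<epsilon>, so the step there has length exactly \<open>h * cut u\<close>.\<close>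
    define cut where "cut u = max 0 (min 1 ((I u - (c - \<eta>)) / (\<eta> / 2)))" for u
    define a where "a u = h * cut u / max \<epsilon> (nrm (G u))" for u
    define Q where "Q u = u - a u *\<^sub>R G u" for u
    have cut_range: "0 \<le> cut u" "cut u \<le> 1" for u by (auto simp: cut_def)
    have cut_low: "cut u = 0" if "I u \<le> c - \<eta>" for u
    proof -
      have "(I u - (c - \<eta>)) / (\<eta> / 2) \<le> 0" using that \<eta> by (intro divide_nonpos_pos) auto
      thus ?thesis by (simp add: cut_def)
    qed
    have cut_zero: "cut u = 0" if "I u \<le> 0" for u
      using that \<eta> c by (intro cut_low) simp
    have Qmem [simp]: "Q u \<in> S" if "u \<in> S" for u using that by (simp add: Q_def)
    have Qnrm: "nrm (a u *\<^sub>R G u) \<le> h * cut u" if u: "u \<in> S" for u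
    proof -
      have "nrm (a u *\<^sub>R G u) = \<bar>a u\<bar> * nrm (G u)" using u by (simp add: nrm_scale)
      also have "\<dots> = h * cut u * (nrm (G u) / max \<epsilon> (nrm (G u)))"
        using h cut_range[of u] \<epsilon> by (simp add: a_def abs_mult abs_div)
      also have "\<dots> \<le> h * cut u * 1"
        using h cut_range[of u] \<epsilon> u by (intro mult_left_mono) (auto simp: divide_le_eq)
      finally show ?thesis by simp
    qed
    \<comment> \<open>The linear term contributes at most \<open>- h * cut u * \<epsilon>\<close>,
      and the choice of \<open>d\<close> with tolerance \<open>\<epsilon> / 2\<close> lets the
      remainder give back no more than half of it.\<close>
    have dec: "I (Q u) \<le> I u - h * cut u * \<epsilon> / 2" if u: "u \<in> S" "nrm u \<le> R" "I u \<le> c + \<eta>" for u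
    proof (cases "cut u = 0")
      case True
      thus ?thesis by (simp add: Q_def a_def)
    next
      case False
      hence "I u > c - \<eta>" using cut_low[of u] by linarith
      hence "\<bar>I u - c\<bar> \<le> \<epsilon>" using u \<eta> by auto
      hence g: "\<epsilon> < nrm (G u)" using big u by blast
      have "nrm (- (a u *\<^sub>R G u)) \<le> h * cut u" using Qnrm u by simp
      moreover have "h * cut u \<le> h * 1" using h cut_range by (intro mult_left_mono) auto
      ultimately have nd: "nrm (- (a u *\<^sub>R G u)) \<le> d" using h by linarith
      have "\<bar>I (u + - (a u *\<^sub>R G u)) - I u - B (G u) (- (a u *\<^sub>R G u))\<bar> \<le> \<epsilon> / 2 * nrm (- (a u *\<^sub>R G u))"
        by (rule dd) (use u nd in auto)
      also have "\<dots> \<le> \<epsilon> / 2 * (h * cut u)" using Qnrm u \<epsilon> by (intro mult_left_mono) auto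
      finally have "I (u + - (a u *\<^sub>R G u)) \<le> I u + B (G u) (- (a u *\<^sub>R G u)) + \<epsilon> / 2 * (h * cut u)"
        by argo
      hence 1: "I (Q u) \<le> I u + B (G u) (- (a u *\<^sub>R G u)) + \<epsilon> / 2 * (h * cut u)"
        unfolding Q_def by (simp only: diff_conv_add_uminus)
      have "B (G u) (- (a u *\<^sub>R G u)) = - (a u * (nrm (G u))\<^sup>2)"
        using u by (simp add: bil nrm_sq)
      also have "\<dots> = - (h * cut u * nrm (G u))"
        using g \<epsilon> by (simp add: a_def power2_eq_square max_def)
      also have "\<dots> \<le> - (h * cut u * \<epsilon>)" using g h cut_range[of u] by (simp add: mult_left_mono)
      finally show ?thesis using 1 by (simp add: field_simps)
    qed
    have Qcurve: "curve e (\<lambda>s. Q (q s))" if q: "curve e q" for q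
    proof -
      have "((\<lambda>s'. nrm (Q (q s') - Q (q s))) \<longlongrightarrow> 0) (at s within {0..1})" if s: "s \<in> {0..1}" for s
      proof -
        let ?Z = "at s within {0..1}"
        note ev = curve_ev[OF q, of s] and qs = curve_mem[OF q s] and l = curve_lim[OF q s]
        have lG: "((\<lambda>s'. nrm (G (q s') - G (q s))) \<longlongrightarrow> 0) ?Z" by (rule tendsto_G[OF ev qs l])
        have evG: "\<forall>\<^sub>F s' in ?Z. G (q s') \<in> S" using ev by eventually_elim simp
        have lnG: "((\<lambda>s'. nrm (G (q s'))) \<longlongrightarrow> nrm (G (q s))) ?Z"
          by (rule tendsto_nrm[OF evG _ lG]) (use qs in simp)
        have la: "((\<lambda>s'. a (q s')) \<longlongrightarrow> a (q s)) ?Z"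
          unfolding a_def cut_def using \<epsilon> \<eta> by (intro tendsto_intros tendsto_I[OF ev qs l] lnG) auto
        have "((\<lambda>s'. nrm (q s' - q s) + (\<bar>a (q s')\<bar> * nrm (G (q s') - G (q s)) + \<bar>a (q s') - a (q s)\<bar> * nrm (G (q s))))
            \<longlongrightarrow> 0 + (\<bar>a (q s)\<bar> * 0 + \<bar>a (q s) - a (q s)\<bar> * nrm (G (q s)))) ?Z"
          by (intro tendsto_intros la l lG)
        hence lim: "((\<lambda>s'. nrm (q s' - q s) + (\<bar>a (q s')\<bar> * nrm (G (q s') - G (q s)) + \<bar>a (q s') - a (q s)\<bar> * nrm (G (q s)))) \<longlongrightarrow> 0) ?Z"
          by simp
        show ?thesis
        proof (rule tendsto_0_le[where K = 1, OF lim], use ev in eventually_elim)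
          case (elim s')
          let ?x = "q s'" and ?y = "q s"
          have "Q ?x - Q ?y = (?x - ?y) - (a ?x *\<^sub>R (G ?x - G ?y) + (a ?x - a ?y) *\<^sub>R G ?y)"
            by (simp add: Q_def algebra_simps)
          hence "nrm (Q ?x - Q ?y) \<le> nrm (?x - ?y) + nrm (a ?x *\<^sub>R (G ?x - G ?y) + (a ?x - a ?y) *\<^sub>R G ?y)"
            using nrm_triangle_diff[of "?x - ?y" "a ?x *\<^sub>R (G ?x - G ?y) + (a ?x - a ?y) *\<^sub>R G ?y"] elim qs by simp
          also have "\<dots> \<le> nrm (?x - ?y) + (nrm (a ?x *\<^sub>R (G ?x - G ?y)) + nrm ((a ?x - a ?y) *\<^sub>R G ?y))"
            using elim qs by (intro add_left_mono nrm_triangle) auto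
          finally have "nrm (Q ?x - Q ?y) \<le> nrm (?x - ?y) + (\<bar>a ?x\<bar> * nrm (G ?x - G ?y) + \<bar>a ?x - a ?y\<bar> * nrm (G ?y))"
            using elim qs by (simp add: nrm_scale)
          thus ?case using elim qs by simp
        qed
      qed
      moreover have "Q 0 = 0" "Q e = e" using cut_zero I0 e by (auto simp: Q_def a_def)
      ultimately show ?thesis using curve_mem[OF q] curve_start[OF q] curve_end[OF q]
        by (auto simp: curve_def)
    qed
    \<comment> \<open>After \<open>j\<close> steps a point has either dropped below
      \<open>c - \<eta> / 2\<close>, where it stays because steps never raise the energy, or has
      received the full decrease \<open>h * \<epsilon> / 2\<close> each time.\<close>
    have inv: "curve e (\<lambda>s. (Q ^^ j) (p s)) \<and> (\<forall>s\<in>{0..1}. nrm ((Q ^^ j) (p s)) \<le> R0 + j * h \<and>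
        I ((Q ^^ j) (p s)) \<le> max (c - \<eta> / 2) (c + \<eta> - j * h * \<epsilon> / 2))" if "j \<le> N" for j
      using that
    proof (induction j)
      case 0
      thus ?case using p pI R0 by (auto simp: le_max_iff_disj)
    next
      case (Suc j)
      let ?q = "\<lambda>s. (Q ^^ j) (p s)"
      from Suc have q: "curve e ?q" and qn: "\<And>s. s \<in> {0..1} \<Longrightarrow> nrm (?q s) \<le> R0 + j * h"
        and qI: "\<And>s. s \<in> {0..1} \<Longrightarrow> I (?q s) \<le> max (c - \<eta> / 2) (c + \<eta> - j * h * \<epsilon> / 2)" by auto
      have "real j * h \<le> real N * h" using Suc.prems h by (intro mult_right_mono) auto
      hence jh: "R0 + j * h \<le> R" using h by (simp add: R_def)
      have "nrm (Q (?q s)) \<le> R0 + Suc j * h \<and> I (Q (?q s)) \<le> max (c - \<eta> / 2) (c + \<eta> - Suc j * h * \<epsilon> / 2)"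
        if s: "s \<in> {0..1}" for s
      proof
        let ?u = "?q s"
        have u: "?u \<in> S" by (rule curve_mem[OF q s])
        have "nrm (Q ?u) \<le> nrm ?u + nrm (a ?u *\<^sub>R G ?u)" using nrm_triangle_diff[of ?u "a ?u *\<^sub>R G ?u"] u by (simp add: Q_def[of ?u])
        also have "\<dots> \<le> (R0 + j * h) + h * 1"
          using qn[OF s] Qnrm[OF u] mult_left_mono[OF cut_range(2)[of ?u], of h] h by linarith
        finally show "nrm (Q ?u) \<le> R0 + Suc j * h" by (simp add: algebra_simps)
        have pos: "0 \<le> j * h * \<epsilon> / 2" using h \<epsilon> by simp
        have uc: "I ?u \<le> c + \<eta>" using qI[OF s] \<eta> pos by (auto simp: le_max_iff_disj)
        have dd: "I (Q ?u) \<le> I ?u - h * cut ?u * \<epsilon> / 2"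
          using qn[OF s] jh by (intro dec u uc) linarith
        show "I (Q ?u) \<le> max (c - \<eta> / 2) (c + \<eta> - Suc j * h * \<epsilon> / 2)"
        proof (cases "I ?u \<le> c - \<eta> / 2")
          case True
          have "0 \<le> h * cut ?u * \<epsilon> / 2" using h cut_range \<epsilon> by simp
          with dd True show ?thesis by linarith
        next
          case False
          hence "1 \<le> (I ?u - (c - \<eta>)) / (\<eta> / 2)" using \<eta> by (simp add: field_simps)
          hence "cut ?u = 1" by (simp add: cut_def)
          moreover have "I ?u \<le> c + \<eta> - j * h * \<epsilon> / 2" using False qI[OF s] by linarith
          ultimately have "I (Q ?u) \<le> c + \<eta> - Suc j * h * \<epsilon> / 2" using dd by (simp add: field_simps)
          thus ?thesis by simp
        qed
      qed
      thus ?case using Qcurve[OF q] by simp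
    qed
    have "c + \<eta> - N * h * \<epsilon> / 2 = c - \<eta> / 2" using \<epsilon> by (simp add: h T_def)
    hence "\<exists>q. curve e q \<and> (\<forall>s\<in>{0..1}. I (q s) \<le> c - \<eta> / 2)"
      using inv[of N] by (auto intro!: exI[of _ "\<lambda>s. (Q ^^ N) (p s)"])
    hence "c - \<eta> / 2 \<in> A" by (simp add: A_def)
    hence "c \<le> c - \<eta> / 2" unfolding c_def by (intro cInf_lower bdd)
    thus False using \<eta> by simp
  qed
  with c show ?thesis by blast
qed

end


text \<open>With \<open>K u\<close> a Riesz representative of \<open>F u\<close>, the gradient of
  \<open>B u u / 2 - \<Psi> u\<close> is \<open>u - K u\<close>. Along a Palais--Smale sequence
  \<open>u - K u\<close> tends to zero and \<open>K u\<close> has a Cauchy subsequence, hence so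
  does \<open>u\<close>. The positive energy in the conclusion is kept because it is what certifies
  nontriviality later.\<close>

lemma (in semi_hilbert) mountain_pass_compact:
  fixes \<Psi> :: "'v \<Rightarrow> real" and F :: "'v \<Rightarrow> 'v \<Rightarrow> real"
  assumes Fadd: "\<And>u v w. \<lbrakk>u \<in> S; v \<in> S; w \<in> S\<rbrakk> \<Longrightarrow> F u (v + w) = F u v + F u w"
    and Fscale: "\<And>u v c. \<lbrakk>u \<in> S; v \<in> S\<rbrakk> \<Longrightarrow> F u (c *\<^sub>R v) = c * F u v"
    and Fbd: "\<And>u. u \<in> S \<Longrightarrow> \<exists>C. \<forall>v\<in>S. \<bar>F u v\<bar> \<le> C * nrm v"
    and F_unif: "\<And>R \<epsilon>. \<epsilon> > 0 \<Longrightarrow> \<exists>\<delta>>0. \<forall>u\<in>S. \<forall>u'\<in>S. nrm u \<le> R \<and> nrm u' \<le> R \<and> nrm (u - u') \<le> \<delta>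
      \<longrightarrow> (\<forall>v\<in>S. \<bar>F u v - F u' v\<bar> \<le> \<epsilon> * nrm v)"
    and F_compact: "\<And>R f. \<lbrakk>\<And>k::nat. f k \<in> S; \<And>k. nrm (f k) \<le> R\<rbrakk> \<Longrightarrow>
      \<exists>s :: nat \<Rightarrow> nat. strict_mono s \<and> (\<forall>\<epsilon>>0. \<exists>N. \<forall>i\<ge>N. \<forall>j\<ge>N. \<forall>v\<in>S. \<bar>F (f (s i)) v - F (f (s j)) v\<bar> \<le> \<epsilon> * nrm v)"
    and \<Psi>_unif: "\<And>R \<epsilon>. \<epsilon> > 0 \<Longrightarrow> \<exists>\<delta>>0. \<forall>u\<in>S. \<forall>v\<in>S. nrm u \<le> R \<and> nrm v \<le> \<delta>
      \<longrightarrow> \<bar>\<Psi> (u + v) - \<Psi> u - F u v\<bar> \<le> \<epsilon> * nrm v"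
    and \<mu>: "\<mu> > 2" and AR: "\<And>u. u \<in> S \<Longrightarrow> \<mu> * \<Psi> u \<le> F u u"
    and \<Psi>0: "\<Psi> 0 = 0" and r: "r > 0" and rho: "\<rho> > 0"
    and sphere: "\<And>u. \<lbrakk>u \<in> S; nrm u = r\<rbrakk> \<Longrightarrow> \<rho> \<le> B u u / 2 - \<Psi> u"
    and e: "e \<in> S" "nrm e > r" "B e e / 2 - \<Psi> e \<le> 0"
  shows "\<exists>u\<in>S. 0 < B u u / 2 - \<Psi> u \<and> (\<forall>v\<in>S. B u v = F u v)"
proof -
  have "\<exists>k\<in>S. \<forall>v\<in>S. B k v = F u v" if u: "u \<in> S" for u
  proof -
    obtain C where "\<And>v. v \<in> S \<Longrightarrow> \<bar>F u v\<bar> \<le> C * nrm v" using Fbd[OF u] by blast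
    thus ?thesis by (intro riesz Fadd Fscale u)
  qed
  then obtain K where K [simp]: "\<And>u. u \<in> S \<Longrightarrow> K u \<in> S"
    and KF: "\<And>u v. \<lbrakk>u \<in> S; v \<in> S\<rbrakk> \<Longrightarrow> B (K u) v = F u v" by metis
  \<comment> \<open>The dual norm estimate is tested with \<open>K u - K u'\<close> itself and
    divided by its length.\<close>
  have Kdiff: "nrm (K u - K u') \<le> \<epsilon>"
    if u: "u \<in> S" "u' \<in> S" and b: "\<And>v. v \<in> S \<Longrightarrow> \<bar>F u v - F u' v\<bar> \<le> \<epsilon> * nrm v" and \<epsilon>: "\<epsilon> > 0" for u u' \<epsilon>
  proof (cases "nrm (K u - K u') = 0")
    case False
    have d: "K u - K u' \<in> S" using u by simp
    hence p: "nrm (K u - K u') > 0" using False nrm_nonneg[OF d] by linarith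
    have "nrm (K u - K u') * nrm (K u - K u') = B (K u - K u') (K u - K u')"
      using nrm_sq[OF d] by (simp add: power2_eq_square)
    also have "\<dots> = F u (K u - K u') - F u' (K u - K u')"
      using u d KF by (simp add: diff_left[of "K u" "K u'" "K u - K u'"])
    also have "\<dots> \<le> \<epsilon> * nrm (K u - K u')" using b[OF d] by linarith
    finally show ?thesis using p by simp
  qed (use \<epsilon> in simp)
  define I where "I u = B u u / 2 - \<Psi> u" for u
  define G where "G u = u - K u" for u
  interpret smooth_functional S B I G
  proof
    show "G u \<in> S" if "u \<in> S" for u using that by (simp add: G_def)
  next
    fix \<epsilon> R :: real assume \<epsilon>: "\<epsilon> > 0"
    then obtain d where d: "d > 0" "\<And>u u' v. \<lbrakk>u \<in> S; u' \<in> S; nrm u \<le> R; nrm u' \<le> R; nrm (u - u') \<le> d; v \<in> S\<rbrakk>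
        \<Longrightarrow> \<bar>F u v - F u' v\<bar> \<le> \<epsilon> / 2 * nrm v"
      using F_unif[of "\<epsilon> / 2" R] by (metis half_gt_zero)
    have "nrm (G u - G v) \<le> \<epsilon>" if u: "u \<in> S" "v \<in> S" "nrm u \<le> R" "nrm v \<le> R" "nrm (u - v) \<le> min d (\<epsilon> / 2)" for u v
    proof -
      have "nrm (K u - K v) \<le> \<epsilon> / 2" using u \<epsilon> d by (intro Kdiff) auto
      moreover have "G u - G v = (u - v) - (K u - K v)" by (simp add: G_def)
      ultimately show ?thesis using nrm_triangle_diff[of "u - v" "K u - K v"] u by simp
    qed
    thus "\<exists>\<delta>>0. \<forall>u\<in>S. \<forall>v\<in>S. nrm u \<le> R \<and> nrm v \<le> R \<and> nrm (u - v) \<le> \<delta> \<longrightarrow> nrm (G u - G v) \<le> \<epsilon>"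
      using \<epsilon> d(1) by (intro exI[of _ "min d (\<epsilon> / 2)"]) auto
  next
    fix \<epsilon> R :: real assume \<epsilon>: "\<epsilon> > 0"
    then obtain d where d: "d > 0" "\<And>u v. \<lbrakk>u \<in> S; v \<in> S; nrm u \<le> R; nrm v \<le> d\<rbrakk>
        \<Longrightarrow> \<bar>\<Psi> (u + v) - \<Psi> u - F u v\<bar> \<le> \<epsilon> / 2 * nrm v"
      using \<Psi>_unif[of "\<epsilon> / 2" R] by (metis half_gt_zero)
    have "\<bar>I (u + v) - I u - B (G u) v\<bar> \<le> \<epsilon> * nrm v" if u: "u \<in> S" "v \<in> S" "nrm u \<le> R" "nrm v \<le> min d \<epsilon>" for u v
    proof -
      \<comment> \<open>The quadratic part has the exact remainder \<open>(nrm v)^2 / 2\<close>,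
        which explains the bound \<epsilon> on \<open>nrm v\<close> beside \<open>d\<close>.\<close>
      have "I (u + v) - I u - B (G u) v = (nrm v)\<^sup>2 / 2 - (\<Psi> (u + v) - \<Psi> u - F u v)"
        using u by (simp add: I_def G_def bil nrm_sq KF sym[of v u] field_simps)
      moreover have "(nrm v)\<^sup>2 \<le> \<epsilon> * nrm v" using u by (simp add: power2_eq_square mult_right_mono)
      moreover have "\<bar>\<Psi> (u + v) - \<Psi> u - F u v\<bar> \<le> \<epsilon> / 2 * nrm v" using u by (intro d) auto
      moreover have "0 \<le> (nrm v)\<^sup>2" by simp
      ultimately show ?thesis by argo
    qed
    thus "\<exists>\<delta>>0. \<forall>u\<in>S. \<forall>v\<in>S. nrm u \<le> R \<and> nrm v \<le> \<delta> \<longrightarrow> \<bar>I (u + v) - I u - B (G u) v\<bar> \<le> \<epsilon> * nrm v"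
      using \<epsilon> d(1) by (intro exI[of _ "min d \<epsilon>"]) auto
  qed
  have "\<exists>c\<ge>\<rho>. \<forall>\<epsilon>>0. \<exists>u\<in>S. \<bar>I u - c\<bar> \<le> \<epsilon> \<and> nrm (G u) \<le> \<epsilon>"
    by (rule mountain_pass[OF _ r rho _ e(1,2)]) (use sphere e \<Psi>0 in \<open>auto simp: I_def\<close>)
  then obtain c where c: "c \<ge> \<rho>" and ps: "\<And>\<epsilon>. \<epsilon> > 0 \<Longrightarrow> \<exists>u\<in>S. \<bar>I u - c\<bar> \<le> \<epsilon> \<and> nrm (G u) \<le> \<epsilon>" by blast
  have "\<exists>u\<in>S. \<bar>I u - c\<bar> \<le> 1 / real (Suc k) \<and> nrm (G u) \<le> 1 / real (Suc k)" for k
    by (rule ps) simp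
  then obtain f where f [simp]: "\<And>k. f k \<in> S" and fI: "\<And>k. \<bar>I (f k) - c\<bar> \<le> 1 / real (Suc k)"
    and fG: "\<And>k. nrm (G (f k)) \<le> 1 / real (Suc k)" by metis
  \<comment> \<open>The Ambrosetti--Rabinowitz gap: \<open>I u - B (G u) u / \<mu>\<close> is at
    least \<open>q\<close> times the squared norm, so energy at most \<open>c + 1\<close> and
    gradient at most 1 bound the norm. In \<open>R\<close> the last summand covers points of norm at
    most 1; for the others \<open>c + 1 \<le> (c + 1) * nrm u\<close> allows one factor of the norm
    to be cancelled.\<close>
  define q where "q = 1/2 - 1/\<mu>"
  have q: "q > 0" using \<mu> by (simp add: q_def field_simps)
  define R where "R = (c + 1) / q + 1 / (\<mu> * q) + 1"
  have bd: "nrm (f k) \<le> R" for k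
  proof (cases "nrm (f k) \<le> 1")
    case True
    have "0 \<le> (c + 1) / q + 1 / (\<mu> * q)" using c rho q \<mu> by simp
    thus ?thesis using True by (simp add: R_def)
  next
    case False
    let ?n = "nrm (f k)"
    have k1: "1 / real (Suc k) \<le> 1" by simp
    have "\<bar>B (G (f k)) (f k)\<bar> \<le> nrm (G (f k)) * ?n" by (intro cauchy_schwarz) auto
    also have "\<dots> \<le> 1 * ?n" using order_trans[OF fG[of k] k1] by (intro mult_right_mono) auto
    finally have 1: "B (G (f k)) (f k) \<ge> - ?n" by linarith
    have 2: "B (G (f k)) (f k) = ?n\<^sup>2 - F (f k) (f k)" by (simp add: G_def bil KF nrm_sq)
    have 3: "?n\<^sup>2 / 2 - \<Psi> (f k) \<le> c + 1" using order_trans[OF fI[of k] k1] by (simp add: I_def nrm_sq)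
    have "\<Psi> (f k) \<le> (?n\<^sup>2 + ?n) / \<mu>" using AR[of "f k"] 1 2 \<mu> by (simp add: field_simps)
    hence "q * ?n\<^sup>2 \<le> c + 1 + ?n / \<mu>" using 3 by (simp add: q_def algebra_simps add_divide_distrib)
    also have "\<dots> \<le> (c + 1) * ?n + ?n / \<mu>" using False c rho by (simp add: mult_le_cancel_left1)
    finally have "?n * (q * ?n) \<le> ?n * ((c + 1) + 1 / \<mu>)" by (simp add: power2_eq_square algebra_simps)
    hence "q * ?n \<le> (c + 1) + 1 / \<mu>" using False by (subst (asm) mult_le_cancel_left_pos) auto
    hence "?n \<le> ((c + 1) + 1 / \<mu>) / q" using q by (simp add: field_simps)
    also have "\<dots> \<le> R" using q \<mu> by (simp add: R_def add_divide_distrib)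
    finally show ?thesis .
  qed
  obtain s :: "nat \<Rightarrow> nat" where s: "strict_mono s" and sF: "\<And>\<epsilon>. \<epsilon> > 0 \<Longrightarrow> \<exists>N. \<forall>i\<ge>N. \<forall>j\<ge>N. \<forall>v\<in>S. \<bar>F (f (s i)) v - F (f (s j)) v\<bar> \<le> \<epsilon> * nrm v"
    using F_compact[of f R, OF f bd] by blast
  have inv: "1 / real (Suc (s i)) \<le> 1 / real (Suc i)" for i
    using strict_mono_imp_increasing[OF s, of i] by (intro divide_left_mono) auto
  have l0: "(\<lambda>i. 1 / real (Suc i)) \<longlonglongrightarrow> 0" by (rule LIMSEQ_Suc[OF lim_1_over_n])
  have lG: "(\<lambda>i. nrm (G (f (s i)))) \<longlonglongrightarrow> 0"
    by (rule tendsto_sandwich[OF _ _ tendsto_const l0]) (use order_trans[OF fG inv] in \<open>auto intro!: always_eventually simp del: of_nat_Suc\<close>)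
  have lI: "(\<lambda>i. I (f (s i))) \<longlonglongrightarrow> c"
  proof -
    have "(\<lambda>i. I (f (s i)) - c) \<longlonglongrightarrow> 0"
    proof (rule tendsto_0_le[where K = 1, OF l0], rule always_eventually, rule allI)
      show "norm (I (f (s i)) - c) \<le> norm (1 / real (Suc i)) * 1" for i
        using order_trans[OF fI[of "s i"] inv[of i]] by simp
    qed
    thus ?thesis using Lim_null by blast
  qed
  have "\<exists>x\<in>S. (\<lambda>k. nrm (f (s k) - x)) \<longlonglongrightarrow> 0"
  proof (rule complete_nrm)
    fix \<epsilon> :: real assume \<epsilon>: "\<epsilon> > 0"
    obtain N1 where N1: "\<And>i j v. \<lbrakk>i \<ge> N1; j \<ge> N1; v \<in> S\<rbrakk> \<Longrightarrow> \<bar>F (f (s i)) v - F (f (s j)) v\<bar> \<le> \<epsilon> / 4 * nrm v"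
      using sF[of "\<epsilon> / 4"] \<epsilon> by auto
    obtain N2 where N2: "\<And>i. i \<ge> N2 \<Longrightarrow> nrm (G (f (s i))) < \<epsilon> / 4"
      using order_tendstoD(2)[OF lG, of "\<epsilon> / 4"] \<epsilon> unfolding eventually_sequentially by auto
    have "nrm (f (s i) - f (s j)) < \<epsilon>" if ij: "i \<ge> max N1 N2" "j \<ge> max N1 N2" for i j
    proof -
      let ?a = "f (s i)" and ?b = "f (s j)"
      \<comment> \<open>Each of the two gradients is below \<open>\<epsilon> / 4\<close> and the
        compact parts differ by at most \<open>\<epsilon> / 4\<close>.\<close>
      have "?a - ?b = (G ?a - G ?b) + (K ?a - K ?b)" by (simp add: G_def)
      hence "nrm (?a - ?b) \<le> nrm (G ?a - G ?b) + nrm (K ?a - K ?b)"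
        using nrm_triangle[of "G ?a - G ?b" "K ?a - K ?b"] by simp
      moreover have "nrm (K ?a - K ?b) \<le> \<epsilon> / 4" using ij \<epsilon> N1 by (intro Kdiff) auto
      moreover have "nrm (G ?a - G ?b) \<le> nrm (G ?a) + nrm (G ?b)" by (intro nrm_triangle_diff) auto
      ultimately show ?thesis using N2[of i] N2[of j] ij \<epsilon> by simp
    qed
    thus "\<exists>N. \<forall>i\<ge>N. \<forall>j\<ge>N. nrm (f (s i) - f (s j)) < \<epsilon>" by blast
  qed simp
  then obtain x where x: "x \<in> S" and lx: "(\<lambda>k. nrm (f (s k) - x)) \<longlonglongrightarrow> 0" by blast
  have ev: "\<forall>\<^sub>F k in sequentially. f (s k) \<in> S" by simp
  have "I x = c" using tendsto_I[OF ev x lx] lI LIMSEQ_unique by blast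
  have "(\<lambda>k. nrm (G (f (s k)))) \<longlonglongrightarrow> nrm (G x)"
    by (rule tendsto_nrm[OF _ _ tendsto_G[OF ev x lx]]) (use x in simp_all)
  hence G0: "nrm (G x) = 0" using lG LIMSEQ_unique by blast
  have "B x v = F x v" if v: "v \<in> S" for v
  proof -
    have "B (G x) v = 0" using cauchy_schwarz[of "G x" v] x v G0 by simp
    thus ?thesis using x v by (simp add: G_def bil KF)
  qed
  thus ?thesis using x \<open>I x = c\<close> c rho by (intro bexI[of _ x]) (auto simp: I_def)
qed

section \<open>Square integrable functions\<close>

text \<open>Makes functions, and hence pairs of functions, a real vector space, as the abstract
  mountain pass theorem demands of its carrier type.\<close>

instantiation "fun" :: (type, scaleR) scaleR
begin
definition scaleR_fun: "c *\<^sub>R f = (\<lambda>x. c *\<^sub>R f x)"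
instance ..
end

lemma scaleR_fun_apply [simp]: "(c *\<^sub>R f) x = c *\<^sub>R f x"
  by (simp add: scaleR_fun)

instance "fun" :: (type, real_vector) real_vector
  by standard (simp_all add: fun_eq_iff scaleR_add_right scaleR_add_left)

text \<open>Fatou's lemma for Bochner integrals, delivering integrability of the limit together with
  the bound. It serves as lower semicontinuity of the \<open>L2\<close> norm and of the form given
  by \<open>L\<close>.\<close>

lemma fatou_bound:
  fixes g :: "nat \<Rightarrow> 'a \<Rightarrow> real"
  assumes int: "\<And>j. integrable M (g j)" and nn: "\<And>j. AE t in M. 0 \<le> g j t"
    and lim: "AE t in M. (\<lambda>j. g j t) \<longlonglongrightarrow> h t" and [measurable]: "h \<in> borel_measurable M"
    and bd: "\<And>j. integral\<^sup>L M (g j) \<le> C"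
  shows "integrable M h" "integral\<^sup>L M h \<le> C"
proof -
  have [measurable]: "g j \<in> borel_measurable M" for j using int by auto
  have nn': "AE t in M. \<forall>j. 0 \<le> g j t" using nn by (simp add: AE_all_countable)
  have h0: "AE t in M. 0 \<le> h t"
    using lim nn' by eventually_elim (blast intro: LIMSEQ_le_const)
  have C: "0 \<le> C" using integral_nonneg_AE[OF nn, of 0] bd[of 0] by linarith
  have "(\<integral>\<^sup>+ t. ennreal (h t) \<partial>M) = (\<integral>\<^sup>+ t. liminf (\<lambda>j. ennreal (g j t)) \<partial>M)"
  proof (rule nn_integral_cong_AE)
    show "AE t in M. ennreal (h t) = liminf (\<lambda>j. ennreal (g j t))"
      using lim
    proof eventually_elim
      case (elim t)
      hence "(\<lambda>j. ennreal (g j t)) \<longlonglongrightarrow> ennreal (h t)" by (rule tendsto_ennrealI)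
      thus ?case using lim_imp_Liminf[OF sequentially_bot] by metis
    qed
  qed
  also have "\<dots> \<le> liminf (\<lambda>j. \<integral>\<^sup>+ t. ennreal (g j t) \<partial>M)" by (rule nn_integral_liminf) simp
  also have "\<dots> \<le> liminf (\<lambda>j. ennreal C)"
  proof (intro Liminf_mono always_eventually allI)
    show "(\<integral>\<^sup>+ t. ennreal (g j t) \<partial>M) \<le> ennreal C" for j
      using bd[of j] by (simp add: nn_integral_eq_integral[OF int nn] ennreal_leI)
  qed
  also have "\<dots> = ennreal C" by (simp add: Liminf_const)
  finally have le: "(\<integral>\<^sup>+ t. ennreal (h t) \<partial>M) \<le> ennreal C" .
  thus i: "integrable M h"
    by (intro integrableI_nonneg h0) (auto intro: order.strict_trans1)
  show "integral\<^sup>L M h \<le> C"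
    using le C by (simp add: nn_integral_eq_integral[OF i h0])
qed

lemma L2_measurable [measurable_dest]: "L2 f \<Longrightarrow> f \<in> borel_measurable lborel"
  and L2_integrable: "L2 f \<Longrightarrow> integrable lborel (\<lambda>t. (norm (f t))\<^sup>2)"
  by (simp_all add: L2_def)

lemma L2_bound:
  assumes [measurable]: "f \<in> borel_measurable lborel" and g: "integrable lborel g"
    and b: "AE t in lborel. (norm (f t))\<^sup>2 \<le> g t"
  shows "L2 f"
  unfolding L2_def
proof
  show "integrable lborel (\<lambda>t. (norm (f t))\<^sup>2)"
    by (rule Bochner_Integration.integrable_bound[OF g]) (use b in auto)
qed simp

lemma L2_add: assumes "L2 f" "L2 g" shows "L2 (\<lambda>t. f t + g t)"
proof (rule L2_bound)
  show "integrable lborel (\<lambda>t. 2 * (norm (f t))\<^sup>2 + 2 * (norm (g t))\<^sup>2)"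
    using assms by (simp add: L2_integrable)
  have "(norm (f t + g t))\<^sup>2 \<le> 2 * (norm (f t))\<^sup>2 + 2 * (norm (g t))\<^sup>2" for t
  proof -
    have "(norm (f t + g t))\<^sup>2 \<le> (norm (f t) + norm (g t))\<^sup>2" by (intro power_mono norm_triangle_ineq) simp
    also have "\<dots> \<le> 2 * (norm (f t))\<^sup>2 + 2 * (norm (g t))\<^sup>2"
      using zero_le_power2[of "norm (f t) - norm (g t)"] by (simp add: power2_sum power2_diff)
    finally show ?thesis .
  qed
  thus "AE t in lborel. (norm (f t + g t))\<^sup>2 \<le> 2 * (norm (f t))\<^sup>2 + 2 * (norm (g t))\<^sup>2" by simp
qed (use assms in measurable)

lemma L2_scale: assumes "L2 f" shows "L2 (\<lambda>t. c *\<^sub>R f t)"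
  using assms unfolding L2_def by (auto simp: power_mult_distrib)

lemma L2_inner_integrable: assumes "L2 f" "L2 g" shows "integrable lborel (\<lambda>t. f t \<bullet> g t)"
proof (rule Bochner_Integration.integrable_bound)
  show "integrable lborel (\<lambda>t. (norm (f t))\<^sup>2 + (norm (g t))\<^sup>2)" using assms by (simp add: L2_integrable)
  have "\<bar>f t \<bullet> g t\<bar> \<le> (norm (f t))\<^sup>2 + (norm (g t))\<^sup>2" for t
  proof -
    have "\<bar>f t \<bullet> g t\<bar> \<le> norm (f t) * norm (g t)" by (rule Cauchy_Schwarz_ineq2)
    also have "\<dots> \<le> (norm (f t))\<^sup>2 + (norm (g t))\<^sup>2"
      using zero_le_power2[of "norm (f t) - norm (g t)"] mult_nonneg_nonneg[OF norm_ge_zero norm_ge_zero, of "f t" "g t"]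
      unfolding power2_diff by linarith
    finally show ?thesis .
  qed
  thus "AE t in lborel. norm (f t \<bullet> g t) \<le> norm ((norm (f t))\<^sup>2 + (norm (g t))\<^sup>2)" by simp
qed (use assms in measurable)

text \<open>The abstract Cauchy--Schwarz and triangle inequalities become those of square integrable
  functions; functions that vanish almost everywhere are the degenerate directions.\<close>

interpretation L2: semi_inner "{f :: real \<Rightarrow> 'a::euclidean_space. L2 f}" "\<lambda>f g. \<integral>t. f t \<bullet> g t \<partial>lborel"
proof
  show "subspace {f :: real \<Rightarrow> 'a. L2 f}"
    unfolding subspace_def using L2_add L2_scale by (auto simp: plus_fun_def scaleR_fun L2_def zero_fun_def)
next
  fix x y z :: "real \<Rightarrow> 'a" and c :: real
  assume x: "x \<in> {f. L2 f}" and z: "z \<in> {f. L2 f}"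
  show "(\<integral>t. (c *\<^sub>R x) t \<bullet> z t \<partial>lborel) = c * (\<integral>t. x t \<bullet> z t \<partial>lborel)" by simp
  show "(\<integral>t. x t \<bullet> z t \<partial>lborel) = (\<integral>t. z t \<bullet> x t \<partial>lborel)" by (simp only: inner_commute)
  show "0 \<le> (\<integral>t. x t \<bullet> x t \<partial>lborel)" by simp
  assume y: "y \<in> {f. L2 f}"
  show "(\<integral>t. (x + y) t \<bullet> z t \<partial>lborel) = (\<integral>t. x t \<bullet> z t \<partial>lborel) + (\<integral>t. y t \<bullet> z t \<partial>lborel)"
    using x y z by (simp add: inner_add_left L2_inner_integrable)
qed

lemma L2_norm: "L2 f \<Longrightarrow> L2 (\<lambda>t. norm (f t))"
  unfolding L2_def by (auto intro: borel_measurable_norm)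

lemma L2_diff: "\<lbrakk>L2 f; L2 g\<rbrakk> \<Longrightarrow> L2 (\<lambda>t. f t - g t)"
  using L2.mem_diff[of f g] by (simp add: fun_diff_def)

text \<open>Total by convention: the Bochner integral of a non-integrable function is 0, so the
  value is meaningful only together with \<open>L2\<close>.\<close>

definition l2n :: "(real \<Rightarrow> 'a::euclidean_space) \<Rightarrow> real" where
  "l2n f = sqrt (\<integral>t. (norm (f t))\<^sup>2 \<partial>lborel)"

lemma L2_nrm_eq: "L2.nrm f = l2n f"
  by (simp add: L2.nrm_def l2n_def dot_square_norm)

lemma l2n_nonneg [simp]: "0 \<le> l2n f"
  by (simp add: l2n_def)

lemma l2n_sq: "(l2n f)\<^sup>2 = (\<integral>t. (norm (f t))\<^sup>2 \<partial>lborel)"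
  by (simp add: l2n_def)

lemma l2n_norm [simp]: "l2n (\<lambda>t. norm (f t)) = l2n f"
  by (simp add: l2n_def)

lemma l2n_scale: "l2n (\<lambda>t. c *\<^sub>R f t) = \<bar>c\<bar> * l2n f"
  by (simp add: l2n_def power_mult_distrib real_sqrt_mult)

lemma l2n_triangle: "\<lbrakk>L2 f; L2 g\<rbrakk> \<Longrightarrow> l2n (\<lambda>t. f t + g t) \<le> l2n f + l2n g"
  using L2.nrm_triangle[of f g] by (simp add: L2_nrm_eq plus_fun_def)

lemma l2n_inner: "\<lbrakk>L2 f; L2 g\<rbrakk> \<Longrightarrow> \<bar>\<integral>t. f t \<bullet> g t \<partial>lborel\<bar> \<le> l2n f * l2n g"
  using L2.cauchy_schwarz[of f g] by (simp add: L2_nrm_eq)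

lemma L2_norm_mult_integrable:
  assumes "L2 f" "L2 g" shows "integrable lborel (\<lambda>t. norm (f t) * norm (g t))"
  using L2_inner_integrable[OF L2_norm L2_norm, OF assms] by simp

lemma l2n_holder:
  assumes "L2 f" "L2 g"
  shows "(\<integral>t. norm (f t) * norm (g t) \<partial>lborel) \<le> l2n f * l2n g"
  using l2n_inner[of "\<lambda>t. norm (f t)" "\<lambda>t. norm (g t)"] assms
  by (simp add: L2_norm)

lemma l2n_mono:
  assumes f: "f \<in> borel_measurable lborel" and g: "L2 g" and b: "AE t in lborel. norm (f t) \<le> norm (g t)"
  shows "L2 f" "l2n f \<le> l2n g"
proof -
  have b2: "AE t in lborel. (norm (f t))\<^sup>2 \<le> (norm (g t))\<^sup>2" using b by eventually_elim (simp add: power_mono)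
  show l: "L2 f" by (rule L2_bound[OF f L2_integrable[OF g] b2])
  show "l2n f \<le> l2n g"
    unfolding l2n_def using b2 l g by (intro real_sqrt_le_mono integral_mono_AE L2_integrable)
qed

lemma L2_AE_subseq:
  assumes f: "\<And>k. L2 (f k)" and g: "L2 g" and lim: "(\<lambda>k. \<integral>t. (norm (f k t - g t))\<^sup>2 \<partial>lborel) \<longlonglongrightarrow> 0"
  obtains r where "strict_mono (r :: nat \<Rightarrow> nat)" "AE t in lborel. (\<lambda>k. f (r k) t) \<longlonglongrightarrow> g t"
proof -
  have "\<exists>r::nat\<Rightarrow>nat. strict_mono r \<and> (AE t in lborel. (\<lambda>k. (norm (f (r k) t - g t))\<^sup>2) \<longlonglongrightarrow> 0)"
    by (rule tendsto_L1_AE_subseq[where M = lborel])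
      (use lim L2_diff[OF f g] in \<open>simp_all add: L2_integrable\<close>)
  then obtain r :: "nat \<Rightarrow> nat" where r: "strict_mono r" "AE t in lborel. (\<lambda>k. (norm (f (r k) t - g t))\<^sup>2) \<longlonglongrightarrow> 0" by blast
  from r(2) have "AE t in lborel. (\<lambda>k. f (r k) t) \<longlonglongrightarrow> g t"
  proof eventually_elim
    case (elim t)
    from tendsto_real_sqrt[OF this] show ?case
      by (simp add: tendsto_norm_zero_iff LIM_zero_iff)
  qed
  with r(1) show ?thesis by (rule that)
qed

text \<open>Multiplication by a strictly positive square integrable weight turns a Cauchy sequence
  in \<open>L2\<close> into one in \<open>L1\<close>, where an almost everywhere convergent
  subsequence exists. Dividing by the weight gives the pointwise limit, and Fatou's lemma upgrades
  the convergence to \<open>L2\<close>.\<close>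

lemma L2_complete:
  fixes f :: "nat \<Rightarrow> real \<Rightarrow> 'a::euclidean_space"
  assumes f: "\<And>k. L2 (f k)"
    and cau: "\<And>\<epsilon>. \<epsilon> > 0 \<Longrightarrow> \<exists>N. \<forall>i\<ge>N. \<forall>j\<ge>N. (\<integral>t. (norm (f i t - f j t))\<^sup>2 \<partial>lborel) < \<epsilon>"
  obtains g where "L2 g" "(\<lambda>k. \<integral>t. (norm (f k t - g t))\<^sup>2 \<partial>lborel) \<longlonglongrightarrow> 0"
proof -
  have [measurable]: "f k \<in> borel_measurable lborel" for k using f by (rule L2_measurable)
  obtain \<omega> :: "real \<Rightarrow> real" where [measurable]: "\<omega> \<in> borel_measurable lborel" and \<omega>: "\<And>t. \<omega> t > 0" "\<And>t. \<omega> t \<le> 1" "integrable lborel \<omega>"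
    by (rule sigma_finite_measure.obtain_positive_integrable_function[OF sigma_finite_lborel]) (rule that)
  have \<omega>2: "L2 \<omega>"
  proof (rule L2_bound[OF _ \<omega>(3)])
    have "(\<omega> t)\<^sup>2 \<le> \<omega> t" for t using \<omega>(1,2)[of t] by (simp add: power2_eq_square mult_left_le)
    thus "AE t in lborel. (norm (\<omega> t))\<^sup>2 \<le> \<omega> t" by simp
  qed simp
  define h where "h k t = \<omega> t *\<^sub>R f k t" for k t
  have [measurable]: "h k \<in> borel_measurable lborel" for k unfolding h_def by measurable
  have hi: "integrable lborel (h k)" for k
    by (rule Bochner_Integration.integrable_bound[OF L2_norm_mult_integrable[OF \<omega>2 f[of k]]]) (auto simp: h_def)
  have hc: "\<exists>N. \<forall>i\<ge>N. \<forall>j\<ge>N. (\<integral>t. norm (h i t - h j t) \<partial>lborel) < e" if e: "e > 0" for e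
  proof -
    have n0: "l2n \<omega> \<ge> 0" using \<omega>2 by simp
    define d where "d = e / (l2n \<omega> + 1)"
    have d: "d > 0" unfolding d_def using e n0 by (intro divide_pos_pos add_nonneg_pos) auto
    obtain N where N: "\<And>i j. i \<ge> N \<Longrightarrow> j \<ge> N \<Longrightarrow> (\<integral>t. (norm (f i t - f j t))\<^sup>2 \<partial>lborel) < d\<^sup>2"
      using cau[of "d\<^sup>2"] d by (auto simp: zero_less_power)
    have "(\<integral>t. norm (h i t - h j t) \<partial>lborel) < e" if ij: "i \<ge> N" "j \<ge> N" for i j
    proof -
      have "(\<integral>t. norm (h i t - h j t) \<partial>lborel) = (\<integral>t. norm (\<omega> t) * norm (f i t - f j t) \<partial>lborel)"
        by (simp add: h_def flip: scaleR_diff_right)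
      also have "\<dots> \<le> l2n \<omega> * l2n (\<lambda>t. f i t - f j t)" by (intro l2n_holder \<omega>2 L2_diff f)
      also have "l2n (\<lambda>t. f i t - f j t) \<le> d"
        unfolding l2n_def using N[OF ij] d by (intro real_le_lsqrt) auto
      hence "l2n \<omega> * l2n (\<lambda>t. f i t - f j t) \<le> l2n \<omega> * d" using n0 by (intro mult_left_mono)
      also have "\<dots> < (l2n \<omega> + 1) * d" using d by simp
      also have "\<dots> = e" using add_nonneg_pos[OF n0 zero_less_one] by (simp add: d_def)
      finally show ?thesis .
    qed
    thus ?thesis by blast
  qed
  obtain r where r: "strict_mono r" and rc: "AE t in lborel. Cauchy (\<lambda>i. h (r i) t)"
    by (rule cauchy_L1_AE_cauchy_subseq[OF hi hc])
  define g where "g t = inverse (\<omega> t) *\<^sub>R lim (\<lambda>i. h (r i) t)" for t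
  have [measurable]: "g \<in> borel_measurable lborel" unfolding g_def
    by (intro borel_measurable_scaleR borel_measurable_lim_metric) measurable
  have glim: "AE t in lborel. (\<lambda>i. f (r i) t) \<longlonglongrightarrow> g t"
    using rc
  proof eventually_elim
    case (elim t)
    hence "(\<lambda>i. h (r i) t) \<longlonglongrightarrow> lim (\<lambda>i. h (r i) t)" by (metis Cauchy_convergent convergent_LIMSEQ_iff)
    hence "(\<lambda>i. inverse (\<omega> t) *\<^sub>R h (r i) t) \<longlonglongrightarrow> g t" unfolding g_def by (intro tendsto_intros)
    thus ?case using \<omega>(1)[of t] by (simp add: h_def less_imp_neq[THEN not_sym])
  qed
  \<comment> \<open>Fatou is applied to \<open>f i - f (r (j + N))\<close> with \<open>i\<close>
    fixed and \<open>j\<close> tending to infinity; the shift by \<open>N\<close> keeps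
    \<open>r (j + N)\<close> in the range of the Cauchy estimate.\<close>
  have main: "\<exists>N. \<forall>i\<ge>N. L2 (\<lambda>t. f i t - g t) \<and> (\<integral>t. (norm (f i t - g t))\<^sup>2 \<partial>lborel) \<le> \<epsilon>" if \<epsilon>: "\<epsilon> > 0" for \<epsilon>
  proof -
    obtain N where N: "\<And>i j. i \<ge> N \<Longrightarrow> j \<ge> N \<Longrightarrow> (\<integral>t. (norm (f i t - f j t))\<^sup>2 \<partial>lborel) < \<epsilon>"
      using cau[OF \<epsilon>] by auto
    have "integrable lborel (\<lambda>t. (norm (f i t - g t))\<^sup>2) \<and> (\<integral>t. (norm (f i t - g t))\<^sup>2 \<partial>lborel) \<le> \<epsilon>" if i: "i \<ge> N" for i
    proof -
      have 1: "integrable lborel (\<lambda>t. (norm (f i t - f (r (j + N)) t))\<^sup>2)" for j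
        by (intro L2_integrable L2_diff f)
      have 2: "AE t in lborel. 0 \<le> (norm (f i t - f (r (j + N)) t))\<^sup>2" for j by simp
      have 3: "AE t in lborel. (\<lambda>j. (norm (f i t - f (r (j + N)) t))\<^sup>2) \<longlonglongrightarrow> (norm (f i t - g t))\<^sup>2"
        using glim
      proof eventually_elim
        case (elim t)
        from LIMSEQ_ignore_initial_segment[OF this, of N] show ?case by (intro tendsto_intros)
      qed
      have 4: "(\<lambda>t. (norm (f i t - g t))\<^sup>2) \<in> borel_measurable lborel" by measurable
      have 5: "(\<integral>t. (norm (f i t - f (r (j + N)) t))\<^sup>2 \<partial>lborel) \<le> \<epsilon>" for j
        using N[OF i, of "r (j + N)"] strict_mono_imp_increasing[OF r, of "j + N"] by simp
      show ?thesis using fatou_bound[OF 1 2 3 4 5] by blast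
    qed
    thus ?thesis by (intro exI[of _ N]) (auto simp: L2_def)
  qed
  have "L2 g"
  proof -
    obtain i where "L2 (\<lambda>t. f i t - g t)" using main[of 1] by auto
    from L2_diff[OF f[of i] this] show ?thesis by simp
  qed
  moreover have "(\<lambda>k. \<integral>t. (norm (f k t - g t))\<^sup>2 \<partial>lborel) \<longlonglongrightarrow> 0"
  proof (rule LIMSEQ_I)
    fix e :: real assume e: "e > 0"
    obtain N where "\<forall>i\<ge>N. (\<integral>t. (norm (f i t - g t))\<^sup>2 \<partial>lborel) \<le> e / 2" using main[of "e / 2"] e by auto
    thus "\<exists>N. \<forall>k\<ge>N. norm ((\<integral>t. (norm (f k t - g t))\<^sup>2 \<partial>lborel) - 0) < e"
      using e by (intro exI[of _ N]) (auto intro: order.strict_trans1)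
  qed
  ultimately show ?thesis by (rule that)
qed

section \<open>Liouville--Weyl derivatives of test functions\<close>

text \<open>The one-sided power without its Gamma factor: exponent -\<alpha> belongs to the left
  integral of order 1-\<alpha>, exponent \<alpha>-1 to the one of order \<alpha>.\<close>

definition ker :: "real \<Rightarrow> real \<Rightarrow> real" where
  "ker a s = indicator {0<..} s * s powr a"

lemma ker_measurable [measurable]: "ker a \<in> borel_measurable borel"
  unfolding ker_def by measurable

lemma ker_nonneg [simp]: "0 \<le> ker a s"
  by (simp add: ker_def)

lemma ker_integral_zero:
  assumes a: "a > -1" and c: "c \<ge> 0"
  shows "has_bochner_integral lborel (\<lambda>s. indicator {0..c} s * ker a s) (c powr (a + 1) / (a + 1))"
proof (rule has_bochner_integral_nn_integral)
  have "(\<integral>\<^sup>+ s. ennreal (indicator {0..c} s * ker a s) \<partial>lborel) = (\<integral>\<^sup>+ s. ennreal (indicator {0..c} s * s powr a) \<partial>lborel)"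
    by (intro nn_integral_cong) (auto simp: ker_def indicator_def)
  also have "\<dots> = ennreal (c powr (a + 1) / (a + 1))"
    using nn_integral_has_integral_lebesgue[OF _ has_integral_powr_from_0[OF a c]] by simp
  finally show "(\<integral>\<^sup>+ s. ennreal (indicator {0..c} s * ker a s) \<partial>lborel) = ennreal (c powr (a + 1) / (a + 1))" .
qed (use a c in auto)

lemma ker_integral_inf:
  assumes a: "a < -1" and c: "c > 0"
  shows "has_bochner_integral lborel (\<lambda>s. indicator {c..} s * ker a s) (c powr (a + 1) / - (a + 1))"
proof (rule has_bochner_integral_nn_integral)
  have "(\<integral>\<^sup>+ s. ennreal (indicator {c..} s * ker a s) \<partial>lborel) = (\<integral>\<^sup>+ s. ennreal (indicator {c..} s * s powr a) \<partial>lborel)"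
    using c by (intro nn_integral_cong) (auto simp: ker_def indicator_def)
  also have "\<dots> = ennreal (c powr (a + 1) / - (a + 1))"
    using nn_integral_has_integral_lebesgue[OF _ has_integral_powr_to_inf[OF a c]]
    by (simp add: minus_divide_right minus_divide_left)
  finally show "(\<integral>\<^sup>+ s. ennreal (indicator {c..} s * ker a s) \<partial>lborel) = ennreal (c powr (a + 1) / - (a + 1))" .
next
  show "0 \<le> c powr (a + 1) / - (a + 1)" using a by (intro divide_nonneg_pos) auto
qed auto

text \<open>The substitution \<open>y = \<xi> + d * t\<close> with \<open>d = x - \<xi>\<close>
  produces the Beta integral. Because the exponents \<open>a - 1\<close> and \<open>b - 1\<close>
  add up to -1, the powers of \<open>d\<close> cancel against the Jacobian, and the value does not
  depend on \<open>x\<close> and \<xi>.\<close>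

lemma ker_beta:
  assumes a: "0 < a" and b: "0 < b" and ab: "a + b = 1" and lt: "\<xi> < x"
  shows "has_bochner_integral lborel (\<lambda>y. ker (b - 1) (x - y) * ker (a - 1) (y - \<xi>)) (Beta a b)"
proof (rule has_bochner_integral_nn_integral)
  define d where "d = x - \<xi>"
  have d: "d > 0" using lt by (simp add: d_def)
  have B: "Beta a b > 0" using a b Gamma_real_pos[of a] Gamma_real_pos[of b] Gamma_real_pos[of "a + b"]
    by (simp add: Beta_def)
  show "0 \<le> Beta a b" using B by simp
  have eq: "ker (b - 1) (x - (\<xi> + d * t)) * ker (a - 1) (\<xi> + d * t - \<xi>)
      = (1 / d) * (indicator {0..1} t * (t powr (a - 1) * (1 - t) powr (b - 1)))" for t
  proof (cases "0 < t \<and> t < 1")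
    case True
    have "x - (\<xi> + d * t) = d * (1 - t)" by (simp add: d_def algebra_simps)
    hence "ker (b - 1) (x - (\<xi> + d * t)) * ker (a - 1) (\<xi> + d * t - \<xi>)
        = (d powr (b - 1) * d powr (a - 1)) * (t powr (a - 1) * (1 - t) powr (b - 1))"
      using True d by (simp add: ker_def powr_mult)
    also have "d powr (b - 1) * d powr (a - 1) = d powr (-1)"
      using ab by (simp flip: powr_add) (simp add: algebra_simps)
    finally show ?thesis using True d by (simp add: powr_minus divide_inverse)
  next
    case False
    have x: "x - (\<xi> + d * t) = d * (1 - t)" by (simp add: d_def algebra_simps)
    show ?thesis unfolding x using False d by (auto simp: ker_def indicator_def zero_less_mult_iff)
  qed
  have "(\<integral>\<^sup>+ y. ennreal (ker (b - 1) (x - y) * ker (a - 1) (y - \<xi>)) \<partial>lborel)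
      = \<bar>d\<bar> * (\<integral>\<^sup>+ t. ennreal (ker (b - 1) (x - (\<xi> + d * t)) * ker (a - 1) (\<xi> + d * t - \<xi>)) \<partial>lborel)"
    using d by (intro nn_integral_real_affine) auto
  also have "\<dots> = ennreal d * (\<integral>\<^sup>+ t. ennreal (1 / d) * ennreal (indicator {0..1} t * (t powr (a - 1) * (1 - t) powr (b - 1))) \<partial>lborel)"
    unfolding eq using d by (simp add: ennreal_mult' divide_nonneg_pos flip: ennreal_mult')
  also have "\<dots> = ennreal d * (ennreal (1 / d) * (\<integral>\<^sup>+ t. ennreal (indicator {0..1} t * (t powr (a - 1) * (1 - t) powr (b - 1))) \<partial>lborel))"
    by (subst nn_integral_cmult) auto
  also have "(\<integral>\<^sup>+ t. ennreal (indicator {0..1} t * (t powr (a - 1) * (1 - t) powr (b - 1))) \<partial>lborel) = ennreal (Beta a b)"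
    using nn_integral_has_integral_lebesgue[OF _ has_integral_Beta_real[OF a b]] by simp
  also have "ennreal d * (ennreal (1 / d) * ennreal (Beta a b)) = ennreal (Beta a b)"
    using d B by (simp flip: ennreal_mult' add: less_imp_le)
  finally show "(\<integral>\<^sup>+ y. ennreal (ker (b - 1) (x - y) * ker (a - 1) (y - \<xi>)) \<partial>lborel) = ennreal (Beta a b)" .
qed auto

lemma powr_square: "(t powr a)\<^sup>2 = t powr (2 * a)" for t a :: real
  by (simp add: power2_eq_square flip: powr_add)

lemma sqrt_powr: "t > 0 \<Longrightarrow> sqrt (t powr a) = t powr (a / 2)" for t a :: real
  by (simp add: powr_powr flip: powr_half_sqrt)

text \<open>With \<open>s = x - y\<close>, only one term is present for \<open>s\<close> between
  \<open>-h\<close> and 0; for \<open>s\<close> up to \<open>h\<close> the larger term dominates.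
  Each range contributes \<open>h powr (2 * \<alpha> - 1) / (2 * \<alpha> - 1)\<close>, finite since
  \<alpha> > 1/2. Beyond \<open>h\<close> the difference is at most
  \<open>h * s powr (\<alpha> - 2)\<close>, whose square integrates to the term with denominator
  \<open>3 - 2 * \<alpha>\<close>.\<close>

lemma ker_shift_L2:
  assumes \<alpha>: "1/2 < \<alpha>" "\<alpha> < 1" and h: "h > 0"
  shows "L2 (\<lambda>y. ker (\<alpha> - 1) (x + h - y) - ker (\<alpha> - 1) (x - y))"
    and "l2n (\<lambda>y. ker (\<alpha> - 1) (x + h - y) - ker (\<alpha> - 1) (x - y)) \<le> sqrt (2 / (2 * \<alpha> - 1) + 1 / (3 - 2 * \<alpha>)) * h powr (\<alpha> - 1/2)"
proof -
  define K where "K = 2 / (2 * \<alpha> - 1) + 1 / (3 - 2 * \<alpha>)"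
  define p where "p s = indicator {0..h} s * ker (2 * \<alpha> - 2) s" for s
  define q where "q s = indicator {h..} s * ker (2 * \<alpha> - 4) s" for s
  have p: "has_bochner_integral lborel p (h powr (2 * \<alpha> - 1) / (2 * \<alpha> - 1))"
    using ker_integral_zero[of "2 * \<alpha> - 2" h] \<alpha> h by (simp add: p_def[abs_def] algebra_simps)
  have q: "has_bochner_integral lborel q (h powr (2 * \<alpha> - 3) / (3 - 2 * \<alpha>))"
    using ker_integral_inf[of "2 * \<alpha> - 4" h] \<alpha> h by (simp add: q_def[abs_def] algebra_simps)
  have p1: "has_bochner_integral lborel (\<lambda>y. p (x + c + (-1) * y)) (h powr (2 * \<alpha> - 1) / (2 * \<alpha> - 1))" for c
    using p by (subst (asm) lborel_has_bochner_integral_real_affine_iff[of "-1" _ _ "x + c"]) auto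
  have q1: "has_bochner_integral lborel (\<lambda>y. q (x + (-1) * y)) (h powr (2 * \<alpha> - 3) / (3 - 2 * \<alpha>))"
    using q by (subst (asm) lborel_has_bochner_integral_real_affine_iff[of "-1" _ _ "x"]) auto
  define G where "G y = p (x + h + (-1) * y) + p (x + 0 + (-1) * y) + h\<^sup>2 * q (x + (-1) * y)" for y
  have "has_bochner_integral lborel G
      (h powr (2 * \<alpha> - 1) / (2 * \<alpha> - 1) + h powr (2 * \<alpha> - 1) / (2 * \<alpha> - 1) + h\<^sup>2 * (h powr (2 * \<alpha> - 3) / (3 - 2 * \<alpha>)))"
    unfolding G_def by (intro has_bochner_integral_add has_bochner_integral_mult_right p1 q1)
  moreover have "h\<^sup>2 * h powr (2 * \<alpha> - 3) = h powr (2 * \<alpha> - 1)"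
  proof -
    have "h\<^sup>2 = h powr 2" using h by (simp add: powr_numeral)
    thus ?thesis by (simp flip: powr_add)
  qed
  ultimately have G: "has_bochner_integral lborel G (K * h powr (2 * \<alpha> - 1))"
    by (simp add: K_def algebra_simps add_divide_distrib)
  have bound: "(ker (\<alpha> - 1) (s + h) - ker (\<alpha> - 1) s)\<^sup>2 \<le> p (s + h) + p s + h\<^sup>2 * q s" for s
  proof -
    have nn: "0 \<le> p t" "0 \<le> h\<^sup>2 * q t" for t by (simp_all add: p_def q_def)
    have sq: "(t powr (\<alpha> - 1))\<^sup>2 = t powr (2 * \<alpha> - 2)" if "t > 0" for t :: real
      by (simp add: powr_square algebra_simps)
    consider "s \<le> - h" | "- h < s" "s \<le> 0" | "0 < s" by linarith
    thus ?thesis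
    proof cases
      case 1
      hence "ker (\<alpha> - 1) (s + h) - ker (\<alpha> - 1) s = 0" using h by (simp add: ker_def)
      thus ?thesis using nn[of s] nn[of "s + h"] by simp
    next
      case 2
      hence "(ker (\<alpha> - 1) (s + h) - ker (\<alpha> - 1) s)\<^sup>2 = p (s + h)"
        using sq[of "s + h"] by (simp add: ker_def p_def)
      thus ?thesis using nn[of s] by simp
    next
      case 3
      have mono: "(s + h) powr (\<alpha> - 1) \<le> s powr (\<alpha> - 1)"
        using 3 h \<alpha> by (intro powr_mono2') auto
      define D where "D = s powr (\<alpha> - 1) - (s + h) powr (\<alpha> - 1)"
      have D0: "0 \<le> D" "D \<le> s powr (\<alpha> - 1)" using mono by (auto simp: D_def)
      have eq: "(ker (\<alpha> - 1) (s + h) - ker (\<alpha> - 1) s)\<^sup>2 = D\<^sup>2"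
        using 3 h by (simp add: ker_def D_def power2_commute)
      show ?thesis
      proof (cases "s \<le> h")
        case True
        have "D\<^sup>2 \<le> (s powr (\<alpha> - 1))\<^sup>2" using D0 by (intro power_mono) auto
        also have "\<dots> = p s" using sq 3 True by (simp add: p_def ker_def)
        finally show ?thesis unfolding eq using nn[of s] nn[of "s + h"] by linarith
      next
        case False
        \<comment> \<open>A substitute for the mean value theorem:
          \<open>t \<le> t powr (1 - \<alpha>)\<close> for \<open>t\<close> in (0,1] bounds the
          relative decrease of the power by \<open>1 - t\<close>, that is by
          \<open>h / (s + h)\<close>.\<close>
        define t where "t = s / (s + h)"
        have t: "0 < t" "t \<le> 1" using 3 h by (auto simp: t_def)
        have "t powr 1 \<le> t powr (1 - \<alpha>)" using t \<alpha> by (intro powr_mono') auto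
        moreover have "(s + h) powr (\<alpha> - 1) = s powr (\<alpha> - 1) * t powr (1 - \<alpha>)"
        proof -
          have "s powr (\<alpha> - 1) * t powr (1 - \<alpha>) = s powr (\<alpha> - 1) * s powr (1 - \<alpha>) / (s + h) powr (1 - \<alpha>)"
            using 3 h by (simp add: t_def powr_divide)
          also have "\<dots> = (s + h) powr (\<alpha> - 1)"
            using 3 h powr_minus[of "s + h" "1 - \<alpha>"] by (simp add: divide_inverse flip: powr_add)
          finally show ?thesis ..
        qed
        ultimately have "D \<le> s powr (\<alpha> - 1) * (1 - t)"
          using t mult_left_mono[of t "t powr (1 - \<alpha>)" "s powr (\<alpha> - 1)"] by (simp add: D_def algebra_simps)
        also have "1 - t = h / (s + h)" using 3 h by (simp add: t_def field_simps)
        also have "s powr (\<alpha> - 1) * (h / (s + h)) \<le> s powr (\<alpha> - 1) * (h / s)"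
          using 3 h by (intro mult_left_mono divide_left_mono) auto
        also have "\<dots> = h * s powr (\<alpha> - 2)"
        proof -
          have "s powr (\<alpha> - 1) = s powr (\<alpha> - 2) * s" using 3 powr_mult_base[of s "\<alpha> - 2"] by (simp add: mult.commute)
          thus ?thesis using 3 by simp
        qed
        finally have "D\<^sup>2 \<le> (h * s powr (\<alpha> - 2))\<^sup>2" using D0 by (intro power_mono)
        also have "\<dots> = h\<^sup>2 * (s powr (\<alpha> - 2))\<^sup>2" by (simp add: power_mult_distrib)
        also have "(s powr (\<alpha> - 2))\<^sup>2 = s powr (2 * \<alpha> - 4)"
          by (simp add: powr_square algebra_simps)
        also have "\<dots> = q s" using 3 False by (simp add: q_def ker_def)
        finally show ?thesis unfolding eq using nn[of s] nn[of "s + h"] by linarith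
      qed
    qed
  qed
  have b: "(norm (ker (\<alpha> - 1) (x + h - y) - ker (\<alpha> - 1) (x - y)))\<^sup>2 \<le> G y" for y
    using bound[of "x - y"] by (simp add: G_def algebra_simps)
  show L: "L2 (\<lambda>y. ker (\<alpha> - 1) (x + h - y) - ker (\<alpha> - 1) (x - y))"
    by (rule L2_bound[of _ G]) (use G b in \<open>auto simp: has_bochner_integral_iff\<close>)
  have "(\<integral>y. (norm (ker (\<alpha> - 1) (x + h - y) - ker (\<alpha> - 1) (x - y)))\<^sup>2 \<partial>lborel) \<le> (\<integral>y. G y \<partial>lborel)"
    by (intro integral_mono L2_integrable L b) (use G in \<open>auto simp: has_bochner_integral_iff\<close>)
  also have "\<dots> = K * h powr (2 * \<alpha> - 1)" using G by (simp add: has_bochner_integral_iff)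
  finally have "l2n (\<lambda>y. ker (\<alpha> - 1) (x + h - y) - ker (\<alpha> - 1) (x - y)) \<le> sqrt (K * h powr (2 * \<alpha> - 1))"
    unfolding l2n_def by (rule real_sqrt_le_mono)
  also have "\<dots> = sqrt K * h powr (\<alpha> - 1/2)"
    using h by (simp add: real_sqrt_mult sqrt_powr diff_divide_distrib)
  finally show "l2n (\<lambda>y. ker (\<alpha> - 1) (x + h - y) - ker (\<alpha> - 1) (x - y)) \<le> sqrt (2 / (2 * \<alpha> - 1) + 1 / (3 - 2 * \<alpha>)) * h powr (\<alpha> - 1/2)"
    by (simp add: K_def)
qed

section \<open>Quantitative bounds for test functions\<close>

lemma integrable_indicator_Icc: "integrable lborel (indicator {a..b} :: real \<Rightarrow> real)"
  by (rule integrable_real_indicator) (auto simp: emeasure_lborel_Icc_eq)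

lemma L2_indicator_Icc: "L2 (indicator {a..b} :: real \<Rightarrow> real)"
  by (rule L2_bound[OF _ integrable_indicator_Icc[of a b]]) (auto simp: indicator_def)

lemma bounded_continuous_support:
  fixes f :: "real \<Rightarrow> 'a::real_normed_vector"
  assumes "continuous_on UNIV f" and "\<And>t. R < \<bar>t\<bar> \<Longrightarrow> f t = 0"
  shows "\<exists>M\<ge>0. \<forall>t. norm (f t) \<le> M"
proof -
  have "compact (f ` {-R..R})"
    by (intro compact_continuous_image continuous_on_subset[OF assms(1)]) auto
  then obtain M where M: "\<And>t. t \<in> {-R..R} \<Longrightarrow> norm (f t) \<le> M"
    using compact_imp_bounded bounded_iff by (metis imageI)
  have "norm (f t) \<le> max M 0" for t
  proof (cases "R < \<bar>t\<bar>")
    case False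
    hence "t \<in> {-R..R}" by auto
    thus ?thesis using M[of t] by simp
  qed (use assms(2) in simp)
  thus ?thesis by (intro exI[of _ "max M 0"]) auto
qed

lemma vector_derivative_zero_outside:
  assumes f: "(f has_vector_derivative D) (at t)" and z: "\<And>s. R < \<bar>s\<bar> \<Longrightarrow> f s = 0" and t: "R < \<bar>t\<bar>"
  shows "D = 0"
proof -
  have "open {s. R < \<bar>s\<bar>}" by (intro open_Collect_less continuous_intros)
  hence "((\<lambda>s. 0) has_vector_derivative D) (at t)"
    by (rule has_vector_derivative_transform_within_open[OF f]) (use z t in auto)
  thus ?thesis using vector_derivative_unique_at[OF has_vector_derivative_const] by metis
qed

text \<open>Gives the first derivative a name, as the fractional derivative of a test function is
  computed from it; in \<open>test_fun\<close> the derivatives are hidden behind an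
  existential.\<close>

definition test_pair :: "(real \<Rightarrow> real^'n) \<Rightarrow> (real \<Rightarrow> real^'n) \<Rightarrow> bool" where
  "test_pair \<phi> \<phi>' \<longleftrightarrow> test_fun \<phi> \<and> (\<forall>t. (\<phi> has_vector_derivative \<phi>' t) (at t))"

lemma test_fun_pair: assumes "test_fun \<phi>" obtains \<phi>' where "test_pair \<phi> \<phi>'"
  using assms unfolding test_pair_def test_fun_def by metis

text \<open>All derivatives inherit the support and are bounded. The Taylor remainder is uniform in
  the base point because the second derivative is bounded on the line.\<close>

lemma test_pair_data:
  assumes "test_pair \<phi> \<phi>'"
  obtains R M where "R \<ge> 1" "M \<ge> 0" "continuous_on UNIV \<phi>" "continuous_on UNIV \<phi>'"
    "\<And>t. R < \<bar>t\<bar> \<Longrightarrow> \<phi> t = 0" "\<And>t. R < \<bar>t\<bar> \<Longrightarrow> \<phi>' t = 0"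
    "\<And>t. norm (\<phi> t) \<le> M" "\<And>t. norm (\<phi>' t) \<le> M"
    "\<And>t h. norm (\<phi> (t + h) - \<phi> t - h *\<^sub>R \<phi>' t) \<le> M * h\<^sup>2"
proof -
  from assms obtain D R0 where D0: "D 0 = \<phi>" and D: "\<And>k t. (D k has_vector_derivative D (Suc k) t) (at t)"
    and R0: "\<And>t. R0 < \<bar>t\<bar> \<Longrightarrow> \<phi> t = 0" unfolding test_pair_def test_fun_def by blast
  define R where "R = max R0 1"
  have cont: "continuous_on UNIV (D k)" for k
    using D by (intro continuous_at_imp_continuous_on) (auto intro: has_vector_derivative_continuous)
  have z: "R < \<bar>t\<bar> \<Longrightarrow> D k t = 0" for k t
  proof (induction k arbitrary: t)
    case 0
    thus ?case using R0 by (simp add: D0 R_def)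
  next
    case (Suc k)
    show ?case by (rule vector_derivative_zero_outside[OF D]) (use Suc in auto)
  qed
  have "\<exists>M\<ge>0. \<forall>t. norm (D k t) \<le> M" for k
    by (rule bounded_continuous_support[OF cont z])
  then obtain M where M: "\<And>k. M k \<ge> 0" "\<And>k t. norm (D k t) \<le> M k" by metis
  have d1: "D (Suc 0) = \<phi>'"
  proof
    fix t
    have "(\<phi> has_vector_derivative \<phi>' t) (at t)" using assms by (simp add: test_pair_def)
    thus "D (Suc 0) t = \<phi>' t" using D[of 0 t] D0 vector_derivative_unique_at by metis
  qed
  \<comment> \<open>The functions are vector valued, so a linearisation replaces the mean value
    equality: its error contributes \<open>2 * M 2\<close> and the linear term \<open>M 2\<close>,
    whence the factor 3.\<close>
  have lip: "norm (D 1 s - D 1 t) \<le> 3 * M 2 * \<bar>s - t\<bar>" for s t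
  proof -
    have "norm (D 1 s - D 1 t - (s - t) *\<^sub>R D 2 t) \<le> norm (s - t) * (2 * M 2)"
    proof (rule vector_differentiable_bound_linearization[where S = UNIV])
      show "(D 1 has_vector_derivative D 2 x) (at x within UNIV)" for x
        using D[of 1 x] by (simp add: numeral_2_eq_2)
      show "norm (D 2 x - D 2 t) \<le> 2 * M 2" for x
        using norm_triangle_ineq4[of "D 2 x" "D 2 t"] M(2)[of 2 x] M(2)[of 2 t] by linarith
    qed auto
    moreover have "norm ((s - t) *\<^sub>R D 2 t) \<le> \<bar>s - t\<bar> * M 2"
      using M(2)[of 2 t] by (simp add: mult_left_mono)
    ultimately show ?thesis
      using norm_triangle_ineq2[of "D 1 s - D 1 t" "(s - t) *\<^sub>R D 2 t"] by (simp add: algebra_simps)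
  qed
  have rem: "norm (\<phi> (t + h) - \<phi> t - h *\<^sub>R \<phi>' t) \<le> (3 * M 2) * h\<^sup>2" for t h
  proof -
    have "norm (\<phi> (t + h) - \<phi> t - ((t + h) - t) *\<^sub>R D 1 t) \<le> norm ((t + h) - t) * ((3 * M 2) * \<bar>h\<bar>)"
    proof (rule vector_differentiable_bound_linearization[where S = "closed_segment t (t + h)"])
      show "(\<phi> has_vector_derivative D 1 x) (at x within closed_segment t (t + h))" for x
        using D[of 0 x] by (auto simp: D0 intro: has_vector_derivative_at_within)
      show "norm (D 1 x - D 1 t) \<le> (3 * M 2) * \<bar>h\<bar>" if "x \<in> closed_segment t (t + h)" for x
      proof -
        have "\<bar>x - t\<bar> \<le> \<bar>h\<bar>" using that by (auto simp: closed_segment_eq_real_ivl split: if_splits)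
        thus ?thesis using lip[of x t] mult_left_mono[of "\<bar>x - t\<bar>" "\<bar>h\<bar>" "3 * M 2"] M(1)[of 2] by simp
      qed
    qed auto
    thus ?thesis by (simp add: d1 power2_eq_square mult_ac)
  qed
  define N where "N = max (M 0) (max (M 1) ((3 * M 2)))"
  show ?thesis
  proof (rule that[of R N])
    show "norm (\<phi> (t + h) - \<phi> t - h *\<^sub>R \<phi>' t) \<le> N * h\<^sup>2" for t h
      by (rule order_trans[OF rem mult_right_mono]) (simp_all add: N_def)
    show "norm (\<phi> t) \<le> N" "norm (\<phi>' t) \<le> N" for t
      using M(2)[of 0 t] M(2)[of 1 t] by (auto simp: N_def D0 d1)
    show "0 \<le> N" using M(1)[of 0] by (simp add: N_def)
  qed (use cont[of 0] cont[of 1] z[of _ 0] z[of _ 1] in \<open>auto simp: D0 d1 R_def\<close>)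
qed

text \<open>For \<open>a > -1\<close> the kernel is integrable near 0 but not at infinity. The
  bounded support of \<psi> saves the convolution: the integrand vanishes outside the part of the
  half line with \<open>s \<le> c\<close>.\<close>

lemma ker_conv:
  fixes \<psi> :: "real \<Rightarrow> 'a::euclidean_space"
  assumes a: "a > -1" and [measurable]: "\<psi> \<in> borel_measurable borel" and M: "\<And>t. norm (\<psi> t) \<le> M"
    and z: "\<And>t. R < \<bar>t\<bar> \<Longrightarrow> \<psi> t = 0" and c: "c \<ge> 0" "\<bar>x\<bar> + R \<le> c"
  shows "integrable lborel (\<lambda>s. ker a s *\<^sub>R \<psi> (x - s))"
    and "norm (\<integral>s. ker a s *\<^sub>R \<psi> (x - s) \<partial>lborel) \<le> M * (c powr (a + 1) / (a + 1))"
proof -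
  have k: "has_bochner_integral lborel (\<lambda>s. M * (indicator {0..c} s * ker a s)) (M * (c powr (a + 1) / (a + 1)))"
    by (intro has_bochner_integral_mult_right ker_integral_zero a c)
  have M0: "0 \<le> M" using norm_ge_zero M order_trans by blast
  have b: "norm (ker a s *\<^sub>R \<psi> (x - s)) \<le> M * (indicator {0..c} s * ker a s)" for s
  proof (cases "0 < s \<and> s \<le> c")
    case True
    thus ?thesis using mult_left_mono[OF M[of "x - s"] ker_nonneg[of a s]] by (simp add: mult.commute)
  next
    case False
    hence "s \<le> 0 \<or> R < \<bar>x - s\<bar>" using c by auto
    thus ?thesis using z[of "x - s"] M0 by (auto simp: ker_def)
  qed
  show i: "integrable lborel (\<lambda>s. ker a s *\<^sub>R \<psi> (x - s))"
    by (rule Bochner_Integration.integrable_bound[of _ "\<lambda>s. M * (indicator {0..c} s * ker a s)"])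
      (use k b M0 in \<open>auto simp: has_bochner_integral_iff simp del: norm_scaleR intro!: always_eventually order_trans[OF b abs_ge_self]\<close>)
  have "norm (\<integral>s. ker a s *\<^sub>R \<psi> (x - s) \<partial>lborel) \<le> (\<integral>s. norm (ker a s *\<^sub>R \<psi> (x - s)) \<partial>lborel)"
    by (rule integral_norm_bound)
  also have "\<dots> \<le> (\<integral>s. M * (indicator {0..c} s * ker a s) \<partial>lborel)"
    by (intro integral_mono integrable_norm i b) (use k in \<open>auto simp: has_bochner_integral_iff\<close>)
  also have "\<dots> = M * (c powr (a + 1) / (a + 1))" using k by (simp only: has_bochner_integral_iff)
  finally show "norm (\<integral>s. ker a s *\<^sub>R \<psi> (x - s) \<partial>lborel) \<le> M * (c powr (a + 1) / (a + 1))" .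
qed

section \<open>Liouville--Weyl derivatives of test functions as convolutions\<close>

locale frac_order =
  fixes \<alpha> :: real
  assumes \<alpha>: "1/2 < \<alpha>" "\<alpha> < 1"
begin

text \<open>The left integral of order 1-\<alpha>, written with the shift on the function instead of
  the kernel. Applied to the derivative of a test function it is the Caputo form of the fractional
  derivative.\<close>

definition frac_conv :: "(real \<Rightarrow> real^'n) \<Rightarrow> real \<Rightarrow> real^'n" where
  "frac_conv \<psi> x = (1 / Gamma (1 - \<alpha>)) *\<^sub>R (\<integral>s. ker (-\<alpha>) s *\<^sub>R \<psi> (x - s) \<partial>lborel)"

lemma Gamma_pos: "Gamma (1 - \<alpha>) > 0"
  using \<alpha> by (intro Gamma_real_pos) simp

lemma norm_frac_conv: "norm (frac_conv \<psi> x) = norm (\<integral>s. ker (-\<alpha>) s *\<^sub>R \<psi> (x - s) \<partial>lborel) / Gamma (1 - \<alpha>)"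
  using Gamma_pos by (simp add: frac_conv_def)

lemma LW_left_int_conv: "LW_left_int (1 - \<alpha>) \<phi> = frac_conv \<phi>"
proof
  fix x
  let ?f = "\<lambda>\<xi>. (indicator {..<x} \<xi> * (x - \<xi>) powr (1 - \<alpha> - 1) / Gamma (1 - \<alpha>)) *\<^sub>R \<phi> \<xi>"
  have "LW_left_int (1 - \<alpha>) \<phi> x = (\<integral>\<xi>. ?f \<xi> \<partial>lborel)" by (simp add: LW_left_int_def)
  also have "\<dots> = \<bar>-1\<bar> *\<^sub>R (\<integral>s. ?f (x + (-1) * s) \<partial>lborel)"
    by (rule lborel_integral_real_affine) simp
  also have "\<dots> = (\<integral>s. (1 / Gamma (1 - \<alpha>)) *\<^sub>R (ker (-\<alpha>) s *\<^sub>R \<phi> (x - s)) \<partial>lborel)"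
    by (simp, rule Bochner_Integration.integral_cong) (auto simp: ker_def indicator_def)
  also have "\<dots> = frac_conv \<phi> x" by (simp only: frac_conv_def integral_scaleR_right)
  finally show "LW_left_int (1 - \<alpha>) \<phi> x = frac_conv \<phi> x" .
qed

text \<open>Since the variable \<open>x\<close> sits in the smooth factor, the difference quotient
  never touches the singular kernel. The error is the convolution of the kernel with the Taylor
  remainder, of order \<open>h^2\<close>; the remainder lives on an interval of radius
  \<open>R + 1\<close>, as \<open>h\<close> is at most 1.\<close>

lemma frac_conv_has_derivative:
  assumes "test_pair \<phi> \<phi>'"
  shows "(LW_left_int (1 - \<alpha>) \<phi> has_vector_derivative frac_conv \<phi>' x) (at x)"
proof -
  obtain R M where R: "R \<ge> 1" "M \<ge> 0" and c: "continuous_on UNIV \<phi>" "continuous_on UNIV \<phi>'"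
    and z: "\<And>t. R < \<bar>t\<bar> \<Longrightarrow> \<phi> t = 0" "\<And>t. R < \<bar>t\<bar> \<Longrightarrow> \<phi>' t = 0"
    and M: "\<And>t. norm (\<phi> t) \<le> M" "\<And>t. norm (\<phi>' t) \<le> M"
    and rem: "\<And>t h. norm (\<phi> (t + h) - \<phi> t - h *\<^sub>R \<phi>' t) \<le> M * h\<^sup>2"
    using test_pair_data[OF assms] by metis
  have [measurable]: "\<phi> \<in> borel_measurable borel" "\<phi>' \<in> borel_measurable borel"
    using c by (auto intro: borel_measurable_continuous_onI)
  have a: "- \<alpha> > -1" using \<alpha> by simp
  define C where "C = (1 / Gamma (1 - \<alpha>)) * (M * ((\<bar>x\<bar> + R + 1) powr (- \<alpha> + 1) / (- \<alpha> + 1)))"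
  have "norm (frac_conv \<phi> (x + h) - frac_conv \<phi> x - h *\<^sub>R frac_conv \<phi>' x) \<le> C * h\<^sup>2" if h: "\<bar>h\<bar> \<le> 1" for h
  proof -
    define \<psi> where "\<psi> t = \<phi> (t + h) - \<phi> t - h *\<^sub>R \<phi>' t" for t
    have i1: "integrable lborel (\<lambda>s. ker (-\<alpha>) s *\<^sub>R \<phi> (y - s))" for y
      by (rule ker_conv(1)[OF a, where M = M and R = R and c = "\<bar>y\<bar> + R"]) (use R M z in auto)
    have i2: "integrable lborel (\<lambda>s. ker (-\<alpha>) s *\<^sub>R \<phi>' (y - s))" for y
      by (rule ker_conv(1)[OF a, where M = M and R = R and c = "\<bar>y\<bar> + R"]) (use R M z in auto)
    have "(\<integral>s. ker (-\<alpha>) s *\<^sub>R \<psi> (x - s) \<partial>lborel) =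
        (\<integral>s. ker (-\<alpha>) s *\<^sub>R \<phi> (x + h - s) - ker (-\<alpha>) s *\<^sub>R \<phi> (x - s) - h *\<^sub>R (ker (-\<alpha>) s *\<^sub>R \<phi>' (x - s)) \<partial>lborel)"
      by (intro Bochner_Integration.integral_cong) (auto simp: \<psi>_def algebra_simps)
    also have "\<dots> = (\<integral>s. ker (-\<alpha>) s *\<^sub>R \<phi> (x + h - s) \<partial>lborel) - (\<integral>s. ker (-\<alpha>) s *\<^sub>R \<phi> (x - s) \<partial>lborel)
        - h *\<^sub>R (\<integral>s. ker (-\<alpha>) s *\<^sub>R \<phi>' (x - s) \<partial>lborel)"
      by (simp only: Bochner_Integration.integral_diff integral_scaleR_right i1 i2
          integrable_scaleR_right Bochner_Integration.integrable_diff)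
    finally have eq: "frac_conv \<phi> (x + h) - frac_conv \<phi> x - h *\<^sub>R frac_conv \<phi>' x
        = (1 / Gamma (1 - \<alpha>)) *\<^sub>R (\<integral>s. ker (-\<alpha>) s *\<^sub>R \<psi> (x - s) \<partial>lborel)"
      by (simp add: frac_conv_def scaleR_diff_right)
    have "norm (\<integral>s. ker (-\<alpha>) s *\<^sub>R \<psi> (x - s) \<partial>lborel) \<le> (M * h\<^sup>2) * ((\<bar>x\<bar> + R + 1) powr (- \<alpha> + 1) / (- \<alpha> + 1))"
    proof (rule ker_conv(2)[OF a, where R = "R + 1"])
      show "\<psi> \<in> borel_measurable borel" unfolding \<psi>_def by measurable
      show "norm (\<psi> t) \<le> M * h\<^sup>2" for t using rem by (simp add: \<psi>_def)
      show "\<psi> t = 0" if "R + 1 < \<bar>t\<bar>" for t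
      proof -
        have "R < \<bar>t + h\<bar>" "R < \<bar>t\<bar>" using that h by linarith+
        thus ?thesis using z by (simp add: \<psi>_def)
      qed
    qed (use R in auto)
    hence "norm ((1 / Gamma (1 - \<alpha>)) *\<^sub>R (\<integral>s. ker (-\<alpha>) s *\<^sub>R \<psi> (x - s) \<partial>lborel))
        \<le> (1 / Gamma (1 - \<alpha>)) * ((M * h\<^sup>2) * ((\<bar>x\<bar> + R + 1) powr (- \<alpha> + 1) / (- \<alpha> + 1)))"
      using Gamma_pos by (subst norm_scaleR) (auto simp del: times_divide_eq_right times_divide_eq_left intro!: mult_left_mono)
    thus ?thesis unfolding eq by (simp add: C_def mult_ac)
  qed
  note est = this
  have "((\<lambda>h. norm (frac_conv \<phi> (x + h) - frac_conv \<phi> x - h *\<^sub>R frac_conv \<phi>' x) / norm h) \<longlongrightarrow> 0) (at 0)"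
  proof (rule tendsto_0_le[where K = C])
    show "((\<lambda>h. h) \<longlongrightarrow> (0::real)) (at 0)" by (rule tendsto_ident_at)
    have "\<forall>\<^sub>F h in at 0. \<bar>h\<bar> < (1::real)"
      by (auto simp: eventually_at intro!: exI[of _ 1])
    moreover have "\<forall>\<^sub>F h in at 0. h \<noteq> (0::real)" by (rule eventually_neq_at_within)
    ultimately show "\<forall>\<^sub>F h in at 0. norm (norm (frac_conv \<phi> (x + h) - frac_conv \<phi> x - h *\<^sub>R frac_conv \<phi>' x) / norm h) \<le> norm h * C"
    proof eventually_elim
      case (elim h)
      hence "norm (frac_conv \<phi> (x + h) - frac_conv \<phi> x - h *\<^sub>R frac_conv \<phi>' x) \<le> C * h\<^sup>2" by (intro est) simp
      also have "\<dots> = C * norm h * norm h" by (simp add: power2_eq_square)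
      finally show ?case using elim by (simp add: divide_le_eq mult_ac)
    qed
  qed
  thus ?thesis
    unfolding LW_left_int_conv has_vector_derivative_def has_derivative_at
    by (auto intro!: bounded_linear_intros)
qed

lemma LW_left_deriv_conv:
  assumes "test_pair \<phi> \<phi>'"
  shows "LW_left_deriv \<alpha> \<phi> = frac_conv \<phi>'"
  unfolding LW_left_deriv_def
  using frac_conv_has_derivative[OF assms] by (auto intro: vector_derivative_at)

lemma test_pair_linear:
  assumes "test_pair \<phi> \<phi>'" "test_pair \<psi> \<psi>'"
  shows "test_pair (\<lambda>t. a *\<^sub>R \<phi> t + b *\<^sub>R \<psi> t) (\<lambda>t. a *\<^sub>R \<phi>' t + b *\<^sub>R \<psi>' t)"
proof -
  from assms obtain D R where D: "D 0 = \<phi>" "\<And>k t. (D k has_vector_derivative D (Suc k) t) (at t)"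
    and R: "\<And>t. R < \<bar>t\<bar> \<Longrightarrow> \<phi> t = 0" unfolding test_pair_def test_fun_def by blast
  from assms obtain E Q where E: "E 0 = \<psi>" "\<And>k t. (E k has_vector_derivative E (Suc k) t) (at t)"
    and Q: "\<And>t. Q < \<bar>t\<bar> \<Longrightarrow> \<psi> t = 0" unfolding test_pair_def test_fun_def by blast
  have "test_fun (\<lambda>t. a *\<^sub>R \<phi> t + b *\<^sub>R \<psi> t)"
    unfolding test_fun_def
  proof (intro conjI exI[of _ "\<lambda>k t. a *\<^sub>R D k t + b *\<^sub>R E k t"] exI[of _ "max R Q"] allI impI)
    show "((\<lambda>t. a *\<^sub>R D k t + b *\<^sub>R E k t) has_vector_derivative a *\<^sub>R D (Suc k) t + b *\<^sub>R E (Suc k) t) (at t)" for k t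
      by (intro has_vector_derivative_add bounded_linear.has_vector_derivative[OF bounded_linear_scaleR_right] D E)
  qed (use R Q D E in auto)
  moreover have "((\<lambda>t. a *\<^sub>R \<phi> t + b *\<^sub>R \<psi> t) has_vector_derivative a *\<^sub>R \<phi>' t + b *\<^sub>R \<psi>' t) (at t)" for t
    using assms unfolding test_pair_def by (intro has_vector_derivative_add bounded_linear.has_vector_derivative[OF bounded_linear_scaleR_right]) auto
  ultimately show ?thesis by (simp add: test_pair_def)
qed

lemma frac_conv_linear:
  assumes "test_pair \<phi> \<phi>'" "test_pair \<psi> \<psi>'"
  shows "frac_conv (\<lambda>t. a *\<^sub>R \<phi>' t + b *\<^sub>R \<psi>' t) x = a *\<^sub>R frac_conv \<phi>' x + b *\<^sub>R frac_conv \<psi>' x"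
proof -
  have i: "integrable lborel (\<lambda>s. ker (-\<alpha>) s *\<^sub>R \<phi>' (x - s))" if p: "test_pair \<phi> \<phi>'" for \<phi> \<phi>' :: "real \<Rightarrow> real^'n"
  proof -
    obtain R M where R: "R \<ge> 1" "continuous_on UNIV \<phi>'" "\<And>t. R < \<bar>t\<bar> \<Longrightarrow> \<phi>' t = 0" "\<And>t. norm (\<phi>' t) \<le> M"
      using test_pair_data[OF p] by metis
    show ?thesis
      by (rule ker_conv(1)[of "-\<alpha>" \<phi>' M R "\<bar>x\<bar> + R"]) (use R \<alpha> in \<open>auto intro: borel_measurable_continuous_onI\<close>)
  qed
  have "(\<integral>s. ker (-\<alpha>) s *\<^sub>R (a *\<^sub>R \<phi>' (x - s) + b *\<^sub>R \<psi>' (x - s)) \<partial>lborel)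
      = (\<integral>s. a *\<^sub>R (ker (-\<alpha>) s *\<^sub>R \<phi>' (x - s)) + b *\<^sub>R (ker (-\<alpha>) s *\<^sub>R \<psi>' (x - s)) \<partial>lborel)"
    by (intro Bochner_Integration.integral_cong) (auto simp: algebra_simps)
  also have "\<dots> = a *\<^sub>R (\<integral>s. ker (-\<alpha>) s *\<^sub>R \<phi>' (x - s) \<partial>lborel) + b *\<^sub>R (\<integral>s. ker (-\<alpha>) s *\<^sub>R \<psi>' (x - s) \<partial>lborel)"
    by (simp only: Bochner_Integration.integral_add integral_scaleR_right integrable_scaleR_right i[OF assms(1)] i[OF assms(2)])
  finally show ?thesis by (simp add: frac_conv_def scaleR_add_right mult.commute)
qed

text \<open>Causality makes the convolution vanish to the left of the support, it is bounded near
  the support, and to the right it decays like \<open>x powr (-\<alpha>)\<close>, which is square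
  integrable at infinity because 2\<alpha> > 1.\<close>

lemma frac_conv_L2:
  assumes p: "test_pair \<phi> \<phi>'"
  shows "L2 \<phi>" and "L2 (frac_conv \<phi>')"
proof -
  obtain R M where R: "R \<ge> 1" "M \<ge> 0" and c: "continuous_on UNIV \<phi>" "continuous_on UNIV \<phi>'"
    and z: "\<And>t. R < \<bar>t\<bar> \<Longrightarrow> \<phi> t = 0" "\<And>t. R < \<bar>t\<bar> \<Longrightarrow> \<phi>' t = 0"
    and M: "\<And>t. norm (\<phi> t) \<le> M" "\<And>t. norm (\<phi>' t) \<le> M"
    using test_pair_data[OF p] by metis
  have [measurable]: "\<phi> \<in> borel_measurable borel" "\<phi>' \<in> borel_measurable borel"
    using c by (auto intro: borel_measurable_continuous_onI)
  show "L2 \<phi>"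
  proof (rule L2_bound[of _ "\<lambda>t. M\<^sup>2 * indicator {-R..R} t"])
    have "(norm (\<phi> t))\<^sup>2 \<le> M\<^sup>2 * indicator {-R..R} t" for t
      using power_mono[OF M(1)[of t], of 2] z(1)[of t] by (cases "R < \<bar>t\<bar>") (auto simp: indicator_def)
    thus "AE t in lborel. (norm (\<phi> t))\<^sup>2 \<le> M\<^sup>2 * indicator {-R..R} t" by simp
  qed (auto intro: integrable_indicator_Icc)
  \<comment> \<open>For \<open>C\<close> the integration range is \<open>3 * R\<close>, as
    \<open>x\<close> is at most \<open>2 * R\<close> and the support adds \<open>R\<close>. For
    \<open>K\<close>, with \<open>x > 2 * R\<close>, the relevant \<open>s\<close> lie in a window
    of length \<open>2 * R\<close> and satisfy \<open>s \<ge> x / 2\<close>, which costs the factor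
    \<open>2 powr \<alpha>\<close>.\<close>
  define C where "C = M * ((3 * R) powr (- \<alpha> + 1) / (- \<alpha> + 1)) / Gamma (1 - \<alpha>)"
  define K where "K = 2 powr \<alpha> * (2 * R * M) / Gamma (1 - \<alpha>)"
  have C0: "C \<ge> 0" "K \<ge> 0" using R \<alpha> Gamma_pos by (auto simp: C_def K_def)
  have near: "norm (frac_conv \<phi>' x) \<le> C" if x: "\<bar>x\<bar> \<le> 2 * R" for x
  proof -
    have "norm (\<integral>s. ker (-\<alpha>) s *\<^sub>R \<phi>' (x - s) \<partial>lborel) \<le> M * ((3 * R) powr (- \<alpha> + 1) / (- \<alpha> + 1))"
      by (rule ker_conv(2)[where R = R]) (use x R M z \<alpha> in auto)
    from divide_right_mono[OF this, of "Gamma (1 - \<alpha>)"] show ?thesis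
      unfolding norm_frac_conv C_def using Gamma_pos by simp
  qed
  have left: "frac_conv \<phi>' x = 0" if x: "x < - 2 * R" for x
  proof -
    have "ker (-\<alpha>) s *\<^sub>R \<phi>' (x - s) = 0" for s
      using z(2)[of "x - s"] x R by (cases "0 < s") (auto simp: ker_def)
    thus ?thesis unfolding frac_conv_def by (simp only: integral_zero scaleR_zero_right)
  qed
  have right: "norm (frac_conv \<phi>' x) \<le> K * x powr (-\<alpha>)" if x: "2 * R < x" for x
  proof -
    have b: "norm (ker (-\<alpha>) s *\<^sub>R \<phi>' (x - s)) \<le> (2 powr \<alpha> * x powr (-\<alpha>) * M) * indicator {x - R..x + R} s" for s
    proof (cases "s \<in> {x - R..x + R}")
      case True
      hence s: "x / 2 \<le> s" "0 < s" using x R by auto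
      have "ker (-\<alpha>) s = s powr (-\<alpha>)" using s by (simp add: ker_def)
      also have "\<dots> \<le> (x / 2) powr (-\<alpha>)" using s x R \<alpha> by (intro powr_mono2') auto
      also have "\<dots> = 2 powr \<alpha> * x powr (-\<alpha>)" using x R by (simp add: powr_divide powr_minus_divide)
      finally have "ker (-\<alpha>) s * norm (\<phi>' (x - s)) \<le> 2 powr \<alpha> * x powr (-\<alpha>) * M"
        by (rule mult_mono) (use M in auto)
      thus ?thesis using True by simp
    next
      case False
      hence "\<phi>' (x - s) = 0" by (intro z) (auto simp: abs_if)
      thus ?thesis using False by simp
    qed
    have "norm (\<integral>s. ker (-\<alpha>) s *\<^sub>R \<phi>' (x - s) \<partial>lborel) \<le> (\<integral>s. (2 powr \<alpha> * x powr (-\<alpha>) * M) * indicator {x - R..x + R} s \<partial>lborel)"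
    proof (rule Bochner_Integration.integral_norm_bound_integral)
      show "integrable lborel (\<lambda>s. ker (-\<alpha>) s *\<^sub>R \<phi>' (x - s))"
        by (rule ker_conv(1)[where R = R and M = M and c = "\<bar>x\<bar> + R"]) (use R M z \<alpha> in auto)
      show "integrable lborel (\<lambda>s. (2 powr \<alpha> * x powr (-\<alpha>) * M) * indicator {x - R..x + R} s)"
        by (intro integrable_mult_right integrable_indicator_Icc)
    qed (use b in auto)
    also have "\<dots> = (2 powr \<alpha> * (2 * R * M)) * x powr (-\<alpha>)" using R by simp
    finally have "norm (\<integral>s. ker (-\<alpha>) s *\<^sub>R \<phi>' (x - s) \<partial>lborel) \<le> (2 powr \<alpha> * (2 * R * M)) * x powr (-\<alpha>)" .
    from divide_right_mono[OF this, of "Gamma (1 - \<alpha>)"] show ?thesis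
      unfolding norm_frac_conv K_def using Gamma_pos by simp
  qed
  have int: "has_bochner_integral lborel (\<lambda>s. indicator {2 * R..} s * ker (-2 * \<alpha>) s) ((2 * R) powr (-2 * \<alpha> + 1) / - (-2 * \<alpha> + 1))"
    by (rule ker_integral_inf) (use \<alpha> R in auto)
  show "L2 (frac_conv \<phi>')"
  proof (rule L2_bound[of _ "\<lambda>t. C\<^sup>2 * indicator {-2*R..2*R} t + K\<^sup>2 * (indicator {2 * R..} t * ker (-2 * \<alpha>) t)"])
    show "frac_conv \<phi>' \<in> borel_measurable lborel" unfolding frac_conv_def by measurable
    show "integrable lborel (\<lambda>t. C\<^sup>2 * indicator {-2*R..2*R} t + K\<^sup>2 * (indicator {2 * R..} t * ker (-2 * \<alpha>) t))"
      using int by (intro Bochner_Integration.integrable_add integrable_mult_right)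
        (auto simp: has_bochner_integral_iff intro: integrable_indicator_Icc)
    have "(norm (frac_conv \<phi>' t))\<^sup>2 \<le> C\<^sup>2 * indicator {-2*R..2*R} t + K\<^sup>2 * (indicator {2 * R..} t * ker (-2 * \<alpha>) t)" for t
    proof -
      consider "\<bar>t\<bar> \<le> 2 * R" | "t < - 2 * R" | "2 * R < t" by linarith
      thus ?thesis
      proof cases
        case 1
        have "(norm (frac_conv \<phi>' t))\<^sup>2 \<le> C\<^sup>2 * 1 + 0" using power_mono[OF near[OF 1], of 2] by simp
        also have "\<dots> \<le> C\<^sup>2 * indicator {-2*R..2*R} t + K\<^sup>2 * (indicator {2 * R..} t * ker (-2 * \<alpha>) t)"
          using 1 by (intro add_mono) (auto simp: indicator_def)
        finally show ?thesis .
      next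
        case 2
        thus ?thesis using left[OF 2] by simp
      next
        case 3
        have "(norm (frac_conv \<phi>' t))\<^sup>2 \<le> (K * t powr (-\<alpha>))\<^sup>2" by (rule power_mono[OF right[OF 3]]) simp
        also have "\<dots> = 0 + K\<^sup>2 * (indicator {2 * R..} t * ker (-2 * \<alpha>) t)"
          using 3 R by (simp add: power_mult_distrib powr_square ker_def)
        also have "\<dots> \<le> C\<^sup>2 * indicator {-2*R..2*R} t + K\<^sup>2 * (indicator {2 * R..} t * ker (-2 * \<alpha>) t)"
          by (intro add_mono) auto
        finally show ?thesis .
      qed
    qed
    thus "AE t in lborel. (norm (frac_conv \<phi>' t))\<^sup>2 \<le> C\<^sup>2 * indicator {-2*R..2*R} t + K\<^sup>2 * (indicator {2 * R..} t * ker (-2 * \<alpha>) t)" by simp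
  qed
qed

text \<open>The left integral of order \<open>\<alpha>\<close> inverts the left derivative; the constant comes from the Beta integral
  \<open>\<integral>\<^sub>\<xi>\<^sup>x (x - y)\<^sup>\<alpha>\<^sup>-\<^sup>1 (y - \<xi>)\<^sup>-\<^sup>\<alpha> dy\<close>.\<close>

lemma frac_representation:
  assumes p: "test_pair \<phi> \<phi>'"
  shows "has_bochner_integral lborel (\<lambda>y. ker (\<alpha> - 1) (x - y) *\<^sub>R frac_conv \<phi>' y)
    ((Beta (1 - \<alpha>) \<alpha> / Gamma (1 - \<alpha>)) *\<^sub>R \<phi> x)"
proof -
  obtain R M where R: "R \<ge> 1" "M \<ge> 0" and c: "continuous_on UNIV \<phi>" "continuous_on UNIV \<phi>'"
    and z: "\<And>t. R < \<bar>t\<bar> \<Longrightarrow> \<phi> t = 0" "\<And>t. R < \<bar>t\<bar> \<Longrightarrow> \<phi>' t = 0"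
    and M: "\<And>t. norm (\<phi> t) \<le> M" "\<And>t. norm (\<phi>' t) \<le> M"
    using test_pair_data[OF p] by metis
  have [measurable]: "\<phi> \<in> borel_measurable borel" "\<phi>' \<in> borel_measurable borel"
    using c by (auto intro: borel_measurable_continuous_onI)
  define b where "b = Beta (1 - \<alpha>) \<alpha>"
  define \<gamma> where "\<gamma> = 1 / Gamma (1 - \<alpha>)"
  define f where "f \<xi> y = (\<gamma> * (ker (\<alpha> - 1) (x - y) * ker (-\<alpha>) (y - \<xi>))) *\<^sub>R \<phi>' \<xi>" for \<xi> y
  have beta: "has_bochner_integral lborel (\<lambda>y. ker (\<alpha> - 1) (x - y) * ker (-\<alpha>) (y - \<xi>)) (b * indicator {..<x} \<xi>)" for \<xi>
  proof (cases "\<xi> < x")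
    case True
    thus ?thesis using ker_beta[of "1 - \<alpha>" \<alpha> \<xi> x] \<alpha> by (simp add: b_def)
  next
    case False
    hence "(\<lambda>y. ker (\<alpha> - 1) (x - y) * ker (-\<alpha>) (y - \<xi>)) = (\<lambda>y. 0)" by (auto simp: ker_def indicator_def)
    thus ?thesis using False by (simp add: has_bochner_integral_zero del: mult_eq_0_iff)
  qed
  have inner: "has_bochner_integral lborel (f \<xi>) ((\<gamma> * (b * indicator {..<x} \<xi>)) *\<^sub>R \<phi>' \<xi>)" for \<xi>
    unfolding f_def by (intro has_bochner_integral_scaleR_left has_bochner_integral_mult_right beta)
  have g0: "\<gamma> > 0" using Gamma_pos by (simp add: \<gamma>_def)
  have innern: "(\<integral>y. norm (f \<xi> y) \<partial>lborel) = (\<gamma> * (b * indicator {..<x} \<xi>)) *\<^sub>R norm (\<phi>' \<xi>)" for \<xi>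
  proof -
    have "has_bochner_integral lborel (\<lambda>y. (\<gamma> * (ker (\<alpha> - 1) (x - y) * ker (-\<alpha>) (y - \<xi>))) *\<^sub>R norm (\<phi>' \<xi>)) ((\<gamma> * (b * indicator {..<x} \<xi>)) *\<^sub>R norm (\<phi>' \<xi>))"
      by (intro has_bochner_integral_scaleR_left has_bochner_integral_mult_right beta)
    moreover have "(\<lambda>y. norm (f \<xi> y)) = (\<lambda>y. (\<gamma> * (ker (\<alpha> - 1) (x - y) * ker (-\<alpha>) (y - \<xi>))) *\<^sub>R norm (\<phi>' \<xi>))"
      using g0 by (auto simp: f_def fun_eq_iff abs_mult)
    ultimately show ?thesis by (simp only: has_bochner_integral_iff)
  qed
  have phi1: "integrable lborel (\<lambda>\<xi>. (\<gamma> * (b * indicator {..<x} \<xi>)) *\<^sub>R norm (\<phi>' \<xi>))"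
  proof (rule Bochner_Integration.integrable_bound[of _ "\<lambda>\<xi>. \<bar>\<gamma> * b\<bar> * M * indicator {-R..R} \<xi>"])
    have "norm ((\<gamma> * (b * indicator {..<x} \<xi>)) *\<^sub>R norm (\<phi>' \<xi>)) \<le> norm (\<bar>\<gamma> * b\<bar> * M * indicator {-R..R} \<xi>)" for \<xi>
    proof (cases "R < \<bar>\<xi>\<bar>")
      case False
      hence "\<xi> \<in> {-R..R}" by auto
      thus ?thesis using M(2)[of \<xi>] R by (auto simp: abs_mult indicator_def intro!: mult_mono)
    qed (use z in simp)
    thus "AE \<xi> in lborel. norm ((\<gamma> * (b * indicator {..<x} \<xi>)) *\<^sub>R norm (\<phi>' \<xi>)) \<le> norm (\<bar>\<gamma> * b\<bar> * M * indicator {-R..R} \<xi>)" by simp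
  qed (auto intro: integrable_indicator_Icc)
  \<comment> \<open>Joint integrability is checked with \<open>y\<close> as the inner variable:
    there the norms integrate to the Beta constant times the norm of \<open>\<phi>'\<close>, which
    has bounded support.\<close>
  have pair: "integrable (lborel \<Otimes>\<^sub>M lborel) (case_prod f)"
  proof (rule lborel_pair.Fubini_integrable)
    show "case_prod f \<in> borel_measurable (lborel \<Otimes>\<^sub>M lborel)" unfolding f_def by measurable
    show "integrable lborel (\<lambda>\<xi>. \<integral>y. norm (case_prod f (\<xi>, y)) \<partial>lborel)" using phi1 by (simp add: innern)
    show "AE \<xi> in lborel. integrable lborel (\<lambda>y. case_prod f (\<xi>, y))" using inner by (auto simp: has_bochner_integral_iff)
  qed
  have fub: "(\<integral>y. (\<integral>\<xi>. f \<xi> y \<partial>lborel) \<partial>lborel) = (\<integral>\<xi>. (\<integral>y. f \<xi> y \<partial>lborel) \<partial>lborel)"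
    by (rule lborel_pair.Fubini_integral[OF pair])
  have conv: "(\<integral>\<xi>. f \<xi> y \<partial>lborel) = ker (\<alpha> - 1) (x - y) *\<^sub>R frac_conv \<phi>' y" for y
  proof -
    have "(\<integral>\<xi>. f \<xi> y \<partial>lborel) = \<bar>-1\<bar> *\<^sub>R (\<integral>s. f (y + (-1) * s) y \<partial>lborel)"
      by (rule lborel_integral_real_affine) simp
    also have "\<dots> = (\<integral>s. (\<gamma> * ker (\<alpha> - 1) (x - y)) *\<^sub>R (ker (-\<alpha>) s *\<^sub>R \<phi>' (y - s)) \<partial>lborel)"
      by (simp add: f_def mult_ac)
    also have "\<dots> = ker (\<alpha> - 1) (x - y) *\<^sub>R frac_conv \<phi>' y"
      by (simp only: integral_scaleR_right) (simp add: frac_conv_def \<gamma>_def mult_ac)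
    finally show ?thesis .
  qed
  have "(\<integral>\<xi>. (\<gamma> * (b * indicator {..<x} \<xi>)) *\<^sub>R \<phi>' \<xi> \<partial>lborel) = (\<gamma> * b) *\<^sub>R \<phi> x"
  proof -
    \<comment> \<open>A point to the left of both \<open>x\<close> and the support, so that the
      fundamental theorem of calculus on \<open>{A..x}\<close> returns the value of \<phi> at
      \<open>x\<close> alone.\<close>
    define A where "A = - (\<bar>x\<bar> + R + 1)"
    have A: "A \<le> x" "R < \<bar>A\<bar>" using R by (auto simp: A_def)
    have "(\<integral>\<xi>. (\<gamma> * (b * indicator {..<x} \<xi>)) *\<^sub>R \<phi>' \<xi> \<partial>lborel) = (\<integral>\<xi>. (\<gamma> * b) *\<^sub>R (indicator {A..x} \<xi> *\<^sub>R \<phi>' \<xi>) \<partial>lborel)"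
    proof (rule integral_cong_AE)
      have "AE \<xi> in lborel. \<xi> \<noteq> x" by (rule AE_lborel_singleton)
      thus "AE \<xi> in lborel. (\<gamma> * (b * indicator {..<x} \<xi>)) *\<^sub>R \<phi>' \<xi> = (\<gamma> * b) *\<^sub>R (indicator {A..x} \<xi> *\<^sub>R \<phi>' \<xi>)"
      proof eventually_elim
        case (elim \<xi>)
        show ?case
        proof (cases "\<xi> < A")
          case True
          hence "R < \<bar>\<xi>\<bar>" using R by (auto simp: A_def)
          thus ?thesis using z by simp
        next
          case False
          thus ?thesis using elim by (auto simp: indicator_def)
        qed
      qed
    qed measurable
    also have "\<dots> = (\<gamma> * b) *\<^sub>R (\<phi> x - \<phi> A)"
    proof -
      have "(\<integral>\<xi>. indicator {A..x} \<xi> *\<^sub>R \<phi>' \<xi> \<partial>lborel) = \<phi> x - \<phi> A"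
        by (rule integral_FTC_Icc)
          (use A p c in \<open>auto simp: test_pair_def intro: has_vector_derivative_at_within continuous_on_subset\<close>)
      thus ?thesis by (simp only: integral_scaleR_right)
    qed
    finally show ?thesis using z(1)[OF A(2)] by simp
  qed
  hence "(\<integral>y. ker (\<alpha> - 1) (x - y) *\<^sub>R frac_conv \<phi>' y \<partial>lborel) = (\<gamma> * b) *\<^sub>R \<phi> x"
    using fub inner by (simp add: conv has_bochner_integral_iff)
  moreover have "integrable lborel (\<lambda>y. ker (\<alpha> - 1) (x - y) *\<^sub>R frac_conv \<phi>' y)"
    using lborel_pair.integrable_snd[OF pair] by (simp add: conv)
  ultimately show ?thesis by (simp add: has_bochner_integral_iff b_def \<gamma>_def)
qed

text \<open>Subtracting the representations at \<open>x + h\<close> and \<open>x\<close> leaves the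
  fractional derivative integrated against a shift difference of the kernel, and Cauchy--Schwarz
  uses its \<open>L2\<close> norm. The exponent \<alpha>-1/2 and the constant come from the kernel
  alone and are the same for all test functions.\<close>

lemma test_holder:
  obtains C where "C \<ge> 0"
    and "\<And>(\<phi> :: real \<Rightarrow> real^'n) \<phi>' x y. test_pair \<phi> \<phi>' \<Longrightarrow> norm (\<phi> x - \<phi> y) \<le> C * \<bar>x - y\<bar> powr (\<alpha> - 1/2) * l2n (frac_conv \<phi>')"
proof -
  define c where "c = Beta (1 - \<alpha>) \<alpha> / Gamma (1 - \<alpha>)"
  \<comment> \<open>\<open>Beta (1 - \<alpha>) \<alpha>\<close> is
    \<open>Gamma (1 - \<alpha>) * Gamma \<alpha> / Gamma 1\<close>.\<close>
  have "c = Gamma \<alpha>" using less_imp_neq[OF Gamma_pos, symmetric] by (simp add: c_def Beta_def)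
  hence c: "c > 0" using \<alpha> by (simp add: Gamma_real_pos)
  define K where "K = sqrt (2 / (2 * \<alpha> - 1) + 1 / (3 - 2 * \<alpha>))"
  have K: "K \<ge> 0" using \<alpha> by (simp add: K_def)
  have main: "norm (\<phi> (x + h) - \<phi> x) \<le> K / c * h powr (\<alpha> - 1/2) * l2n (frac_conv \<phi>')"
    if p: "test_pair \<phi> \<phi>'" and h: "h > 0" for \<phi> \<phi>' :: "real \<Rightarrow> real^'n" and x h
  proof -
    define k where "k y = ker (\<alpha> - 1) (x + h - y) - ker (\<alpha> - 1) (x - y)" for y
    have kL: "L2 k" and kn: "l2n k \<le> K * h powr (\<alpha> - 1/2)"
      using ker_shift_L2[OF \<alpha> h, of x] by (simp_all add: k_def[abs_def] K_def)
    have gL: "L2 (frac_conv \<phi>')" by (rule frac_conv_L2[OF p])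
    have "has_bochner_integral lborel (\<lambda>y. ker (\<alpha> - 1) (x + h - y) *\<^sub>R frac_conv \<phi>' y - ker (\<alpha> - 1) (x - y) *\<^sub>R frac_conv \<phi>' y)
        (c *\<^sub>R \<phi> (x + h) - c *\<^sub>R \<phi> x)"
      unfolding c_def by (intro has_bochner_integral_diff frac_representation p)
    hence "c *\<^sub>R (\<phi> (x + h) - \<phi> x) = (\<integral>y. k y *\<^sub>R frac_conv \<phi>' y \<partial>lborel)"
      by (simp add: has_bochner_integral_iff k_def scaleR_diff_left scaleR_diff_right)
    also have "norm \<dots> \<le> (\<integral>y. norm (k y *\<^sub>R frac_conv \<phi>' y) \<partial>lborel)" by (rule integral_norm_bound)
    also have "\<dots> = (\<integral>y. norm (k y) * norm (frac_conv \<phi>' y) \<partial>lborel)" by simp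
    also have "\<dots> \<le> l2n k * l2n (frac_conv \<phi>')" by (intro l2n_holder kL gL)
    also have "\<dots> \<le> K * h powr (\<alpha> - 1/2) * l2n (frac_conv \<phi>')" by (intro mult_right_mono kn) simp
    finally have "c * norm (\<phi> (x + h) - \<phi> x) \<le> K * h powr (\<alpha> - 1/2) * l2n (frac_conv \<phi>')" using c by simp
    thus ?thesis using c by (simp add: field_simps)
  qed
  have "norm (\<phi> x - \<phi> y) \<le> K / c * \<bar>x - y\<bar> powr (\<alpha> - 1/2) * l2n (frac_conv \<phi>')"
    if p: "test_pair \<phi> \<phi>'" for \<phi> \<phi>' :: "real \<Rightarrow> real^'n" and x y
  proof -
    consider "x < y" | "x = y" | "y < x" by linarith
    thus ?thesis
    proof cases
      case 1
      thus ?thesis using main[OF p, of "y - x" x] by (simp add: norm_minus_commute)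
    next
      case 3
      thus ?thesis using main[OF p, of "x - y" y] by simp
    qed simp
  qed
  thus ?thesis using that[of "K / c"] K c by simp
qed

text \<open>The Hoelder estimate is averaged over the unit interval to the right of
  \<open>x\<close>: the distance to \<open>x\<close> is at most 1 there, and the mean of the norm is
  bounded by the \<open>L2\<close> norm.\<close>

lemma test_sup:
  obtains C where "C \<ge> 0"
    and "\<And>(\<phi> :: real \<Rightarrow> real^'n) \<phi>' x. test_pair \<phi> \<phi>' \<Longrightarrow> norm (\<phi> x) \<le> l2n \<phi> + C * l2n (frac_conv \<phi>')"
proof -
  obtain C where C: "C \<ge> 0" and hol: "\<And>(\<phi> :: real \<Rightarrow> real^'n) \<phi>' x y. test_pair \<phi> \<phi>' \<Longrightarrow>
      norm (\<phi> x - \<phi> y) \<le> C * \<bar>x - y\<bar> powr (\<alpha> - 1/2) * l2n (frac_conv \<phi>')"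
    using test_holder by blast
  have "norm (\<phi> x) \<le> l2n \<phi> + C * l2n (frac_conv \<phi>')" if p: "test_pair \<phi> \<phi>'" for \<phi> \<phi>' :: "real \<Rightarrow> real^'n" and x
  proof -
    define J where "J = (\<lambda>t. indicator {x..x+1} t :: real)"
    have L: "L2 \<phi>" by (rule frac_conv_L2[OF p])
    have JL: "L2 J" by (simp add: J_def L2_indicator_Icc)
    have "l2n J = sqrt (\<integral>t. J t \<partial>lborel)" unfolding l2n_def J_def
      by (intro arg_cong[of _ _ sqrt] Bochner_Integration.integral_cong) (auto simp: indicator_def)
    hence Jn: "l2n J = 1" by (simp add: J_def)
    have b: "norm (\<phi> x) * J t \<le> norm (J t) * norm (\<phi> t) + C * l2n (frac_conv \<phi>') * J t" for t
    proof (cases "t \<in> {x..x+1}")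
      case True
      have "norm (\<phi> x) \<le> norm (\<phi> t) + norm (\<phi> x - \<phi> t)" by (metis norm_triangle_sub)
      also have "\<dots> \<le> norm (\<phi> t) + C * \<bar>x - t\<bar> powr (\<alpha> - 1/2) * l2n (frac_conv \<phi>')"
        by (intro add_left_mono hol p)
      also have "\<bar>x - t\<bar> powr (\<alpha> - 1/2) \<le> 1" using True \<alpha> by (intro powr_le1) auto
      hence "C * \<bar>x - t\<bar> powr (\<alpha> - 1/2) * l2n (frac_conv \<phi>') \<le> C * 1 * l2n (frac_conv \<phi>')"
        using C by (intro mult_left_mono mult_right_mono) auto
      finally show ?thesis using True by (simp add: J_def)
    qed (simp add: J_def)
    have Ji: "integrable lborel J" by (simp add: J_def integrable_indicator_Icc)
    have "norm (\<phi> x) = (\<integral>t. norm (\<phi> x) * J t \<partial>lborel)" by (simp add: J_def)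
    also have "\<dots> \<le> (\<integral>t. norm (J t) * norm (\<phi> t) + C * l2n (frac_conv \<phi>') * J t \<partial>lborel)"
      by (intro integral_mono b Bochner_Integration.integrable_add integrable_mult_right L2_norm_mult_integrable JL L Ji)
    also have "\<dots> = (\<integral>t. norm (J t) * norm (\<phi> t) \<partial>lborel) + C * l2n (frac_conv \<phi>')"
      by (subst Bochner_Integration.integral_add) (use L2_norm_mult_integrable[OF JL L] Ji in \<open>auto simp: J_def\<close>)
    also have "\<dots> \<le> l2n J * l2n \<phi> + C * l2n (frac_conv \<phi>')" by (intro add_right_mono l2n_holder JL L)
    finally show ?thesis by (simp add: Jn)
  qed
  thus ?thesis using that[of C] C by blast
qed

end

text \<open>Differentiating \<open>p * q^(-2k) * exp (-1/q)\<close> and extracting the factor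
  \<open>q^(-2k-2)\<close> leaves \<open>p' * q^2 - 2k * p * q * q' + p * q'\<close>. Here
  \<open>[:0, 1, -1:]\<close> is \<open>q = t * (1 - t)\<close> and \<open>[:1, -2:]\<close> is its
  derivative.\<close>

fun bump_poly :: "nat \<Rightarrow> real poly" where
  "bump_poly 0 = 1"
| "bump_poly (Suc k) = pderiv (bump_poly k) * [:0, 1, -1:]\<^sup>2
     - smult (2 * real k) (bump_poly k * [:0, 1, -1:] * [:1, -2:]) + bump_poly k * [:1, -2:]"

text \<open>The derivatives of \<open>exp (- 1 / q)\<close> with \<open>q = t (1 - t)\<close>, extended by zero.\<close>

definition bump :: "nat \<Rightarrow> real \<Rightarrow> real" where
  "bump k t = (if 0 < t \<and> t < 1
     then poly (bump_poly k) t * (inverse (t * (1 - t)) ^ (2 * k) * exp (- inverse (t * (1 - t)))) else 0)"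

lemma power_exp_bound: "y \<ge> 0 \<Longrightarrow> y ^ n * exp (- y) \<le> real n ^ n" for y :: real
proof (cases "n = 0")
  case False
  assume y: "y \<ge> 0"
  have "(y / n) ^ n \<le> exp (y / n) ^ n"
    using y exp_ge_add_one_self[of "y / n"] by (intro power_mono) (linarith, simp)
  also have "\<dots> = exp y" using False by (simp flip: exp_of_nat_mult)
  finally show ?thesis using False by (simp add: power_divide exp_minus field_simps)
qed simp

text \<open>Inside the unit interval \<open>q\<close> is at most the distance to either end point,
  hence at most the distance to any \<open>t\<close> outside. The exponential absorbs every negative
  power of \<open>q\<close> and can still spare a factor \<open>q^2\<close>.\<close>

lemma bump_flat:
  assumes "t \<le> 0 \<or> 1 \<le> t"
  shows "\<exists>C. \<forall>s. \<bar>bump k s\<bar> \<le> C * (s - t)\<^sup>2"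
proof -
  have "compact (poly (bump_poly k) ` {0..1})" by (intro compact_continuous_image continuous_intros) auto
  then obtain M where M: "\<And>s. s \<in> {0..1} \<Longrightarrow> norm (poly (bump_poly k) s) \<le> M"
    using compact_imp_bounded bounded_iff by (metis imageI)
  \<comment> \<open>\<open>2 * k\<close> powers cancel the denominator of the derivative, the other
    two produce the quadratic bound.\<close>
  define n where "n = 2 * k + 2"
  have M0: "M \<ge> 0" using M[of 0] norm_ge_zero order_trans by fastforce
  have "\<bar>bump k s\<bar> \<le> (M * real n ^ n) * (s - t)\<^sup>2" for s
  proof (cases "0 < s \<and> s < 1")
    case True
    define q where "q = s * (1 - s)"
    have q: "q > 0" "q \<le> s" "q \<le> 1 - s" using True by (auto simp: q_def mult_le_cancel_left1 mult_le_cancel_right1)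
    hence qt: "q\<^sup>2 \<le> (s - t)\<^sup>2"
      using assms True by (subst abs_le_square_iff[symmetric]) auto
    have "inverse q ^ (2 * k) * exp (- inverse q) = q\<^sup>2 * (inverse q ^ n * exp (- inverse q))"
      using q by (simp add: n_def power_add field_simps power2_eq_square)
    also have "\<dots> \<le> q\<^sup>2 * real n ^ n" using q by (intro mult_left_mono power_exp_bound) auto
    finally have le: "inverse q ^ (2 * k) * exp (- inverse q) \<le> q\<^sup>2 * real n ^ n" .
    have "\<bar>poly (bump_poly k) s\<bar> * (inverse q ^ (2 * k) * exp (- inverse q)) \<le> M * (q\<^sup>2 * real n ^ n)"
      by (rule mult_mono) (use True M[of s] q M0 le in auto)
    hence "\<bar>bump k s\<bar> \<le> M * (q\<^sup>2 * real n ^ n)"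
      using True q by (simp add: bump_def abs_mult power_abs flip: q_def)
    also have "\<dots> \<le> (M * real n ^ n) * (s - t)\<^sup>2" using mult_left_mono[OF qt, of "M * real n ^ n"] M0 by (simp add: mult_ac)
    finally show ?thesis .
  qed (use M0 in \<open>auto simp: bump_def\<close>)
  thus ?thesis by blast
qed

lemma bump_deriv: "(bump k has_field_derivative bump (Suc k) t) (at t)"
proof (cases "0 < t \<and> t < 1")
  case True
  define Q where "Q s = inverse (s * (1 - s))" for s :: real
  have q: "t * (1 - t) \<noteq> 0" using True by auto
  define e where "e = exp (- Q t)"
  have dQ: "(Q has_field_derivative - (Q t)\<^sup>2 * (1 - 2 * t)) (at t)"
    unfolding Q_def using q by (auto intro!: derivative_eq_intros simp: power2_eq_square algebra_simps)
  have "((\<lambda>s. poly (bump_poly k) s * (Q s ^ (2 * k) * exp (- Q s))) has_field_derivative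
     poly (pderiv (bump_poly k)) t * (Q t ^ (2 * k) * e) +
     (real (2 * k) * (- (Q t)\<^sup>2 * (1 - 2 * t)) * Q t ^ (2 * k - 1) * e + Q t ^ (2 * k) * (e * ((Q t)\<^sup>2 * (1 - 2 * t)))) * poly (bump_poly k) t) (at t)"
    unfolding e_def by (auto intro!: derivative_eq_intros dQ poly_DERIV simp: algebra_simps)
  also have "poly (pderiv (bump_poly k)) t * (Q t ^ (2 * k) * e) +
     (real (2 * k) * (- (Q t)\<^sup>2 * (1 - 2 * t)) * Q t ^ (2 * k - 1) * e + Q t ^ (2 * k) * (e * ((Q t)\<^sup>2 * (1 - 2 * t)))) * poly (bump_poly k) t
     = bump (Suc k) t"
  proof -
    have Qq: "Q t * (t * (1 - t)) = 1" unfolding Q_def using q by (rule left_inverse)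
    define x where "x = t * (1 - t)"
    have xx: "poly [:0, 1, -1:] t = x" by (simp add: x_def algebra_simps)
    have Qx: "Q t * x = 1" using Qq by (simp add: x_def)
    have "bump (Suc k) t = (poly (pderiv (bump_poly k)) t * x\<^sup>2 - 2 * real k * (poly (bump_poly k) t * x * (1 - 2 * t))
        + poly (bump_poly k) t * (1 - 2 * t)) * (Q t ^ (2 * k + 2) * e)"
    proof -
      have x2: "poly [:1, -2:] t = 1 - 2 * t" by simp
      have "poly (bump_poly (Suc k)) t = poly (pderiv (bump_poly k)) t * x\<^sup>2 - 2 * real k * (poly (bump_poly k) t * x * (1 - 2 * t))
        + poly (bump_poly k) t * (1 - 2 * t)"
        by (simp only: bump_poly.simps poly_add poly_diff poly_smult poly_mult poly_power xx x2)
      thus ?thesis using True unfolding bump_def e_def Q_def by simp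
    qed
    also have "\<dots> = poly (pderiv (bump_poly k)) t * (Q t ^ (2 * k) * (Q t * x)\<^sup>2 * e)
        - 2 * real k * (poly (bump_poly k) t * (1 - 2 * t)) * (Q t ^ (2 * k) * Q t * (Q t * x) * e)
        + poly (bump_poly k) t * (1 - 2 * t) * (Q t ^ (2 * k) * (Q t)\<^sup>2 * e)"
      by (simp add: power_add power2_eq_square algebra_simps)
    also have "\<dots> = poly (pderiv (bump_poly k)) t * (Q t ^ (2 * k) * e)
        - 2 * real k * (poly (bump_poly k) t * (1 - 2 * t)) * (Q t ^ (2 * k) * Q t * e)
        + poly (bump_poly k) t * (1 - 2 * t) * (Q t ^ (2 * k) * (Q t)\<^sup>2 * e)"
      by (simp only: Qx) simp
    also have "\<dots> = poly (pderiv (bump_poly k)) t * (Q t ^ (2 * k) * e) +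
     (real (2 * k) * (- (Q t)\<^sup>2 * (1 - 2 * t)) * Q t ^ (2 * k - 1) * e + Q t ^ (2 * k) * (e * ((Q t)\<^sup>2 * (1 - 2 * t)))) * poly (bump_poly k) t"
    proof (cases k)
      case (Suc j)
      have "(Q t)\<^sup>2 * Q t ^ (2 * k - 1) = Q t ^ (2 * k) * Q t" by (simp add: Suc power2_eq_square)
      thus ?thesis by (simp add: algebra_simps)
    qed (simp add: algebra_simps)
    finally show ?thesis ..
  qed
  finally show ?thesis
    by (rule has_field_derivative_transform_within_open[where S = "{0<..<1}"])
      (use True in \<open>auto simp: bump_def Q_def\<close>)
next
  case False
  \<comment> \<open>At and outside the end points the function vanishes at \<open>t\<close> and is
    quadratically small nearby, so its difference quotient tends to 0.\<close>
  then obtain C where C: "\<And>s. \<bar>bump k s\<bar> \<le> C * (s - t)\<^sup>2" using bump_flat[of t k] by (auto simp: not_less)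
  have z: "bump k t = 0" "bump (Suc k) t = 0" using False by (auto simp: bump_def)
  have "((\<lambda>s. (bump k s - bump k t) / (s - t)) \<longlongrightarrow> 0) (at t)"
  proof (rule tendsto_0_le[where K = C])
    show "((\<lambda>s. s - t) \<longlongrightarrow> 0) (at t)" by (rule LIM_zero) (rule tendsto_ident_at)
    have "\<forall>\<^sub>F s in at t. s \<noteq> t" by (rule eventually_neq_at_within)
    thus "\<forall>\<^sub>F s in at t. norm ((bump k s - bump k t) / (s - t)) \<le> norm (s - t) * C"
    proof eventually_elim
      case (elim s)
      have "\<bar>bump k s\<bar> \<le> C * (\<bar>s - t\<bar> * \<bar>s - t\<bar>)" using C[of s] by (simp add: power2_eq_square)
      thus ?case using elim by (simp add: z divide_le_eq mult_ac)
    qed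
  qed
  thus ?thesis by (simp add: has_field_derivative_iff z)
qed

text \<open>Supplies the direction along which the energy becomes negative. The value at an interior
  point is recorded because it makes the set of nonzeros a nonempty open set.\<close>

lemma test_fun_exists: "\<exists>\<phi> :: real \<Rightarrow> real^'n. test_fun \<phi> \<and> \<phi> (1/2) \<noteq> 0"
proof -
  \<comment> \<open>Any coordinate vector will do; the index type is nonempty, so an unspecified
    index is legitimate.\<close>
  define v :: "real^'n" where "v = axis undefined 1"
  have "test_fun (\<lambda>t. bump 0 t *\<^sub>R v)"
    unfolding test_fun_def
  proof (intro conjI exI[of _ "\<lambda>k t. bump k t *\<^sub>R v"] exI[of _ 1] allI impI)
    show "((\<lambda>t. bump k t *\<^sub>R v) has_vector_derivative bump (Suc k) t *\<^sub>R v) (at t)" for k t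
      using bump_deriv[of k t] by (auto intro!: derivative_eq_intros)
  qed (auto simp: bump_def)
  moreover have "bump 0 (1/2) *\<^sub>R v \<noteq> 0" by (simp add: bump_def v_def axis_eq_0_iff)
  ultimately show ?thesis by blast
qed

section \<open>The superquadratic potential\<close>

locale superquadratic_potential =
  fixes W :: "real \<Rightarrow> real^'n \<Rightarrow> real" and \<mu> :: real
  assumes C1: "C1_pair W"
    and \<mu>: "\<mu> > 2"
    and AR: "x \<noteq> 0 \<Longrightarrow> 0 < \<mu> * W t x \<and> \<mu> * W t x \<le> x \<bullet> nablaW W t x"
    and small: "\<epsilon> > 0 \<Longrightarrow> \<exists>\<delta>>0. \<forall>t x. 0 < norm x \<and> norm x < \<delta> \<longrightarrow> norm (nablaW W t x) \<le> \<epsilon> * norm x"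
    and dominated: "\<exists>Wb :: real^'n \<Rightarrow> real. continuous_on UNIV Wb \<and> (\<forall>t x. \<bar>W t x\<bar> + norm (nablaW W t x) \<le> \<bar>Wb x\<bar>)"
begin

abbreviation g :: "real \<Rightarrow> real^'n \<Rightarrow> real^'n" where "g \<equiv> nablaW W"

text \<open>\<open>nablaW\<close> is assembled from partial derivatives at fixed \<open>t\<close>.
  Matching its components with the joint differential applied to \<open>(0, axis i 1)\<close> turns
  them into a genuine gradient and transfers joint continuity to it.\<close>

lemma gradient:
  shows W_derivative: "(W t has_derivative (\<lambda>y. g t x \<bullet> y)) (at x)"
    and g_continuous: "continuous_on UNIV (\<lambda>p. g (fst p) (snd p))"
    and W_continuous: "continuous_on UNIV (\<lambda>p. W (fst p) (snd p))"
proof -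
  obtain DW where DWc: "continuous_on UNIV DW"
    and DW: "\<And>p. ((\<lambda>q. W (fst q) (snd q)) has_derivative blinfun_apply (DW p)) (at p)"
    using C1 unfolding C1_pair_def by blast
  show "continuous_on UNIV (\<lambda>p. W (fst p) (snd p))"
    by (intro continuous_at_imp_continuous_on ballI has_derivative_continuous[OF DW])
  have part: "(W t has_derivative (\<lambda>y. DW (t, x) (0, y))) (at x)" for t and x :: "real^'n"
  proof -
    have "((\<lambda>x. (t, x)) has_derivative (\<lambda>y. (0, y))) (at x)" by (intro derivative_intros)
    from has_derivative_compose[OF this DW[of "(t, x)"]] show ?thesis by simp
  qed
  have comp: "g t x $ i = DW (t, x) (0, axis i 1)" for t x i
  proof -
    have d: "((\<lambda>s. x + s *\<^sub>R axis i (1::real)) has_derivative (\<lambda>s. s *\<^sub>R axis i 1)) (at 0)"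
      by (auto intro!: derivative_eq_intros)
    have "((\<lambda>s. W t (x + s *\<^sub>R axis i 1)) has_derivative (\<lambda>s. DW (t, x) (0, s *\<^sub>R axis i 1))) (at 0)"
      using has_derivative_compose[OF d, of "W t" "\<lambda>y. DW (t, x) (0, y)"] part by simp
    moreover have "DW (t, x) (0, s *\<^sub>R axis i 1) = DW (t, x) (0, axis i 1) * s" for s
      using blinfun.scaleR_right[of "DW (t, x)" s "(0, axis i 1)"] by simp
    ultimately have "((\<lambda>s. W t (x + s *\<^sub>R axis i 1)) has_field_derivative DW (t, x) (0, axis i 1)) (at 0)"
      by (simp add: has_field_derivative_def)
    thus ?thesis by (simp add: nablaW_def DERIV_imp_deriv)
  qed
  have inner: "DW (t, x) (0, y) = g t x \<bullet> y" for t x y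
  proof -
    have "(0, y) = (\<Sum>i\<in>UNIV. (y $ i) *\<^sub>R (0 :: real, axis i (1::real)))"
    proof (rule prod_eqI)
      show "fst (0, y) = fst (\<Sum>i\<in>UNIV. (y $ i) *\<^sub>R (0 :: real, axis i (1::real)))" by (simp add: fst_sum)
      show "snd (0, y) = snd (\<Sum>i\<in>UNIV. (y $ i) *\<^sub>R (0 :: real, axis i (1::real)))"
        by (simp add: snd_sum basis_expansion flip: scalar_mult_eq_scaleR)
    qed
    hence "DW (t, x) (0, y) = (\<Sum>i\<in>UNIV. (y $ i) * DW (t, x) (0, axis i 1))"
      by (simp only: blinfun.sum_right blinfun.scaleR_right real_scaleR_def)
    also have "\<dots> = g t x \<bullet> y" by (simp add: inner_vec_def comp mult.commute)
    finally show ?thesis .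
  qed
  show "(W t has_derivative (\<lambda>y. g t x \<bullet> y)) (at x)" using part by (simp add: inner)
  have "g (fst p) (snd p) = (\<chi> i. DW p (0, axis i 1))" for p
    by (simp add: vec_eq_iff comp)
  thus "continuous_on UNIV (\<lambda>p. g (fst p) (snd p))"
    by (simp only:) (intro continuous_intros DWc)
qed

lemma g_measurable [measurable]: "u \<in> borel_measurable lborel \<Longrightarrow> (\<lambda>t. g t (u t)) \<in> borel_measurable lborel"
  using borel_measurable_continuous_Pair[of "\<lambda>t. t" lborel u g] g_continuous by simp

lemma W_measurable [measurable]: "u \<in> borel_measurable lborel \<Longrightarrow> (\<lambda>t. W t (u t)) \<in> borel_measurable lborel"
  using borel_measurable_continuous_Pair[of "\<lambda>t. t" lborel u W] W_continuous by simp

lemma W_line: "((\<lambda>s. W t (x + s *\<^sub>R y)) has_field_derivative g t (x + s *\<^sub>R y) \<bullet> y) (at s)"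
proof -
  have "((\<lambda>s. x + s *\<^sub>R y) has_derivative (\<lambda>h. h *\<^sub>R y)) (at s)"
    by (auto intro!: derivative_eq_intros)
  moreover have "(*) (g t (x + s *\<^sub>R y) \<bullet> y) = (\<lambda>h. g t (x + s *\<^sub>R y) \<bullet> (h *\<^sub>R y))"
    by (simp add: fun_eq_iff)
  ultimately show ?thesis
    unfolding has_field_derivative_def using has_derivative_compose[OF _ W_derivative] by metis
qed

lemma W_mvt: "\<exists>\<theta>. 0 < \<theta> \<and> \<theta> < 1 \<and> W t (x + y) - W t x = g t (x + \<theta> *\<^sub>R y) \<bullet> y"
  using MVT2[of 0 1 "\<lambda>s. W t (x + s *\<^sub>R y)" "\<lambda>s. g t (x + s *\<^sub>R y) \<bullet> y"] W_line[of t x y] by fastforce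

lemma g_tendsto: "((\<lambda>x. g t x) \<longlongrightarrow> g t a) (at a)"
proof -
  have "continuous_on UNIV (\<lambda>x. g (fst (t, x)) (snd (t, x)))"
    by (rule continuous_on_compose2[OF g_continuous]) (auto intro!: continuous_intros)
  thus ?thesis by (simp add: continuous_on_def)
qed

lemma g_zero [simp]: "g t 0 = 0"
proof -
  note c = g_tendsto[of t 0]
  have "((\<lambda>x. g t x) \<longlongrightarrow> 0) (at 0)"
  proof (rule tendsto_0_le[where K = 1])
    show "((\<lambda>x. x) \<longlongrightarrow> 0) (at (0::real^'n))" by (rule tendsto_ident_at)
    obtain d where "d > 0" "\<And>x. 0 < norm x \<Longrightarrow> norm x < d \<Longrightarrow> norm (g t x) \<le> 1 * norm x"
      using small[of 1] by auto
    thus "\<forall>\<^sub>F x in at 0. norm (g t x) \<le> norm x * 1"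
      by (auto simp: eventually_at intro!: exI[of _ d])
  qed
  with c show ?thesis using tendsto_unique[OF at_neq_bot] by blast
qed

text \<open>(W1) says nothing at \<open>x = 0\<close>. There \<open>\<mu> * W t x\<close> is
  squeezed between 0 and \<open>x \<bullet> g t x\<close>, which tends to 0, and continuity fixes
  the value.\<close>

lemma W_nonneg_AR: "0 \<le> W t x \<and> \<mu> * W t x \<le> x \<bullet> g t x" and W_zero [simp]: "W t 0 = 0"
proof -
  have c: "((\<lambda>x. W t x) \<longlongrightarrow> W t 0) (at 0)"
    using has_derivative_continuous[OF W_derivative[of t 0]] by (simp add: isCont_def)
  have "((\<lambda>x. \<mu> * W t x) \<longlongrightarrow> 0) (at 0)"
  proof (rule tendsto_sandwich[where f = "\<lambda>x. 0" and h = "\<lambda>x. x \<bullet> g t x"])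
    have ev: "\<forall>\<^sub>F x in at (0::real^'n). x \<noteq> 0" by (rule eventually_neq_at_within)
    show "\<forall>\<^sub>F x in at 0. 0 \<le> \<mu> * W t x" using ev by eventually_elim (use AR[of _ t] in \<open>auto intro: less_imp_le\<close>)
    show "\<forall>\<^sub>F x in at 0. \<mu> * W t x \<le> x \<bullet> g t x" using ev by eventually_elim (use AR[of _ t] in \<open>auto intro: less_imp_le\<close>)
    have "((\<lambda>x. x \<bullet> g t x) \<longlongrightarrow> 0 \<bullet> g t 0) (at 0)" by (intro tendsto_intros g_tendsto)
    thus "((\<lambda>x. x \<bullet> g t x) \<longlongrightarrow> 0) (at 0)" by simp
  qed simp
  moreover have "((\<lambda>x. \<mu> * W t x) \<longlongrightarrow> \<mu> * W t 0) (at 0)" by (intro tendsto_intros c)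
  ultimately have "\<mu> * W t 0 = 0" using tendsto_unique[OF at_neq_bot] by blast
  thus z: "W t 0 = 0" using \<mu> by simp
  show "0 \<le> W t x \<and> \<mu> * W t x \<le> x \<bullet> g t x"
    using AR[of x t] \<mu> z by (cases "x = 0") (auto simp: zero_less_mult_iff)
qed

lemma W_pos: "x \<noteq> 0 \<Longrightarrow> 0 < W t x"
  using AR[of x t] \<mu> by (simp add: zero_less_mult_iff)

text \<open>Along a ray the quotient \<open>W t (s x) / s powr \<mu>\<close> is nondecreasing: its
  derivative is a nonnegative multiple of the Ambrosetti--Rabinowitz difference.\<close>

lemma W_scale:
  assumes s: "s \<ge> 1"
  shows "s powr \<mu> * W t x \<le> W t (s *\<^sub>R x)"
proof -
  define h where "h s = W t (0 + s *\<^sub>R x) * s powr (-\<mu>)" for s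
  have "h 1 \<le> h s"
  proof (rule DERIV_nonneg_imp_nondecreasing[OF s])
    fix r :: real assume r: "1 \<le> r" "r \<le> s"
    have "(h has_field_derivative (g t (0 + r *\<^sub>R x) \<bullet> x) * r powr (-\<mu>) + (-\<mu>) * r powr (-\<mu> - 1) * W t (0 + r *\<^sub>R x)) (at r)"
      unfolding h_def by (rule DERIV_cong[OF DERIV_mult'[OF W_line has_real_derivative_powr]]) (use r in auto)
    moreover have "0 \<le> (g t (0 + r *\<^sub>R x) \<bullet> x) * r powr (-\<mu>) + (-\<mu>) * r powr (-\<mu> - 1) * W t (0 + r *\<^sub>R x)"
    proof -
      have e: "r powr (-\<mu>) = r * r powr (-\<mu> - 1)" using r powr_mult_base[of r "-\<mu> - 1"] by simp
      have "0 \<le> r powr (-\<mu> - 1) * ((r *\<^sub>R x) \<bullet> g t (r *\<^sub>R x) - \<mu> * W t (r *\<^sub>R x))"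
        using W_nonneg_AR[of t "r *\<^sub>R x"] by (intro mult_nonneg_nonneg) auto
      also have "\<dots> = (g t (0 + r *\<^sub>R x) \<bullet> x) * r powr (-\<mu>) + (-\<mu>) * r powr (-\<mu> - 1) * W t (0 + r *\<^sub>R x)"
        by (simp add: e algebra_simps inner_commute)
      finally show ?thesis .
    qed
    ultimately show "\<exists>y. (h has_real_derivative y) (at r) \<and> 0 \<le> y" by blast
  qed
  hence "W t x \<le> W t (s *\<^sub>R x) * s powr (-\<mu>)" by (simp add: h_def)
  hence "s powr \<mu> * W t x \<le> s powr \<mu> * (W t (s *\<^sub>R x) * s powr (-\<mu>))" by (intro mult_left_mono) auto
  also have "\<dots> = W t (s *\<^sub>R x)" using s by (simp add: powr_minus field_simps)
  finally show ?thesis .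
qed

lemma W_le_g:
  assumes "\<And>y. norm y \<le> norm x \<Longrightarrow> norm (g t y) \<le> C * norm y" and C: "C \<ge> 0"
  shows "W t x \<le> C * (norm x)\<^sup>2"
proof -
  obtain \<theta> where \<theta>: "0 < \<theta>" "\<theta> < 1" "W t (0 + x) - W t 0 = g t (0 + \<theta> *\<^sub>R x) \<bullet> x" using W_mvt by blast
  hence n: "norm (\<theta> *\<^sub>R x) \<le> norm x" by (simp add: mult_left_le_one_le)
  have "W t x = g t (\<theta> *\<^sub>R x) \<bullet> x" using \<theta> by simp
  also have "\<dots> \<le> norm (g t (\<theta> *\<^sub>R x)) * norm x" by (rule norm_cauchy_schwarz)
  also have "\<dots> \<le> (C * norm x) * norm x"
    using assms(1)[OF n] mult_left_mono[OF n C] by (intro mult_right_mono) auto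
  finally show ?thesis by (simp add: power2_eq_square mult_ac)
qed

lemma W_small:
  assumes "\<epsilon> > 0"
  shows "\<exists>\<delta>>0. \<forall>t x. norm x < \<delta> \<longrightarrow> W t x \<le> \<epsilon> * (norm x)\<^sup>2"
proof -
  obtain d where d: "d > 0" "\<And>t (x :: real^'n). 0 < norm x \<Longrightarrow> norm x < d \<Longrightarrow> norm (g t x) \<le> \<epsilon> * norm x"
    using small[OF assms] by auto
  have d': "norm (g t x) \<le> \<epsilon> * norm x" if "norm x < d" for t and x :: "real^'n"
    using d(2)[of x t] that by (cases "x = 0") auto
  have "W t x \<le> \<epsilon> * (norm x)\<^sup>2" if "norm x < d" for t and x :: "real^'n"
    by (rule W_le_g) (use d' that assms in auto)
  thus ?thesis using d(1) by blast
qed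

text \<open>Near the origin (W2) gives a linear bound uniformly in \<open>t\<close>; on the rest of
  the ball (W3) gives a constant bound, and a constant is linear away from the origin.\<close>

lemma growth:
  obtains C where "C \<ge> 0" "\<And>t (x :: real^'n). norm x \<le> M \<Longrightarrow> norm (g t x) \<le> C * norm x"
    "\<And>t (x :: real^'n). norm x \<le> M \<Longrightarrow> W t x \<le> C * (norm x)\<^sup>2"
proof -
  obtain d where d: "d > 0" "\<And>t (x :: real^'n). 0 < norm x \<Longrightarrow> norm x < d \<Longrightarrow> norm (g t x) \<le> 1 * norm x"
    using small[of 1] by auto
  obtain Wb where Wb: "continuous_on UNIV Wb" "\<And>t x. \<bar>W t x\<bar> + norm (g t x) \<le> \<bar>Wb x\<bar>" using dominated by blast
  have "compact (Wb ` cball 0 M)" by (intro compact_continuous_image continuous_on_subset[OF Wb(1)]) auto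
  then obtain B where B: "\<And>x. x \<in> cball 0 M \<Longrightarrow> norm (Wb x) \<le> B"
    using compact_imp_bounded bounded_iff by (metis imageI)
  \<comment> \<open>1 is the slope within distance \<open>d\<close> of the origin; beyond it
    \<open>B\<close> equals \<open>(B / d) * d\<close>, at most
    \<open>(B / d) * norm x\<close>.\<close>
  define C where "C = max 1 (B / d)"
  have C1: "C \<ge> 1" by (simp add: C_def)
  have main: "norm (g t x) \<le> C * norm x" if x: "norm x \<le> M" for t and x :: "real^'n"
  proof (cases "norm x < d")
    case True
    have "norm (g t x) \<le> 1 * norm x" using d(2)[of x t] True by (cases "x = 0") auto
    also have "\<dots> \<le> C * norm x" using C1 by (intro mult_right_mono) auto
    finally show ?thesis .
  next
    case False
    have "norm (g t x) \<le> \<bar>Wb x\<bar>" using Wb(2)[of t x] by linarith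
    also have "\<dots> \<le> B" using B[of x] x by simp
    also have "B = B / d * d" using d by simp
    also have "\<dots> \<le> C * norm x"
      using False C1 d by (intro mult_mono) (auto simp: C_def)
    finally show ?thesis .
  qed
  show ?thesis
  proof (rule that[of C])
    show "W t x \<le> C * (norm x)\<^sup>2" if "norm x \<le> M" for t and x :: "real^'n"
      using main that C1 by (intro W_le_g) auto
  qed (use main C1 in auto)
qed

text \<open>Near infinity in time the weight \<open>l\<close> absorbs the linear growth of the gradient; on a bounded
  time interval its uniform continuity is interpolated with its boundedness.\<close>

lemma g_modulus:
  assumes l: "filterlim l at_top at_infinity" and \<epsilon>: "\<epsilon> > 0" and M: "M \<ge> 0"
  obtains T C where "T > 0" "C \<ge> 0"
    "\<And>t (x :: real^'n) y. \<lbrakk>norm x \<le> M; norm y \<le> M\<rbrakk> \<Longrightarrow> norm (g t x - g t y)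
       \<le> \<epsilon> * (sqrt (l t) * (norm x + norm y)) * indicator (- {-T..T}) t + \<epsilon> / sqrt (2 * T) * indicator {-T..T} t + C * norm (x - y)"
proof -
  obtain A where A: "A \<ge> 0" "\<And>t (x :: real^'n). norm x \<le> M \<Longrightarrow> norm (g t x) \<le> A * norm x" using growth[of M] by metis
  have g2: "norm (g t x - g t y) \<le> A * (norm x + norm y)" if "norm x \<le> M" "norm y \<le> M" for t and x y :: "real^'n"
    using norm_triangle_ineq4[of "g t x" "g t y"] A(2)[OF that(1), of t] A(2)[OF that(2), of t] by (simp add: distrib_left)
  have "\<forall>\<^sub>F t in at_infinity. (A / \<epsilon>)\<^sup>2 \<le> l t" using l by (simp add: filterlim_at_top)
  then obtain T0 where T0: "\<And>t. T0 \<le> norm t \<Longrightarrow> (A / \<epsilon>)\<^sup>2 \<le> l t" unfolding eventually_at_infinity by blast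
  \<comment> \<open>Beyond \<open>T0\<close> the weight satisfies
    \<open>A \<le> \<epsilon> * sqrt (l t)\<close>, so it absorbs the growth constant; the maximum
    with 1 keeps the length \<open>2 * T\<close> positive.\<close>
  define T where "T = max T0 1"
  have T: "T > 0" by (simp add: T_def)
  have "uniformly_continuous_on ({-T..T} \<times> cball 0 M) (\<lambda>p. g (fst p) (snd p))"
    by (intro compact_uniformly_continuous continuous_on_subset[OF g_continuous] compact_Times) auto
  \<comment> \<open>This tolerance times the indicator of \<open>{-T..T}\<close> has
    \<open>L2\<close> norm exactly \<epsilon>, whatever the size of \<open>T\<close>.\<close>
  moreover have "\<epsilon> / sqrt (2 * T) > 0" using \<epsilon> T by simp
  ultimately obtain d where d: "d > 0" "\<And>p q. \<lbrakk>p \<in> {-T..T} \<times> cball 0 M; q \<in> {-T..T} \<times> cball 0 M; dist p q < d\<rbrakk>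
      \<Longrightarrow> dist (g (fst p) (snd p)) (g (fst q) (snd q)) < \<epsilon> / sqrt (2 * T)"
    unfolding uniformly_continuous_on_def by metis
  \<comment> \<open>If \<open>x\<close> and \<open>y\<close> are at least \<open>d\<close> apart,
    the crude bound \<open>A * (M + M)\<close> is already at most
    \<open>C * norm (x - y)\<close>.\<close>
  define C where "C = A * (M + M) / d"
  have C: "C \<ge> 0" using A M d by (simp add: C_def)
  show ?thesis
  proof (rule that[OF T C])
    fix t and x y :: "real^'n" assume xy: "norm x \<le> M" "norm y \<le> M"
    show "norm (g t x - g t y) \<le> \<epsilon> * (sqrt (l t) * (norm x + norm y)) * indicator (- {-T..T}) t
      + \<epsilon> / sqrt (2 * T) * indicator {-T..T} t + C * norm (x - y)"
    proof (cases "t \<in> {-T..T}")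
      case True
      show ?thesis
      proof (cases "norm (x - y) < d")
        case True': True
        have "dist (g t x) (g t y) < \<epsilon> / sqrt (2 * T)"
          using d(2)[of "(t, x)" "(t, y)"] True True' xy by (simp add: dist_Pair_Pair dist_norm)
        moreover have "0 \<le> C * norm (x - y)" using C by simp
        ultimately show ?thesis using True by (simp add: dist_norm)
      next
        case False
        have "norm (g t x - g t y) \<le> A * (norm x + norm y)" by (rule g2[OF xy])
        also have "\<dots> \<le> A * (M + M)" using xy A by (intro mult_left_mono add_mono) auto
        also have "\<dots> = C * d" using d by (simp add: C_def)
        also have "\<dots> \<le> C * norm (x - y)" using False C by (intro mult_left_mono) auto
        finally have "norm (g t x - g t y) \<le> C * norm (x - y)" .
        moreover have "0 \<le> \<epsilon> / sqrt (2 * T)" using \<epsilon> T by simp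
        ultimately show ?thesis using True by simp
      qed
    next
      case False
      hence "T0 \<le> norm t" by (auto simp: T_def abs_if)
      hence "A / \<epsilon> \<le> sqrt (l t)" by (intro real_le_rsqrt T0)
      hence "A \<le> \<epsilon> * sqrt (l t)" using A \<epsilon> by (simp add: field_simps)
      hence "A * (norm x + norm y) \<le> \<epsilon> * sqrt (l t) * (norm x + norm y)" by (intro mult_right_mono) auto
      hence "norm (g t x - g t y) \<le> \<epsilon> * (sqrt (l t) * (norm x + norm y))" using g2[OF xy, of t] by (simp add: mult.assoc)
      moreover have "0 \<le> C * norm (x - y)" using C by simp
      ultimately show ?thesis using False by simp
    qed
  qed
qed

end

section \<open>The fractional Sobolev space\<close>

lemma l2n_tendsto_iff: "((\<lambda>k. \<integral>t. (norm (f k t))\<^sup>2 \<partial>lborel) \<longlongrightarrow> 0) F \<longleftrightarrow> ((\<lambda>k. l2n (f k)) \<longlongrightarrow> 0) F"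
proof
  assume "((\<lambda>k. \<integral>t. (norm (f k t))\<^sup>2 \<partial>lborel) \<longlongrightarrow> 0) F"
  from tendsto_real_sqrt[OF this] show "((\<lambda>k. l2n (f k)) \<longlongrightarrow> 0) F" by (simp add: l2n_def)
next
  assume "((\<lambda>k. l2n (f k)) \<longlongrightarrow> 0) F"
  from tendsto_power[OF this, of 2] show "((\<lambda>k. \<integral>t. (norm (f k t))\<^sup>2 \<partial>lborel) \<longlongrightarrow> 0) F" by (simp add: l2n_sq)
qed

lemma l2n_diff_triangle:
  assumes "L2 f" "L2 g" "L2 h"
  shows "l2n (\<lambda>t. f t - h t) \<le> l2n (\<lambda>t. f t - g t) + l2n (\<lambda>t. g t - h t)"
  using l2n_triangle[OF L2_diff[OF assms(1,2)] L2_diff[OF assms(2,3)]] by simp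

lemma l2n_minus: "l2n (\<lambda>t. f t - g t) = l2n (\<lambda>t. g t - f t)"
  by (simp add: l2n_def norm_minus_commute)

lemma l2n_diff_ineq:
  assumes "L2 f" "L2 g"
  shows "\<bar>l2n f - l2n g\<bar> \<le> l2n (\<lambda>t. f t - g t)"
  using l2n_triangle[OF L2_diff[OF assms] assms(2)] l2n_triangle[OF L2_diff[OF assms(2,1)] assms(1)]
    l2n_minus[of f g] by simp

context frac_order
begin

lemma test_approx_sequence:
  assumes "\<And>k \<epsilon>. \<epsilon> > 0 \<Longrightarrow> \<exists>\<phi> \<phi>'. test_pair \<phi> \<phi>' \<and> l2n (\<lambda>t. \<phi> t - u k t) < \<epsilon> \<and> l2n (\<lambda>t. frac_conv \<phi>' t - Du k t) < \<epsilon>"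
  obtains \<phi> \<phi>' where "\<And>k. test_pair (\<phi> k) (\<phi>' k)"
    "\<And>k :: nat. l2n (\<lambda>t. \<phi> k t - u k t) < 1 / real (Suc k)"
    "\<And>k. l2n (\<lambda>t. frac_conv (\<phi>' k) t - Du k t) < 1 / real (Suc k)"
proof -
  have "\<exists>q. test_pair (fst q) (snd q) \<and> l2n (\<lambda>t. fst q t - u k t) < 1 / real (Suc k)
      \<and> l2n (\<lambda>t. frac_conv (snd q) t - Du k t) < 1 / real (Suc k)" for k
  proof -
    have "1 / real (Suc k) > 0" by simp
    from assms[OF this, of k] obtain \<phi> \<phi>' where "test_pair \<phi> \<phi>' \<and> l2n (\<lambda>t. \<phi> t - u k t) < 1 / real (Suc k)
      \<and> l2n (\<lambda>t. frac_conv \<phi>' t - Du k t) < 1 / real (Suc k)" by blast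
    thus ?thesis by (intro exI[of _ "(\<phi>, \<phi>')"]) simp
  qed
  hence "\<exists>q. \<forall>k. test_pair (fst (q k)) (snd (q k)) \<and> l2n (\<lambda>t. fst (q k) t - u k t) < 1 / real (Suc k)
      \<and> l2n (\<lambda>t. frac_conv (snd (q k)) t - Du k t) < 1 / real (Suc k)" by (intro choice) blast
  then obtain q where q: "\<forall>k. test_pair (fst (q k)) (snd (q k)) \<and> l2n (\<lambda>t. fst (q k) t - u k t) < 1 / real (Suc k)
      \<and> l2n (\<lambda>t. frac_conv (snd (q k)) t - Du k t) < 1 / real (Suc k)" by blast
  show ?thesis by (rule that[of "\<lambda>k. fst (q k)" "\<lambda>k. snd (q k)"]) (use q in blast)+
qed

text \<open>Replaces the approximating sequence by \<epsilon>-approximations and the Liouville--Weyl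
  derivative by the convolution. In this form closedness follows from a triangle inequality, without
  diagonal sequences.\<close>

lemma frac_H_iff:
  "frac_H \<alpha> u Du \<longleftrightarrow> L2 u \<and> L2 Du \<and>
    (\<forall>\<epsilon>>0. \<exists>\<phi> \<phi>'. test_pair \<phi> \<phi>' \<and> l2n (\<lambda>t. \<phi> t - u t) < \<epsilon> \<and> l2n (\<lambda>t. frac_conv \<phi>' t - Du t) < \<epsilon>)"
  (is "?A \<longleftrightarrow> ?B")
proof
  assume ?A
  then obtain \<phi> where L: "L2 u" "L2 Du" and \<phi>: "\<And>k. test_fun (\<phi> k)"
    and l: "(\<lambda>k. l2n (\<lambda>t. \<phi> k t - u t)) \<longlonglongrightarrow> 0" "(\<lambda>k. l2n (\<lambda>t. LW_left_deriv \<alpha> (\<phi> k) t - Du t)) \<longlonglongrightarrow> 0"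
    unfolding frac_H_def l2n_tendsto_iff by blast
  have "\<exists>\<phi> \<phi>'. test_pair \<phi> \<phi>' \<and> l2n (\<lambda>t. \<phi> t - u t) < \<epsilon> \<and> l2n (\<lambda>t. frac_conv \<phi>' t - Du t) < \<epsilon>" if "\<epsilon> > 0" for \<epsilon>
  proof -
    have "\<forall>\<^sub>F k in sequentially. l2n (\<lambda>t. \<phi> k t - u t) < \<epsilon> \<and> l2n (\<lambda>t. LW_left_deriv \<alpha> (\<phi> k) t - Du t) < \<epsilon>"
      using order_tendstoD(2)[OF l(1) that] order_tendstoD(2)[OF l(2) that] by eventually_elim simp
    then obtain k where k: "l2n (\<lambda>t. \<phi> k t - u t) < \<epsilon>" "l2n (\<lambda>t. LW_left_deriv \<alpha> (\<phi> k) t - Du t) < \<epsilon>"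
      unfolding eventually_sequentially by blast
    obtain \<phi>' where "test_pair (\<phi> k) \<phi>'" using test_fun_pair[OF \<phi>] .
    thus ?thesis using k LW_left_deriv_conv by metis
  qed
  thus ?B using L by blast
next
  assume B: ?B
  then obtain \<phi> \<phi>' where p: "\<And>k. test_pair (\<phi> k) (\<phi>' k)"
    and l: "\<And>k. l2n (\<lambda>t. \<phi> k t - u t) < 1 / real (Suc k)" "\<And>k. l2n (\<lambda>t. frac_conv (\<phi>' k) t - Du t) < 1 / real (Suc k)"
    using test_approx_sequence[of "\<lambda>k. u" "\<lambda>k. Du"] by blast
  have z: "(\<lambda>k. 1 / real (Suc k)) \<longlonglongrightarrow> 0" by (rule LIMSEQ_Suc[OF lim_1_over_n])
  have 1: "(\<lambda>k. l2n (\<lambda>t. \<phi> k t - u t)) \<longlonglongrightarrow> 0"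
    by (rule tendsto_sandwich[OF _ _ tendsto_const z]) (use l(1) in \<open>auto intro!: always_eventually less_imp_le simp del: of_nat_Suc\<close>)
  have 2: "(\<lambda>k. l2n (\<lambda>t. frac_conv (\<phi>' k) t - Du t)) \<longlonglongrightarrow> 0"
    by (rule tendsto_sandwich[OF _ _ tendsto_const z]) (use l(2) in \<open>auto intro!: always_eventually less_imp_le simp del: of_nat_Suc\<close>)
  show ?A unfolding frac_H_def l2n_tendsto_iff
  proof (intro conjI exI[of _ \<phi>] allI)
    show "test_fun (\<phi> k)" for k using p by (simp add: test_pair_def)
    show "L2 (\<phi> k)" "L2 (LW_left_deriv \<alpha> (\<phi> k))" for k
      using frac_conv_L2[OF p] by (simp_all add: LW_left_deriv_conv[OF p])
    show "(\<lambda>k. l2n (\<lambda>t. LW_left_deriv \<alpha> (\<phi> k) t - Du t)) \<longlonglongrightarrow> 0"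
      using 2 by (simp add: LW_left_deriv_conv[OF p])
  qed (use B 1 in auto)
qed

lemma frac_H_L2: "frac_H \<alpha> u Du \<Longrightarrow> L2 u" "frac_H \<alpha> u Du \<Longrightarrow> L2 Du"
  by (simp_all add: frac_H_def)

lemma frac_H_test:
  assumes p: "test_pair \<phi> \<phi>'" shows "frac_H \<alpha> \<phi> (frac_conv \<phi>')"
  unfolding frac_H_iff
proof (intro conjI allI impI frac_conv_L2[OF p])
  fix \<epsilon> :: real assume "\<epsilon> > 0"
  hence "test_pair \<phi> \<phi>' \<and> l2n (\<lambda>t. \<phi> t - \<phi> t) < \<epsilon> \<and> l2n (\<lambda>t. frac_conv \<phi>' t - frac_conv \<phi>' t) < \<epsilon>"
    using p by (simp add: l2n_def)
  thus "\<exists>\<psi> \<psi>'. test_pair \<psi> \<psi>' \<and> l2n (\<lambda>t. \<psi> t - \<phi> t) < \<epsilon> \<and> l2n (\<lambda>t. frac_conv \<psi>' t - frac_conv \<phi>' t) < \<epsilon>" by blast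
qed

text \<open>The space is the closure of a graph, so it contains the limits of its own elements as
  well as those of test functions. This supplies the derivative in the completeness of the energy
  space.\<close>

lemma frac_H_closed:
  assumes L: "L2 u" "L2 Du"
    and ap: "\<And>\<epsilon>. \<epsilon> > 0 \<Longrightarrow> \<exists>v Dv. frac_H \<alpha> v Dv \<and> l2n (\<lambda>t. v t - u t) < \<epsilon> \<and> l2n (\<lambda>t. Dv t - Du t) < \<epsilon>"
  shows "frac_H \<alpha> u Du"
  unfolding frac_H_iff
proof (intro conjI allI impI L)
  fix \<epsilon> :: real assume \<epsilon>: "\<epsilon> > 0"
  then obtain v Dv where v: "frac_H \<alpha> v Dv" "l2n (\<lambda>t. v t - u t) < \<epsilon> / 2" "l2n (\<lambda>t. Dv t - Du t) < \<epsilon> / 2"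
    using ap[of "\<epsilon> / 2"] by auto
  from v(1) \<epsilon> obtain \<phi> \<phi>' where p: "test_pair \<phi> \<phi>'" "l2n (\<lambda>t. \<phi> t - v t) < \<epsilon> / 2" "l2n (\<lambda>t. frac_conv \<phi>' t - Dv t) < \<epsilon> / 2"
    unfolding frac_H_iff by (meson half_gt_zero)
  note Lp = frac_conv_L2[OF p(1)] and Lv = frac_H_L2[OF v(1)]
  have "l2n (\<lambda>t. \<phi> t - u t) < \<epsilon>" using l2n_diff_triangle[OF Lp(1) Lv(1) L(1)] p v by simp
  moreover have "l2n (\<lambda>t. frac_conv \<phi>' t - Du t) < \<epsilon>" using l2n_diff_triangle[OF Lp(2) Lv(2) L(2)] p v by simp
  ultimately show "\<exists>\<phi> \<phi>'. test_pair \<phi> \<phi>' \<and> l2n (\<lambda>t. \<phi> t - u t) < \<epsilon> \<and> l2n (\<lambda>t. frac_conv \<phi>' t - Du t) < \<epsilon>"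
    using p(1) by blast
qed

lemma l2n_combination:
  assumes "L2 f" "L2 g" "L2 f'" "L2 g'"
  shows "l2n (\<lambda>t. (a *\<^sub>R f t + b *\<^sub>R g t) - (a *\<^sub>R f' t + b *\<^sub>R g' t)) \<le> \<bar>a\<bar> * l2n (\<lambda>t. f t - f' t) + \<bar>b\<bar> * l2n (\<lambda>t. g t - g' t)"
proof -
  have "l2n (\<lambda>t. a *\<^sub>R (f t - f' t) + b *\<^sub>R (g t - g' t)) \<le> l2n (\<lambda>t. a *\<^sub>R (f t - f' t)) + l2n (\<lambda>t. b *\<^sub>R (g t - g' t))"
    by (intro l2n_triangle L2_scale L2_diff assms)
  moreover have "(\<lambda>t. a *\<^sub>R (f t - f' t) + b *\<^sub>R (g t - g' t)) = (\<lambda>t. (a *\<^sub>R f t + b *\<^sub>R g t) - (a *\<^sub>R f' t + b *\<^sub>R g' t))"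
    by (simp add: fun_eq_iff algebra_simps)
  ultimately show ?thesis by (simp only: l2n_scale)
qed

lemma frac_H_linear:
  assumes u: "frac_H \<alpha> u Du" and v: "frac_H \<alpha> v Dv"
  shows "frac_H \<alpha> (\<lambda>t. a *\<^sub>R u t + b *\<^sub>R v t) (\<lambda>t. a *\<^sub>R Du t + b *\<^sub>R Dv t)"
proof (rule frac_H_closed)
  note Lu = frac_H_L2[OF u] and Lv = frac_H_L2[OF v]
  show "L2 (\<lambda>t. a *\<^sub>R u t + b *\<^sub>R v t)" "L2 (\<lambda>t. a *\<^sub>R Du t + b *\<^sub>R Dv t)"
    by (intro L2_add L2_scale Lu Lv)+
  fix \<epsilon> :: real assume \<epsilon>: "\<epsilon> > 0"
  \<comment> \<open>The added 1 avoids division by zero when both coefficients vanish and makes the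
    final inequality strict.\<close>
  define d where "d = \<epsilon> / (\<bar>a\<bar> + \<bar>b\<bar> + 1)"
  have d: "d > 0" using \<epsilon> by (simp add: d_def add_nonneg_pos)
  have ab: "(\<bar>a\<bar> + \<bar>b\<bar>) * d < \<epsilon>"
  proof -
    have "(\<bar>a\<bar> + \<bar>b\<bar>) * d < (\<bar>a\<bar> + \<bar>b\<bar> + 1) * d" using d by (intro mult_strict_right_mono) auto
    also have "\<dots> = \<epsilon>" unfolding d_def by (simp add: add_nonneg_eq_0_iff add_nonneg_pos less_imp_neq[THEN not_sym])
    finally show ?thesis .
  qed
  obtain \<phi> \<phi>' where p: "test_pair \<phi> \<phi>'" "l2n (\<lambda>t. \<phi> t - u t) < d" "l2n (\<lambda>t. frac_conv \<phi>' t - Du t) < d"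
    using u d unfolding frac_H_iff by blast
  obtain \<psi> \<psi>' where q: "test_pair \<psi> \<psi>'" "l2n (\<lambda>t. \<psi> t - v t) < d" "l2n (\<lambda>t. frac_conv \<psi>' t - Dv t) < d"
    using v d unfolding frac_H_iff by blast
  note Lp = frac_conv_L2[OF p(1)] and Lq = frac_conv_L2[OF q(1)]
  have small: "\<bar>a\<bar> * x + \<bar>b\<bar> * y < \<epsilon>" if "x < d" "y < d" for x y
  proof -
    have "\<bar>a\<bar> * x + \<bar>b\<bar> * y \<le> \<bar>a\<bar> * d + \<bar>b\<bar> * d" using that by (intro add_mono mult_left_mono) auto
    thus ?thesis using ab by (simp add: distrib_right)
  qed
  show "\<exists>w Dw. frac_H \<alpha> w Dw \<and> l2n (\<lambda>t. w t - (a *\<^sub>R u t + b *\<^sub>R v t)) < \<epsilon> \<and> l2n (\<lambda>t. Dw t - (a *\<^sub>R Du t + b *\<^sub>R Dv t)) < \<epsilon>"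
  proof (intro exI conjI)
    show "frac_H \<alpha> (\<lambda>t. a *\<^sub>R \<phi> t + b *\<^sub>R \<psi> t) (frac_conv (\<lambda>t. a *\<^sub>R \<phi>' t + b *\<^sub>R \<psi>' t))"
      by (intro frac_H_test test_pair_linear p q)
    show "l2n (\<lambda>t. (a *\<^sub>R \<phi> t + b *\<^sub>R \<psi> t) - (a *\<^sub>R u t + b *\<^sub>R v t)) < \<epsilon>"
      using l2n_combination[OF Lp(1) Lq(1) Lu(1) Lv(1)] small[OF p(2) q(2)] by (rule order.strict_trans1)
    show "l2n (\<lambda>t. frac_conv (\<lambda>t. a *\<^sub>R \<phi>' t + b *\<^sub>R \<psi>' t) t - (a *\<^sub>R Du t + b *\<^sub>R Dv t)) < \<epsilon>"
      unfolding frac_conv_linear[OF p(1) q(1)]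
      using l2n_combination[OF Lp(2) Lq(2) Lu(2) Lv(2)] small[OF p(3) q(3)] by (rule order.strict_trans1)
  qed
qed

text \<open>The bound for test functions passes to the limit: both norms converge along the
  approximating sequence, and a subsequence converges almost everywhere.\<close>

lemma frac_H_sup:
  obtains C where "C \<ge> 0"
    and "\<And>(u :: real \<Rightarrow> real^'n) Du. frac_H \<alpha> u Du \<Longrightarrow> AE t in lborel. norm (u t) \<le> l2n u + C * l2n Du"
proof -
  obtain C where C: "C \<ge> 0" and sup: "\<And>(\<phi> :: real \<Rightarrow> real^'n) \<phi>' x. test_pair \<phi> \<phi>' \<Longrightarrow> norm (\<phi> x) \<le> l2n \<phi> + C * l2n (frac_conv \<phi>')"
    using test_sup by blast
  have "AE t in lborel. norm (u t) \<le> l2n u + C * l2n Du" if u: "frac_H \<alpha> u Du" for u Du :: "real \<Rightarrow> real^'n"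
  proof -
    note Lu = frac_H_L2[OF u]
    from u obtain \<phi> where \<phi>: "\<And>k. test_fun (\<phi> k)"
      and l: "(\<lambda>k. \<integral>t. (norm (\<phi> k t - u t))\<^sup>2 \<partial>lborel) \<longlonglongrightarrow> 0" "(\<lambda>k. l2n (\<lambda>t. LW_left_deriv \<alpha> (\<phi> k) t - Du t)) \<longlonglongrightarrow> 0"
      unfolding frac_H_def l2n_tendsto_iff[of "\<lambda>k t. LW_left_deriv \<alpha> (\<phi> k) t - Du t" for \<phi>] by blast
    obtain \<phi>' where p: "\<And>k. test_pair (\<phi> k) (\<phi>' k)" using choice[of "\<lambda>k. test_pair (\<phi> k)"] test_fun_pair[OF \<phi>] by blast
    note Lp = frac_conv_L2[OF p]
    obtain r where r: "strict_mono r" "AE t in lborel. (\<lambda>k. \<phi> (r k) t) \<longlonglongrightarrow> u t"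
      by (rule L2_AE_subseq[OF Lp(1) Lu(1) l(1)])
    have n1: "(\<lambda>k. l2n (\<phi> k)) \<longlonglongrightarrow> l2n u"
    proof (rule LIM_zero_cancel, rule tendsto_0_le[where K = 1])
      show "(\<lambda>k. l2n (\<lambda>t. \<phi> k t - u t)) \<longlonglongrightarrow> 0" using l(1) by (simp add: l2n_tendsto_iff)
      show "\<forall>\<^sub>F k in sequentially. norm (l2n (\<phi> k) - l2n u) \<le> norm (l2n (\<lambda>t. \<phi> k t - u t)) * 1"
        using l2n_diff_ineq[OF Lp(1) Lu(1)] by (intro always_eventually) auto
    qed
    have n2: "(\<lambda>k. l2n (frac_conv (\<phi>' k))) \<longlonglongrightarrow> l2n Du"
    proof (rule LIM_zero_cancel, rule tendsto_0_le[where K = 1])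
      show "(\<lambda>k. l2n (\<lambda>t. frac_conv (\<phi>' k) t - Du t)) \<longlonglongrightarrow> 0" using l(2) by (simp add: LW_left_deriv_conv[OF p])
      show "\<forall>\<^sub>F k in sequentially. norm (l2n (frac_conv (\<phi>' k)) - l2n Du) \<le> norm (l2n (\<lambda>t. frac_conv (\<phi>' k) t - Du t)) * 1"
        using l2n_diff_ineq[OF Lp(2) Lu(2)] by (intro always_eventually) auto
    qed
    have rhs: "(\<lambda>k. l2n (\<phi> (r k)) + C * l2n (frac_conv (\<phi>' (r k)))) \<longlonglongrightarrow> l2n u + C * l2n Du"
      using LIMSEQ_subseq_LIMSEQ[OF n1 r(1)] LIMSEQ_subseq_LIMSEQ[OF n2 r(1)]
      by (intro tendsto_intros) (simp_all add: o_def)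
    show ?thesis using r(2)
    proof eventually_elim
      case (elim t)
      show ?case by (rule LIMSEQ_le[OF tendsto_norm[OF elim] rhs]) (use sup[OF p] in auto)
    qed
  qed
  thus ?thesis using that[of C] C by blast
qed

text \<open>Approximating test functions are uniformly bounded and equi-Hoelder, so a subsequence converges
  pointwise; on bounded intervals dominated convergence applies.\<close>

lemma frac_H_locally_compact:
  fixes u Du :: "nat \<Rightarrow> real \<Rightarrow> real^'n"
  assumes u: "\<And>k. frac_H \<alpha> (u k) (Du k)" and bd: "\<And>k. l2n (u k) \<le> R" "\<And>k. l2n (Du k) \<le> R"
  obtains r where "strict_mono (r :: nat \<Rightarrow> nat)"
    and "\<And>T \<epsilon>. \<epsilon> > 0 \<Longrightarrow> \<exists>N. \<forall>i\<ge>N. \<forall>j\<ge>N. l2n (\<lambda>t. indicator {-T..T} t *\<^sub>R (u (r i) t - u (r j) t)) < \<epsilon>"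
proof -
  obtain \<phi> \<phi>' where p: "\<And>k. test_pair (\<phi> k) (\<phi>' k)"
    and l: "\<And>k. l2n (\<lambda>t. \<phi> k t - u k t) < 1 / real (Suc k)" "\<And>k. l2n (\<lambda>t. frac_conv (\<phi>' k) t - Du k t) < 1 / real (Suc k)"
    using test_approx_sequence[of u Du] u unfolding frac_H_iff by blast
  note Lp = frac_conv_L2[OF p] and Lu = frac_H_L2[OF u]
  have one: "1 / real (Suc k) \<le> 1" for k by simp
  have b1: "l2n (\<phi> k) \<le> R + 1" and b2: "l2n (frac_conv (\<phi>' k)) \<le> R + 1" for k
    using l2n_diff_ineq[OF Lp(1)[of k] Lu(1)[of k]] l2n_diff_ineq[OF Lp(2)[of k] Lu(2)[of k]] l[of k] one[of k] bd[of k]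
    by linarith+
  obtain C where C: "C \<ge> 0" and sup: "\<And>(\<phi> :: real \<Rightarrow> real^'n) \<phi>' x. test_pair \<phi> \<phi>' \<Longrightarrow> norm (\<phi> x) \<le> l2n \<phi> + C * l2n (frac_conv \<phi>')"
    using test_sup by blast
  obtain H where H: "H \<ge> 0" and hol: "\<And>(\<phi> :: real \<Rightarrow> real^'n) \<phi>' x y. test_pair \<phi> \<phi>' \<Longrightarrow>
      norm (\<phi> x - \<phi> y) \<le> H * \<bar>x - y\<bar> powr (\<alpha> - 1/2) * l2n (frac_conv \<phi>')"
    using test_holder by blast
  define M where "M = (R + 1) + C * (R + 1)"
  have bound: "norm (\<phi> k x) \<le> M" for k x
    using sup[OF p[of k], of x] b1[of k] mult_left_mono[OF b2[of k] C] by (simp add: M_def)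
  have R1: "R + 1 \<ge> 0" using b1[of 0] l2n_nonneg[of "\<phi> 0"] by linarith
  have equi: "norm (\<phi> k x - \<phi> k y) \<le> H * \<bar>x - y\<bar> powr (\<alpha> - 1/2) * (R + 1)" for k x y
    using hol[OF p[of k], of x y] mult_left_mono[OF b2[of k], of "H * \<bar>x - y\<bar> powr (\<alpha> - 1/2)"] H by fastforce
  \<comment> \<open>A diagonal extraction secures convergence at the rationals; the equi-Hoelder
    bound then carries it to every real point through a nearby rational.\<close>
  obtain r where r: "strict_mono (r :: nat \<Rightarrow> nat)" and rat: "\<And>x. x \<in> \<rat> \<Longrightarrow> \<exists>l. (\<lambda>n. \<phi> (r n) x) \<longlonglongrightarrow> l"
    by (rule function_convergent_subsequence[of "\<rat> :: real set" \<phi> M]) (auto simp: countable_rat bound)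
  have conv: "convergent (\<lambda>n. \<phi> (r n) x)" for x
  proof (rule Cauchy_convergent, rule metric_CauchyI)
    fix e :: real assume e: "e > 0"
    have "((\<lambda>h. H * \<bar>h\<bar> powr (\<alpha> - 1/2) * (R + 1)) \<longlongrightarrow> H * \<bar>0\<bar> powr (\<alpha> - 1/2) * (R + 1)) (at 0)"
      using \<alpha> by (intro tendsto_intros) auto
    hence "\<forall>\<^sub>F h in at 0. H * \<bar>h\<bar> powr (\<alpha> - 1/2) * (R + 1) < e / 3"
      using e \<alpha> by (intro order_tendstoD(2)[where y = "H * \<bar>0\<bar> powr (\<alpha> - 1/2) * (R + 1)"]) auto
    then obtain d where d: "d > 0" "\<And>h. \<lbrakk>h \<noteq> 0; \<bar>h\<bar> < d\<rbrakk> \<Longrightarrow> H * \<bar>h\<bar> powr (\<alpha> - 1/2) * (R + 1) < e / 3"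
      by (auto simp: eventually_at)
    obtain q where q: "q \<in> \<rat>" "x < q" "q < x + d" using Rats_dense_in_real[of x "x + d"] d by auto
    have near: "norm (\<phi> k x - \<phi> k q) < e / 3" for k
      using equi[of k x q] d(2)[of "x - q"] q by linarith
    from rat[OF q(1)] have "Cauchy (\<lambda>n. \<phi> (r n) q)" using LIMSEQ_imp_Cauchy by blast
    then obtain N where N: "\<And>i j. i \<ge> N \<Longrightarrow> j \<ge> N \<Longrightarrow> dist (\<phi> (r i) q) (\<phi> (r j) q) < e / 3"
      using e unfolding Cauchy_def by (metis zero_less_divide_iff zero_less_numeral)
    have "dist (\<phi> (r i) x) (\<phi> (r j) x) < e" if "i \<ge> N" "j \<ge> N" for i j
    proof -
      have "\<phi> (r i) x - \<phi> (r j) x = (\<phi> (r i) x - \<phi> (r i) q) + (\<phi> (r i) q - \<phi> (r j) q) - (\<phi> (r j) x - \<phi> (r j) q)" by simp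
      also have "norm \<dots> \<le> norm (\<phi> (r i) x - \<phi> (r i) q) + norm (\<phi> (r i) q - \<phi> (r j) q) + norm (\<phi> (r j) x - \<phi> (r j) q)"
        by (intro order_trans[OF norm_triangle_ineq4] add_right_mono norm_triangle_ineq)
      finally show ?thesis using near[of "r i"] near[of "r j"] N[OF that] by (simp add: dist_norm)
    qed
    thus "\<exists>N. \<forall>m\<ge>N. \<forall>n\<ge>N. dist (\<phi> (r m) x) (\<phi> (r n) x) < e" by blast
  qed
  define w where "w x = lim (\<lambda>n. \<phi> (r n) x)" for x
  have lim: "(\<lambda>n. \<phi> (r n) x) \<longlonglongrightarrow> w x" for x
    unfolding w_def using conv[of x] by (simp add: convergent_LIMSEQ_iff)
  have [measurable]: "\<phi> k \<in> borel_measurable lborel" for k using Lp(1) by (rule L2_measurable)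
  have [measurable]: "w \<in> borel_measurable lborel" by (rule borel_measurable_LIMSEQ_metric[OF _ lim]) measurable
  have wb: "norm (w x) \<le> M" for x
    by (rule LIMSEQ_le_const2[OF tendsto_norm[OF lim]]) (use bound in auto)
  have M0: "M \<ge> 0" using bound[of 0 0] norm_ge_zero order_trans by blast
  \<comment> \<open>The difference between \<open>u\<close> and \<phi> is small in \<open>L2\<close>
    on the whole line, but \<phi> approaches its pointwise limit \<open>w\<close> in
    \<open>L2\<close> only after the cutoff, where \<open>(2 * M)^2\<close> times the indicator
    dominates. Two errors below \<open>\<epsilon> / 4\<close> for each of the two indices add up to
    \<epsilon>.\<close>
  have local: "\<exists>N. \<forall>i\<ge>N. \<forall>j\<ge>N. l2n (\<lambda>t. indicator {-T..T} t *\<^sub>R (u (r i) t - u (r j) t)) < \<epsilon>" if \<epsilon>: "\<epsilon> > 0" for T \<epsilon>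
  proof -
    define J where "J t = (indicator {-T..T} t :: real)" for t
    have [measurable]: "J \<in> borel_measurable borel" unfolding J_def by measurable
    have Jb: "norm (J t *\<^sub>R y) \<le> norm y" for t and y :: "real^'n" by (simp add: J_def indicator_def)
    have dom: "(norm (J t *\<^sub>R (\<phi> (r n) t - w t)))\<^sup>2 \<le> (2 * M)\<^sup>2 * J t" for n t
    proof -
      have "norm (\<phi> (r n) t - w t) \<le> 2 * M"
        using norm_triangle_ineq4[of "\<phi> (r n) t" "w t"] bound[of "r n" t] wb[of t] by simp
      hence "(norm (\<phi> (r n) t - w t))\<^sup>2 \<le> (2 * M)\<^sup>2" by (intro power_mono) auto
      thus ?thesis by (simp add: J_def indicator_def)
    qed
    have domi: "integrable lborel (\<lambda>t. (2 * M)\<^sup>2 * J t)" unfolding J_def by (intro integrable_mult_right integrable_indicator_Icc)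
    have LJ: "L2 (\<lambda>t. J t *\<^sub>R (\<phi> (r n) t - w t))" for n
      by (rule L2_bound[OF _ domi]) (use dom in auto)
    have "(\<lambda>n. \<integral>t. (norm (J t *\<^sub>R (\<phi> (r n) t - w t)))\<^sup>2 \<partial>lborel) \<longlonglongrightarrow> integral\<^sup>L lborel (\<lambda>t :: real. 0)"
    proof (rule integral_dominated_convergence[where w = "\<lambda>t. (2 * M)\<^sup>2 * J t"])
      show "integrable lborel (\<lambda>t. (2 * M)\<^sup>2 * J t)" by (rule domi)
      show "AE t in lborel. (\<lambda>n. (norm (J t *\<^sub>R (\<phi> (r n) t - w t)))\<^sup>2) \<longlonglongrightarrow> 0"
      proof (intro AE_I2)
        fix t
        have "(\<lambda>n. (norm (J t *\<^sub>R (\<phi> (r n) t - w t)))\<^sup>2) \<longlonglongrightarrow> (norm (J t *\<^sub>R (w t - w t)))\<^sup>2"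
          by (intro tendsto_intros lim)
        thus "(\<lambda>n. (norm (J t *\<^sub>R (\<phi> (r n) t - w t)))\<^sup>2) \<longlonglongrightarrow> 0" by simp
      qed
    qed (use dom in auto)
    hence lJ: "(\<lambda>n. l2n (\<lambda>t. J t *\<^sub>R (\<phi> (r n) t - w t))) \<longlonglongrightarrow> 0" by (simp only: integral_zero l2n_tendsto_iff)
    have lu: "(\<lambda>n. l2n (\<lambda>t. \<phi> (r n) t - u (r n) t)) \<longlonglongrightarrow> 0"
    proof -
      have z: "(\<lambda>k. 1 / real (Suc k)) \<longlonglongrightarrow> 0" by (rule LIMSEQ_Suc[OF lim_1_over_n])
      have "(\<lambda>n. l2n (\<lambda>t. \<phi> n t - u n t)) \<longlonglongrightarrow> 0"
        by (rule tendsto_sandwich[OF _ _ tendsto_const z]) (use l(1) in \<open>auto intro!: always_eventually less_imp_le simp del: of_nat_Suc\<close>)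
      from LIMSEQ_subseq_LIMSEQ[OF this r] show ?thesis by (simp add: o_def)
    qed
    have "\<forall>\<^sub>F n in sequentially. l2n (\<lambda>t. J t *\<^sub>R (\<phi> (r n) t - w t)) < \<epsilon> / 4 \<and> l2n (\<lambda>t. \<phi> (r n) t - u (r n) t) < \<epsilon> / 4"
      using order_tendstoD(2)[OF lJ, of "\<epsilon> / 4"] order_tendstoD(2)[OF lu, of "\<epsilon> / 4"] \<epsilon> by (simp add: eventually_conj)
    then obtain N where N: "\<And>n. n \<ge> N \<Longrightarrow> l2n (\<lambda>t. J t *\<^sub>R (\<phi> (r n) t - w t)) < \<epsilon> / 4"
      "\<And>n. n \<ge> N \<Longrightarrow> l2n (\<lambda>t. \<phi> (r n) t - u (r n) t) < \<epsilon> / 4" unfolding eventually_sequentially by blast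
    have LJu: "L2 (\<lambda>t. J t *\<^sub>R (u (r n) t - \<phi> (r n) t))" and
      nJu: "l2n (\<lambda>t. J t *\<^sub>R (u (r n) t - \<phi> (r n) t)) \<le> l2n (\<lambda>t. \<phi> (r n) t - u (r n) t)" for n
    proof -
      have m: "u (r n) \<in> borel_measurable lborel" by (rule L2_measurable[OF Lu(1)])
      have "(\<lambda>t. J t *\<^sub>R (u (r n) t - \<phi> (r n) t)) \<in> borel_measurable lborel" using m by measurable
      note * = l2n_mono[OF this L2_diff[OF Lu(1) Lp(1)], of "r n" "r n"]
      show "L2 (\<lambda>t. J t *\<^sub>R (u (r n) t - \<phi> (r n) t))" using * Jb by blast
      show "l2n (\<lambda>t. J t *\<^sub>R (u (r n) t - \<phi> (r n) t)) \<le> l2n (\<lambda>t. \<phi> (r n) t - u (r n) t)"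
        using * Jb by (simp add: l2n_minus[of "\<phi> (r n)"])
    qed
    have "l2n (\<lambda>t. J t *\<^sub>R (u (r i) t - u (r j) t)) < \<epsilon>" if "i \<ge> N" "j \<ge> N" for i j
    proof -
      let ?A = "\<lambda>n t. J t *\<^sub>R (u (r n) t - \<phi> (r n) t) + J t *\<^sub>R (\<phi> (r n) t - w t)"
      have LA: "L2 (?A n)" for n by (intro L2_add LJu LJ)
      have nA: "l2n (?A n) < \<epsilon> / 2" if "n \<ge> N" for n
        using l2n_triangle[OF LJu[of n] LJ[of n]] N(1)[OF that] N(2)[OF that] nJu[of n] by simp
      have "(\<lambda>t. J t *\<^sub>R (u (r i) t - u (r j) t)) = (\<lambda>t. ?A i t + (-1) *\<^sub>R ?A j t)"
        by (simp add: fun_eq_iff algebra_simps)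
      hence "l2n (\<lambda>t. J t *\<^sub>R (u (r i) t - u (r j) t)) \<le> l2n (?A i) + l2n (\<lambda>t. (-1) *\<^sub>R ?A j t)"
        using l2n_triangle[OF LA[of i] L2_scale[OF LA[of j], of "-1"]] by (simp only:)
      also have "l2n (\<lambda>t. (-1) *\<^sub>R ?A j t) = l2n (?A j)" by (subst l2n_scale) simp
      finally show ?thesis using nA[OF that(1)] nA[OF that(2)] by linarith
    qed
    thus ?thesis unfolding J_def by blast
  qed
  show ?thesis using that[OF r] local by blast
qed

end

section \<open>The energy space\<close>

locale frac_hamiltonian = frac_order \<alpha> + superquadratic_potential W \<mu>
  for \<alpha> :: real and W :: "real \<Rightarrow> real^'n \<Rightarrow> real" and \<mu> :: real +
  fixes L :: "real \<Rightarrow> real^'n^'n" and l :: "real \<Rightarrow> real"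
  assumes L_cont: "continuous_on UNIV L"
    and L_sym: "transpose (L t) = L t"
    and l_cont: "continuous_on UNIV l"
    and l_pos: "0 < l t"
    and l_lim: "filterlim l at_top at_infinity"
    and l_le: "l t * (norm x)\<^sup>2 \<le> (L t *v x) \<bullet> x"
begin

section \<open>The quadratic form of the matrix function\<close>

lemma L_inner_sym: "(L t *v x) \<bullet> y = (L t *v y) \<bullet> x"
proof -
  have "(L t *v x) \<bullet> y = (transpose (L t) *v x) \<bullet> y" by (simp add: L_sym)
  also have "\<dots> = x \<bullet> (L t *v y)" by (simp add: dot_lmul_matrix)
  finally show ?thesis by (simp add: inner_commute)
qed

lemma L_nonneg: "0 \<le> (L t *v x) \<bullet> x"
  using order_trans[OF mult_nonneg_nonneg[OF less_imp_le[OF l_pos] zero_le_power2] l_le] .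

text \<open>Polarisation: nonnegativity of the form at \<open>x + y\<close> and \<open>x - y\<close>
  bounds the mixed term from both sides. Integrability of mixed terms is thereby reduced to the
  diagonal.\<close>

lemma L_inner_bound: "\<bar>(L t *v x) \<bullet> y\<bar> \<le> (L t *v x) \<bullet> x + (L t *v y) \<bullet> y"
proof -
  have "0 \<le> (L t *v (x + y)) \<bullet> (x + y)" "0 \<le> (L t *v (x - y)) \<bullet> (x - y)" by (rule L_nonneg)+
  thus ?thesis using L_nonneg[of t x] L_nonneg[of t y]
    by (simp add: matrix_vector_mult_diff_distrib matrix_vector_right_distrib inner_add_left inner_add_right
        inner_diff_left inner_diff_right L_inner_sym[of t y x])
qed

lemma L_continuous_app: "continuous_on UNIV f \<Longrightarrow> continuous_on UNIV (\<lambda>t. L t *v f t)"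
  unfolding matrix_vector_mult_def by (intro continuous_intros L_cont)

lemma L_measurable [measurable]:
  assumes "u \<in> borel_measurable lborel" shows "(\<lambda>t. L t *v u t) \<in> borel_measurable lborel"
proof -
  have "continuous_on UNIV (\<lambda>p :: real \<times> (real^'n). L (fst p) *v snd p)"
    unfolding matrix_vector_mult_def
    by (intro continuous_intros continuous_on_compose2[OF L_cont]) auto
  thus ?thesis using borel_measurable_continuous_Pair[of "\<lambda>t. t" lborel u "\<lambda>t x. L t *v x"] assms by simp
qed

lemma l_measurable [measurable]: "l \<in> borel_measurable borel"
  by (rule borel_measurable_continuous_onI[OF l_cont])

lemma l_min: obtains m where "m > 0" "\<And>t. m \<le> l t"
proof -
  have "\<forall>\<^sub>F t in at_infinity. 1 \<le> l t" using l_lim by (simp add: filterlim_at_top)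
  then obtain T where T: "\<And>t. T \<le> norm t \<Longrightarrow> 1 \<le> l t" unfolding eventually_at_infinity by blast
  have "\<exists>s\<in>{-\<bar>T\<bar>..\<bar>T\<bar>}. \<forall>t\<in>{-\<bar>T\<bar>..\<bar>T\<bar>}. l s \<le> l t"
    by (intro continuous_attains_inf continuous_on_subset[OF l_cont]) auto
  then obtain s where s: "\<And>t. t \<in> {-\<bar>T\<bar>..\<bar>T\<bar>} \<Longrightarrow> l s \<le> l t" by blast
  have "min 1 (l s) \<le> l t" for t
    using s[of t] T[of t] by (cases "\<bar>t\<bar> \<le> \<bar>T\<bar>") (auto simp: min_le_iff_disj abs_le_iff)
  thus ?thesis using that[of "min 1 (l s)"] l_pos[of s] by simp
qed

text \<open>Pairs with the same membership conditions as in \<open>in_X\<close>, but with the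
  derivative fixed. Integrability of its squared norm is already part of
  \<open>frac_H\<close>.\<close>

definition XS :: "((real \<Rightarrow> real^'n) \<times> (real \<Rightarrow> real^'n)) set" where
  "XS = {p. frac_H \<alpha> (fst p) (snd p) \<and> integrable lborel (\<lambda>t. (L t *v fst p t) \<bullet> fst p t)}"

definition XB :: "(real \<Rightarrow> real^'n) \<times> (real \<Rightarrow> real^'n) \<Rightarrow> (real \<Rightarrow> real^'n) \<times> (real \<Rightarrow> real^'n) \<Rightarrow> real" where
  "XB p q = (\<integral>t. snd p t \<bullet> snd q t + (L t *v fst p t) \<bullet> fst q t \<partial>lborel)"

lemma XS_L2: "p \<in> XS \<Longrightarrow> L2 (fst p)" "p \<in> XS \<Longrightarrow> L2 (snd p)"
  using frac_H_L2 by (auto simp: XS_def)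

lemma XS_measurable: "p \<in> XS \<Longrightarrow> fst p \<in> borel_measurable lborel" "p \<in> XS \<Longrightarrow> snd p \<in> borel_measurable lborel"
  using XS_L2 L2_measurable by blast+

lemma X_integrable_L: assumes "p \<in> XS" "q \<in> XS" shows "integrable lborel (\<lambda>t. (L t *v fst p t) \<bullet> fst q t)"
proof (rule Bochner_Integration.integrable_bound)
  show "integrable lborel (\<lambda>t. (L t *v fst p t) \<bullet> fst p t + (L t *v fst q t) \<bullet> fst q t)"
    using assms by (auto simp: XS_def)
  show "(\<lambda>t. (L t *v fst p t) \<bullet> fst q t) \<in> borel_measurable lborel"
    using XS_measurable[OF assms(1)] XS_measurable[OF assms(2)] by measurable
  show "AE t in lborel. norm ((L t *v fst p t) \<bullet> fst q t) \<le> norm ((L t *v fst p t) \<bullet> fst p t + (L t *v fst q t) \<bullet> fst q t)"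
    by (intro always_eventually allI) (simp add: order_trans[OF L_inner_bound abs_ge_self])
qed

lemma X_integrable:
  assumes "p \<in> XS" "q \<in> XS" shows "integrable lborel (\<lambda>t. snd p t \<bullet> snd q t + (L t *v fst p t) \<bullet> fst q t)"
  using X_integrable_L[OF assms] L2_inner_integrable[OF XS_L2(2)[OF assms(1)] XS_L2(2)[OF assms(2)]] by simp

lemma XB_split:
  assumes "p \<in> XS" "q \<in> XS"
  shows "XB p q = (\<integral>t. snd p t \<bullet> snd q t \<partial>lborel) + (\<integral>t. (L t *v fst p t) \<bullet> fst q t \<partial>lborel)"
  unfolding XB_def
  using X_integrable_L[OF assms] L2_inner_integrable[OF XS_L2(2)[OF assms(1)] XS_L2(2)[OF assms(2)]] by simp

lemma XS_combination:
  assumes p: "p \<in> XS" and q: "q \<in> XS" shows "a *\<^sub>R p + b *\<^sub>R q \<in> XS"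
proof -
  have f: "fst (a *\<^sub>R p + b *\<^sub>R q) = (\<lambda>t. a *\<^sub>R fst p t + b *\<^sub>R fst q t)"
    and s: "snd (a *\<^sub>R p + b *\<^sub>R q) = (\<lambda>t. a *\<^sub>R snd p t + b *\<^sub>R snd q t)"
    by (simp_all add: fun_eq_iff)
  have "integrable lborel (\<lambda>t. a * a * ((L t *v fst p t) \<bullet> fst p t) + b * b * ((L t *v fst q t) \<bullet> fst q t)
      + 2 * a * b * ((L t *v fst p t) \<bullet> fst q t))"
    using X_integrable_L[OF p q] X_integrable_L[OF p p] X_integrable_L[OF q q] by simp
  moreover have "(L t *v (a *\<^sub>R fst p t + b *\<^sub>R fst q t)) \<bullet> (a *\<^sub>R fst p t + b *\<^sub>R fst q t)
      = a * a * ((L t *v fst p t) \<bullet> fst p t) + b * b * ((L t *v fst q t) \<bullet> fst q t) + 2 * a * b * ((L t *v fst p t) \<bullet> fst q t)" for t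
    by (simp add: matrix_vector_right_distrib matrix_vector_mult_scaleR inner_add_left inner_add_right
        L_inner_sym[of t "fst q t" "fst p t"] algebra_simps)
  ultimately have "integrable lborel (\<lambda>t. (L t *v (a *\<^sub>R fst p t + b *\<^sub>R fst q t)) \<bullet> (a *\<^sub>R fst p t + b *\<^sub>R fst q t))"
    by (simp only:)
  moreover have "frac_H \<alpha> (\<lambda>t. a *\<^sub>R fst p t + b *\<^sub>R fst q t) (\<lambda>t. a *\<^sub>R snd p t + b *\<^sub>R snd q t)"
    using p q by (intro frac_H_linear) (auto simp: XS_def)
  ultimately show ?thesis unfolding XS_def mem_Collect_eq f s by blast
qed

lemma XS_subspace: "subspace XS"
proof -
  have "(0, 0) \<in> XS"
  proof -
    have "test_pair (\<lambda>t. 0 :: real^'n) (\<lambda>t. 0)"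
      by (auto simp: test_pair_def test_fun_def intro!: exI[of _ "\<lambda>k t. 0"])
    moreover have "frac_conv (\<lambda>t. 0 :: real^'n) = (\<lambda>x. 0)" by (simp add: frac_conv_def fun_eq_iff)
    ultimately have "frac_H \<alpha> (\<lambda>t. 0 :: real^'n) (\<lambda>t. 0)" using frac_H_test by metis
    thus ?thesis by (simp add: XS_def zero_fun_def)
  qed
  moreover have "p + q \<in> XS" if "p \<in> XS" "q \<in> XS" for p q using XS_combination[OF that, of 1 1] by simp
  moreover have "c *\<^sub>R p \<in> XS" if "p \<in> XS" for p c using XS_combination[OF that that, of c 0] by simp
  ultimately show ?thesis by (auto simp: subspace_def zero_prod_def)
qed

lemma XS_diff: "p \<in> XS \<Longrightarrow> q \<in> XS \<Longrightarrow> p - q \<in> XS"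
  by (rule subspace_diff[OF XS_subspace])

lemma XB_self:
  assumes "p \<in> XS" shows "XB p p = (l2n (snd p))\<^sup>2 + (\<integral>t. (L t *v fst p t) \<bullet> fst p t \<partial>lborel)"
  using XB_split[OF assms assms] by (simp add: l2n_sq dot_square_norm)

lemma weighted_L2:
  assumes p: "p \<in> XS"
  shows "L2 (\<lambda>t. sqrt (l t) * norm (fst p t))" and "(l2n (\<lambda>t. sqrt (l t) * norm (fst p t)))\<^sup>2 \<le> (\<integral>t. (L t *v fst p t) \<bullet> fst p t \<partial>lborel)"
proof -
  have i: "integrable lborel (\<lambda>t. (L t *v fst p t) \<bullet> fst p t)" using p by (simp add: XS_def)
  have b: "(norm (sqrt (l t) * norm (fst p t)))\<^sup>2 \<le> (L t *v fst p t) \<bullet> fst p t" for t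
    using l_le[of t "fst p t"] l_pos[of t] by (simp add: power_mult_distrib)
  show w: "L2 (\<lambda>t. sqrt (l t) * norm (fst p t))"
    by (rule L2_bound[OF _ i]) (use b XS_measurable[OF p] in auto)
  show "(l2n (\<lambda>t. sqrt (l t) * norm (fst p t)))\<^sup>2 \<le> (\<integral>t. (L t *v fst p t) \<bullet> fst p t \<partial>lborel)"
    unfolding l2n_sq by (intro integral_mono L2_integrable w i b)
qed

lemma XB_bounds:
  assumes p: "p \<in> XS"
  shows "0 \<le> XB p p" "l2n (snd p) \<le> sqrt (XB p p)" "l2n (\<lambda>t. sqrt (l t) * norm (fst p t)) \<le> sqrt (XB p p)"
proof -
  have n: "0 \<le> (\<integral>t. (L t *v fst p t) \<bullet> fst p t \<partial>lborel)" using L_nonneg by simp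
  show "0 \<le> XB p p" using n XB_self[OF p] by simp
  show "l2n (snd p) \<le> sqrt (XB p p)" using n XB_self[OF p] by (intro real_le_rsqrt) simp
  show "l2n (\<lambda>t. sqrt (l t) * norm (fst p t)) \<le> sqrt (XB p p)"
    using weighted_L2(2)[OF p] XB_self[OF p] zero_le_power2[of "l2n (snd p)"] by (intro real_le_rsqrt) linarith
qed

lemma XB_L2_bound:
  obtains A where "A > 0" "\<And>p. p \<in> XS \<Longrightarrow> l2n (fst p) \<le> A * sqrt (XB p p)"
proof -
  obtain m where m: "m > 0" "\<And>t. m \<le> l t" using l_min by blast
  have "l2n (fst p) \<le> (1 / sqrt m) * sqrt (XB p p)" if p: "p \<in> XS" for p
  proof -
    have "l2n (\<lambda>t. sqrt m *\<^sub>R fst p t) \<le> l2n (\<lambda>t. sqrt (l t) * norm (fst p t))"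
    proof (rule l2n_mono[OF _ weighted_L2(1)[OF p]])
      show "(\<lambda>t. sqrt m *\<^sub>R fst p t) \<in> borel_measurable lborel" using XS_measurable[OF p] by measurable
      have "sqrt m * norm (fst p t) \<le> sqrt (l t) * norm (fst p t)" for t
        using m by (intro mult_right_mono) auto
      thus "AE t in lborel. norm (sqrt m *\<^sub>R fst p t) \<le> norm (sqrt (l t) * norm (fst p t))"
        using m l_pos by (simp add: abs_mult less_imp_le)
    qed
    hence "sqrt m * l2n (fst p) \<le> sqrt (XB p p)" using XB_bounds(3)[OF p] m by (simp add: l2n_scale)
    thus ?thesis using m by (simp add: field_simps)
  qed
  thus ?thesis using that[of "1 / sqrt m"] m by simp
qed

text \<open>Functions and derivatives converge separately in \<open>L2\<close>, and closedness of
  \<open>frac_H\<close> keeps them paired. The form of \<open>L\<close> is not bounded by the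
  \<open>L2\<close> norm, so its convergence is obtained from the Cauchy property by Fatou's lemma
  along an almost everywhere convergent subsequence.\<close>

lemma X_complete:
  assumes f: "\<And>k::nat. f k \<in> XS"
    and cau: "\<And>\<epsilon>. \<epsilon> > 0 \<Longrightarrow> \<exists>N. \<forall>i\<ge>N. \<forall>j\<ge>N. XB (f i - f j) (f i - f j) < \<epsilon>"
  shows "\<exists>x\<in>XS. (\<lambda>k. XB (f k - x) (f k - x)) \<longlonglongrightarrow> 0"
proof -
  obtain A where A: "A > 0" "\<And>p. p \<in> XS \<Longrightarrow> l2n (fst p) \<le> A * sqrt (XB p p)" using XB_L2_bound by blast
  have sq: "x\<^sup>2 < \<epsilon>" if "0 \<le> x" "x \<le> K * sqrt b" "0 \<le> b" "b < \<epsilon> / K\<^sup>2" "K > 0" for x b K \<epsilon> :: real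
  proof -
    have "x\<^sup>2 \<le> (K * sqrt b)\<^sup>2" using that by (intro power_mono) auto
    also have "\<dots> = K\<^sup>2 * b" using that by (simp add: power_mult_distrib)
    also have "\<dots> < \<epsilon>" using that by (simp add: pos_less_divide_eq mult.commute)
    finally show ?thesis .
  qed
  have c1: "\<exists>N. \<forall>i\<ge>N. \<forall>j\<ge>N. (\<integral>t. (norm (fst (f i) t - fst (f j) t))\<^sup>2 \<partial>lborel) < \<epsilon>" if \<epsilon>: "\<epsilon> > 0" for \<epsilon>
  proof -
    have "\<epsilon> / A\<^sup>2 > 0" using \<epsilon> A by simp
    then obtain N where N: "\<And>i j. i \<ge> N \<Longrightarrow> j \<ge> N \<Longrightarrow> XB (f i - f j) (f i - f j) < \<epsilon> / A\<^sup>2" using cau by blast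
    have "(\<integral>t. (norm (fst (f i) t - fst (f j) t))\<^sup>2 \<partial>lborel) < \<epsilon>" if "i \<ge> N" "j \<ge> N" for i j
    proof -
      have d: "f i - f j \<in> XS" by (intro XS_diff f)
      have "(l2n (fst (f i - f j)))\<^sup>2 < \<epsilon>"
        by (rule sq[OF _ A(2)[OF d] XB_bounds(1)[OF d] N[OF that] A(1)]) simp
      thus ?thesis by (simp add: l2n_sq)
    qed
    thus ?thesis by blast
  qed
  have c2: "\<exists>N. \<forall>i\<ge>N. \<forall>j\<ge>N. (\<integral>t. (norm (snd (f i) t - snd (f j) t))\<^sup>2 \<partial>lborel) < \<epsilon>" if \<epsilon>: "\<epsilon> > 0" for \<epsilon>
  proof -
    obtain N where N: "\<And>i j. i \<ge> N \<Longrightarrow> j \<ge> N \<Longrightarrow> XB (f i - f j) (f i - f j) < \<epsilon>" using cau[OF \<epsilon>] by blast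
    have "(\<integral>t. (norm (snd (f i) t - snd (f j) t))\<^sup>2 \<partial>lborel) < \<epsilon>" if "i \<ge> N" "j \<ge> N" for i j
    proof -
      have d: "f i - f j \<in> XS" by (intro XS_diff f)
      have "(l2n (snd (f i - f j)))\<^sup>2 < \<epsilon>"
        by (rule sq[of _ 1, OF _ _ XB_bounds(1)[OF d]]) (use XB_bounds(2)[OF d] N[OF that] in auto)
      thus ?thesis by (simp add: l2n_sq)
    qed
    thus ?thesis by blast
  qed
  obtain u where u: "L2 u" "(\<lambda>k. \<integral>t. (norm (fst (f k) t - u t))\<^sup>2 \<partial>lborel) \<longlonglongrightarrow> 0"
    by (rule L2_complete[OF XS_L2(1)[OF f] c1])
  obtain v where v: "L2 v" "(\<lambda>k. \<integral>t. (norm (snd (f k) t - v t))\<^sup>2 \<partial>lborel) \<longlonglongrightarrow> 0"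
    by (rule L2_complete[OF XS_L2(2)[OF f] c2])
  have lu: "(\<lambda>k. l2n (\<lambda>t. fst (f k) t - u t)) \<longlonglongrightarrow> 0" using u(2) by (simp add: l2n_tendsto_iff)
  have lv: "(\<lambda>k. l2n (\<lambda>t. snd (f k) t - v t)) \<longlonglongrightarrow> 0" using v(2) by (simp add: l2n_tendsto_iff)
  have H: "frac_H \<alpha> u v"
  proof (rule frac_H_closed[OF u(1) v(1)])
    fix \<epsilon> :: real assume \<epsilon>: "\<epsilon> > 0"
    have "\<forall>\<^sub>F k in sequentially. l2n (\<lambda>t. fst (f k) t - u t) < \<epsilon> \<and> l2n (\<lambda>t. snd (f k) t - v t) < \<epsilon>"
      using order_tendstoD(2)[OF lu \<epsilon>] order_tendstoD(2)[OF lv \<epsilon>] by (rule eventually_conj)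
    then obtain k where "l2n (\<lambda>t. fst (f k) t - u t) < \<epsilon> \<and> l2n (\<lambda>t. snd (f k) t - v t) < \<epsilon>"
      unfolding eventually_sequentially by blast
    moreover have "frac_H \<alpha> (fst (f k)) (snd (f k))" using f by (simp add: XS_def)
    ultimately show "\<exists>w Dw. frac_H \<alpha> w Dw \<and> l2n (\<lambda>t. w t - u t) < \<epsilon> \<and> l2n (\<lambda>t. Dw t - v t) < \<epsilon>" by blast
  qed
  obtain r where r: "strict_mono r" and ae: "AE t in lborel. (\<lambda>k. fst (f (r k)) t) \<longlonglongrightarrow> u t"
    by (rule L2_AE_subseq[OF XS_L2(1)[OF f] u])
  have [measurable]: "u \<in> borel_measurable lborel" by (rule L2_measurable[OF u(1)])
  have [measurable]: "fst (f k) \<in> borel_measurable lborel" for k by (rule XS_measurable[OF f])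
  let ?q = "\<lambda>y t. (L t *v y t) \<bullet> y t"
  have fat: "\<exists>N. \<forall>i\<ge>N. integrable lborel (?q (\<lambda>t. fst (f i) t - u t)) \<and> integral\<^sup>L lborel (?q (\<lambda>t. fst (f i) t - u t)) \<le> \<epsilon>"
    if \<epsilon>: "\<epsilon> > 0" for \<epsilon>
  proof -
    obtain N where N: "\<And>i j. i \<ge> N \<Longrightarrow> j \<ge> N \<Longrightarrow> XB (f i - f j) (f i - f j) < \<epsilon>" using cau[OF \<epsilon>] by blast
    have "integrable lborel (?q (\<lambda>t. fst (f i) t - u t)) \<and> integral\<^sup>L lborel (?q (\<lambda>t. fst (f i) t - u t)) \<le> \<epsilon>" if i: "i \<ge> N" for i
    proof -
      have d: "f i - f (r (j + N)) \<in> XS" for j by (intro XS_diff f)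
      have 1: "integrable lborel (?q (\<lambda>t. fst (f i) t - fst (f (r (j + N))) t))" for j
        using d[of j] by (simp add: XS_def)
      have 2: "AE t in lborel. 0 \<le> ?q (\<lambda>t. fst (f i) t - fst (f (r (j + N))) t) t" for j
        using L_nonneg by simp
      have 3: "AE t in lborel. (\<lambda>j. ?q (\<lambda>t. fst (f i) t - fst (f (r (j + N))) t) t) \<longlonglongrightarrow> ?q (\<lambda>t. fst (f i) t - u t) t"
        using ae
      proof eventually_elim
        case (elim t)
        from LIMSEQ_ignore_initial_segment[OF this, of N]
        have l0: "(\<lambda>j. fst (f i) t - fst (f (r (j + N))) t) \<longlonglongrightarrow> fst (f i) t - u t" by (intro tendsto_intros)
        have "(\<lambda>j. L t *v (fst (f i) t - fst (f (r (j + N))) t)) \<longlonglongrightarrow> L t *v (fst (f i) t - u t)"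
          by (rule bounded_linear.tendsto[OF matrix_vector_mul_bounded_linear l0])
        thus ?case by (intro tendsto_inner l0)
      qed
      have 4: "?q (\<lambda>t. fst (f i) t - u t) \<in> borel_measurable lborel" by measurable
      have 5: "integral\<^sup>L lborel (?q (\<lambda>t. fst (f i) t - fst (f (r (j + N))) t)) \<le> \<epsilon>" for j
      proof -
        let ?D = "f i - f (r (j + N))"
        have "(\<integral>t. (L t *v fst ?D t) \<bullet> fst ?D t \<partial>lborel) \<le> XB ?D ?D" unfolding XB_self[OF d] by simp
        also have "XB ?D ?D < \<epsilon>"
          using strict_mono_imp_increasing[OF r, of "j + N"] by (intro N i) simp
        finally show ?thesis by simp
      qed
      show ?thesis using fatou_bound[OF 1 2 3 4 5] by blast
    qed
    thus ?thesis by blast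
  qed
  \<comment> \<open>Only the finiteness of the \<open>L\<close>-form of the difference has to be
    known. The limit itself then lies in the space as \<open>f i\<close> minus this
    difference.\<close>
  have dX: "f k - (u, v) \<in> XS" if "integrable lborel (?q (\<lambda>t. fst (f k) t - u t))" for k
    using that frac_H_linear[OF _ H, of "fst (f k)" "snd (f k)" 1 "-1"] f[of k]
    by (simp add: XS_def fun_diff_def)
  have uX: "(u, v) \<in> XS"
  proof -
    obtain i where "integrable lborel (?q (\<lambda>t. fst (f i) t - u t))" using fat[of 1] by auto
    from XS_diff[OF f[of i] dX[OF this]] show ?thesis by simp
  qed
  moreover have "(\<lambda>k. XB (f k - (u, v)) (f k - (u, v))) \<longlonglongrightarrow> 0"
  proof -
    have "(\<lambda>k. integral\<^sup>L lborel (?q (\<lambda>t. fst (f k) t - u t))) \<longlonglongrightarrow> 0"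
    proof (rule LIMSEQ_I)
      fix e :: real assume e: "e > 0"
      obtain N where N: "\<forall>i\<ge>N. integral\<^sup>L lborel (?q (\<lambda>t. fst (f i) t - u t)) \<le> e / 2" using fat[of "e / 2"] e by auto
      have "0 \<le> integral\<^sup>L lborel (?q (\<lambda>t. fst (f i) t - u t))" for i using L_nonneg by simp
      thus "\<exists>N. \<forall>k\<ge>N. norm (integral\<^sup>L lborel (?q (\<lambda>t. fst (f k) t - u t)) - 0) < e"
        using N e by (intro exI[of _ N]) force
    qed
    from tendsto_add[OF tendsto_power[OF lv, of 2] this]
    have "(\<lambda>k. (l2n (\<lambda>t. snd (f k) t - v t))\<^sup>2 + integral\<^sup>L lborel (?q (\<lambda>t. fst (f k) t - u t))) \<longlonglongrightarrow> 0" by simp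
    moreover have "XB (f k - (u, v)) (f k - (u, v)) = (l2n (\<lambda>t. snd (f k) t - v t))\<^sup>2 + integral\<^sup>L lborel (?q (\<lambda>t. fst (f k) t - u t))" for k
      using XB_self[OF XS_diff[OF f[of k] uX]] by (simp add: fun_diff_def)
    ultimately show ?thesis by simp
  qed
  ultimately show ?thesis by blast
qed

sublocale X: semi_hilbert XS XB
proof
  show "subspace XS" by (rule XS_subspace)
  show "XB x y = XB y x" for x y by (simp add: XB_def inner_commute[of "snd x _"] L_inner_sym[of _ "fst x _"])
  show "0 \<le> XB x x" if "x \<in> XS" for x by (rule XB_bounds(1)[OF that])
  show "XB (x + y) z = XB x z + XB y z" if "x \<in> XS" "y \<in> XS" "z \<in> XS" for x y z
  proof -
    have "XB (x + y) z = (\<integral>t. (snd x t \<bullet> snd z t + (L t *v fst x t) \<bullet> fst z t) + (snd y t \<bullet> snd z t + (L t *v fst y t) \<bullet> fst z t) \<partial>lborel)"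
      unfolding XB_def by (intro Bochner_Integration.integral_cong) (auto simp: inner_add_left matrix_vector_right_distrib)
    thus ?thesis using X_integrable[OF that(1,3)] X_integrable[OF that(2,3)] by (simp add: XB_def)
  qed
  show "XB (c *\<^sub>R x) z = c * XB x z" for x z c
  proof -
    have "XB (c *\<^sub>R x) z = (\<integral>t. c * (snd x t \<bullet> snd z t + (L t *v fst x t) \<bullet> fst z t) \<partial>lborel)"
      unfolding XB_def by (intro Bochner_Integration.integral_cong) (auto simp: matrix_vector_mult_scaleR algebra_simps)
    thus ?thesis by (simp add: XB_def)
  qed
qed (rule X_complete)

end

section \<open>Critical points\<close>

context frac_hamiltonian
begin

lemma X_L2_bound:
  obtains A where "A > 0" "\<And>p. p \<in> XS \<Longrightarrow> l2n (fst p) \<le> A * X.nrm p"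
  using XB_L2_bound by (auto simp: X.nrm_def)

lemma X_sup_bound:
  obtains S where "S > 0" "\<And>p. p \<in> XS \<Longrightarrow> AE t in lborel. norm (fst p t) \<le> S * X.nrm p"
proof -
  obtain A where A: "A > 0" "\<And>p. p \<in> XS \<Longrightarrow> l2n (fst p) \<le> A * X.nrm p" using X_L2_bound by blast
  obtain C where C: "C \<ge> 0" "\<And>(u :: real \<Rightarrow> real^'n) Du. frac_H \<alpha> u Du \<Longrightarrow> AE t in lborel. norm (u t) \<le> l2n u + C * l2n Du"
    using frac_H_sup by blast
  have "AE t in lborel. norm (fst p t) \<le> (A + C) * X.nrm p" if p: "p \<in> XS" for p
  proof -
    have "AE t in lborel. norm (fst p t) \<le> l2n (fst p) + C * l2n (snd p)" using p by (intro C) (simp add: XS_def)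
    moreover have "l2n (fst p) + C * l2n (snd p) \<le> A * X.nrm p + C * X.nrm p"
      using XB_bounds(2)[OF p] C(1) by (intro add_mono A p mult_left_mono) (auto simp: X.nrm_def)
    ultimately show ?thesis by (auto simp: distrib_right elim: eventually_mono)
  qed
  thus ?thesis using that[of "A + C"] A C by simp
qed

lemma X_weighted_bound: "p \<in> XS \<Longrightarrow> l2n (\<lambda>t. sqrt (l t) * norm (fst p t)) \<le> X.nrm p"
  using XB_bounds(3) by (simp add: X.nrm_def)

lemma l_ev: "\<exists>T. \<forall>t. T < \<bar>t\<bar> \<longrightarrow> K \<le> l t"
proof -
  have "\<forall>\<^sub>F t in at_infinity. K \<le> l t" using l_lim by (simp add: filterlim_at_top)
  then obtain T where "\<And>t. T \<le> norm t \<Longrightarrow> K \<le> l t" unfolding eventually_at_infinity by blast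
  thus ?thesis by (intro exI[of _ T]) auto
qed

section \<open>The potential and its derivative on the energy space\<close>

definition F :: "(real \<Rightarrow> real^'n) \<times> (real \<Rightarrow> real^'n) \<Rightarrow> (real \<Rightarrow> real^'n) \<times> (real \<Rightarrow> real^'n) \<Rightarrow> real" where
  "F p q = (\<integral>t. g t (fst p t) \<bullet> fst q t \<partial>lborel)"

definition Pot :: "(real \<Rightarrow> real^'n) \<times> (real \<Rightarrow> real^'n) \<Rightarrow> real" where
  "Pot p = (\<integral>t. W t (fst p t) \<partial>lborel)"

text \<open>The values of an element of the energy space lie in a fixed ball almost everywhere; on
  that ball the gradient is at most linear and the potential at most quadratic, so both are
  controlled by the \<open>L2\<close> norm.\<close>

lemma X_growth:
  assumes p: "p \<in> XS"
  shows "L2 (\<lambda>t. g t (fst p t))" and "integrable lborel (\<lambda>t. W t (fst p t))"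
proof -
  obtain S where S: "S > 0" "\<And>p. p \<in> XS \<Longrightarrow> AE t in lborel. norm (fst p t) \<le> S * X.nrm p" using X_sup_bound by blast
  obtain C where C: "C \<ge> 0" "\<And>t x. norm x \<le> S * X.nrm p \<Longrightarrow> norm (g t x) \<le> C * norm x"
    "\<And>t x. norm x \<le> S * X.nrm p \<Longrightarrow> W t x \<le> C * (norm x)\<^sup>2" using growth[of "S * X.nrm p"] by blast
  have m [measurable]: "fst p \<in> borel_measurable lborel" by (rule XS_measurable[OF p])
  have sup: "AE t in lborel. norm (fst p t) \<le> S * X.nrm p" by (rule S(2)[OF p])
  show "L2 (\<lambda>t. g t (fst p t))"
  proof (rule l2n_mono(1)[OF _ L2_scale[OF XS_L2(1)[OF p], of C]])
    show "AE t in lborel. norm (g t (fst p t)) \<le> norm (C *\<^sub>R fst p t)"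
      using sup by eventually_elim (use C in simp)
  qed measurable
  show "integrable lborel (\<lambda>t. W t (fst p t))"
  proof (rule Bochner_Integration.integrable_bound)
    show "integrable lborel (\<lambda>t. C * (norm (fst p t))\<^sup>2)" by (intro integrable_mult_right L2_integrable XS_L2 p)
    show "AE t in lborel. norm (W t (fst p t)) \<le> norm (C * (norm (fst p t))\<^sup>2)"
      using sup by eventually_elim (use C W_nonneg_AR in simp)
  qed measurable
qed

lemma F_integrable: "p \<in> XS \<Longrightarrow> q \<in> XS \<Longrightarrow> integrable lborel (\<lambda>t. g t (fst p t) \<bullet> fst q t)"
  by (intro L2_inner_integrable X_growth XS_L2)

lemma F_diff_bound:
  assumes "p \<in> XS" "q \<in> XS" "v \<in> XS"
  shows "\<bar>F p v - F q v\<bar> \<le> l2n (\<lambda>t. g t (fst p t) - g t (fst q t)) * l2n (fst v)"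
proof -
  have eq: "F p v - F q v = (\<integral>t. (g t (fst p t) - g t (fst q t)) \<bullet> fst v t \<partial>lborel)"
    using F_integrable[OF assms(1,3)] F_integrable[OF assms(2,3)] by (simp add: F_def inner_diff_left)
  show ?thesis unfolding eq by (intro l2n_inner L2_diff X_growth XS_L2 assms)
qed

lemma unit_bump:
  assumes "T > 0"
  shows "L2 (\<lambda>t. indicator {-T..T} t / sqrt (2 * T) :: real)" "l2n (\<lambda>t. indicator {-T..T} t / sqrt (2 * T) :: real) = 1"
proof -
  show "L2 (\<lambda>t. indicator {-T..T} t / sqrt (2 * T) :: real)"
    using L2_scale[OF L2_indicator_Icc[of "-T" T], of "1 / sqrt (2 * T)"] by simp
  have "(\<integral>t. (norm (indicator {-T..T} t / sqrt (2 * T) :: real))\<^sup>2 \<partial>lborel) = (\<integral>t. (1 / (2 * T)) * indicator {-T..T} t \<partial>lborel)"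
    using assms by (intro Bochner_Integration.integral_cong) (auto simp: indicator_def power_divide)
  also have "\<dots> = 1" using assms by simp
  finally show "l2n (\<lambda>t. indicator {-T..T} t / sqrt (2 * T) :: real) = 1" by (simp add: l2n_def)
qed

text \<open>Integrates the pointwise modulus: the weighted term is controlled by the energy norms,
  the local term by its normalisation, and only the \<open>L2\<close> distance remains. Sequences
  that are bounded in energy and Cauchy in \<open>L2\<close> thus have gradients that are Cauchy in
  \<open>L2\<close>.\<close>

lemma g_modulus_L2:
  assumes \<epsilon>: "\<epsilon> > 0" and R: "R \<ge> 0"
  obtains C where "C \<ge> 0"
    "\<And>p q. \<lbrakk>p \<in> XS; q \<in> XS; X.nrm p \<le> R; X.nrm q \<le> R\<rbrakk> \<Longrightarrow>
      l2n (\<lambda>t. g t (fst p t) - g t (fst q t)) \<le> \<epsilon> + C * l2n (\<lambda>t. fst p t - fst q t)"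
proof -
  obtain S where S: "S > 0" "\<And>p. p \<in> XS \<Longrightarrow> AE t in lborel. norm (fst p t) \<le> S * X.nrm p" using X_sup_bound by blast
  \<comment> \<open>The two weighted norms contribute at most \<open>2 * R\<close> and the
    normalised indicator contributes 1.\<close>
  define \<eta> where "\<eta> = \<epsilon> / (2 * R + 1)"
  have \<eta>: "\<eta> > 0" using \<epsilon> R by (simp add: \<eta>_def)
  have M: "S * R \<ge> 0" using S R by simp
  obtain T C where T: "T > 0" and C: "C \<ge> 0"
    and mod: "\<And>t (x :: real^'n) y. \<lbrakk>norm x \<le> S * R; norm y \<le> S * R\<rbrakk> \<Longrightarrow> norm (g t x - g t y)
       \<le> \<eta> * (sqrt (l t) * (norm x + norm y)) * indicator (- {-T..T}) t + \<eta> / sqrt (2 * T) * indicator {-T..T} t + C * norm (x - y)"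
    using g_modulus[OF l_lim \<eta> M] by blast
  have "l2n (\<lambda>t. g t (fst p t) - g t (fst q t)) \<le> \<epsilon> + C * l2n (\<lambda>t. fst p t - fst q t)"
    if p: "p \<in> XS" "X.nrm p \<le> R" and q: "q \<in> XS" "X.nrm q \<le> R" for p q
  proof -
    let ?a = "\<lambda>t. sqrt (l t) * norm (fst p t)" and ?b = "\<lambda>t. sqrt (l t) * norm (fst q t)"
    let ?J = "\<lambda>t. indicator {-T..T} t / sqrt (2 * T) :: real" and ?d = "\<lambda>t. norm (fst p t - fst q t)"
    note La = weighted_L2(1)[OF p(1)] and Lb = weighted_L2(1)[OF q(1)] and LJ = unit_bump[OF T]
    have Ld: "L2 ?d" by (intro L2_norm L2_diff XS_L2 p q)
    have Lab: "L2 (\<lambda>t. \<eta> *\<^sub>R (?a t + ?b t))" by (intro L2_scale L2_add La Lb)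
    have LJ': "L2 (\<lambda>t. \<eta> *\<^sub>R ?J t)" by (intro L2_scale LJ)
    have Ld': "L2 (\<lambda>t. C *\<^sub>R ?d t)" by (intro L2_scale Ld)
    have sup: "AE t in lborel. norm (fst p t) \<le> S * R \<and> norm (fst q t) \<le> S * R"
    proof -
      have "S * X.nrm p \<le> S * R" "S * X.nrm q \<le> S * R" using p q S by auto
      thus ?thesis using S(2)[OF p(1)] S(2)[OF q(1)] by (auto elim: eventually_elim2)
    qed
    have "l2n (\<lambda>t. g t (fst p t) - g t (fst q t)) \<le> l2n (\<lambda>t. (\<eta> *\<^sub>R (?a t + ?b t) + \<eta> *\<^sub>R ?J t) + C *\<^sub>R ?d t)"
    proof (rule l2n_mono(2))
      show "(\<lambda>t. g t (fst p t) - g t (fst q t)) \<in> borel_measurable lborel"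
        by (intro borel_measurable_diff g_measurable XS_measurable p q)
      show "L2 (\<lambda>t. (\<eta> *\<^sub>R (?a t + ?b t) + \<eta> *\<^sub>R ?J t) + C *\<^sub>R ?d t)" by (intro L2_add[OF L2_add[OF Lab LJ'] Ld'])
      show "AE t in lborel. norm (g t (fst p t) - g t (fst q t)) \<le> norm ((\<eta> *\<^sub>R (?a t + ?b t) + \<eta> *\<^sub>R ?J t) + C *\<^sub>R ?d t)"
        using sup
      proof eventually_elim
        case (elim t)
        have i: "\<eta> * (sqrt (l t) * (norm (fst p t) + norm (fst q t))) * indicator (- {-T..T}) t \<le> \<eta> *\<^sub>R (?a t + ?b t)"
          using \<eta> l_pos[of t] by (auto simp: indicator_def algebra_simps)
        have "norm (g t (fst p t) - g t (fst q t)) \<le> (\<eta> *\<^sub>R (?a t + ?b t) + \<eta> *\<^sub>R ?J t) + C *\<^sub>R ?d t"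
          using mod[of "fst p t" "fst q t" t] elim i by simp
        thus ?case by simp
      qed
    qed
    also have "\<dots> \<le> (l2n (\<lambda>t. \<eta> *\<^sub>R (?a t + ?b t)) + l2n (\<lambda>t. \<eta> *\<^sub>R ?J t)) + l2n (\<lambda>t. C *\<^sub>R ?d t)"
      by (rule order_trans[OF l2n_triangle[OF L2_add[OF Lab LJ'] Ld'] add_right_mono[OF l2n_triangle[OF Lab LJ']]])
    also have "\<dots> = \<eta> * l2n (\<lambda>t. ?a t + ?b t) + \<eta> + C * l2n ?d"
      unfolding l2n_scale LJ(2) using \<eta> C by simp
    also have "l2n (\<lambda>t. ?a t + ?b t) \<le> 2 * R"
      using l2n_triangle[OF La Lb] X_weighted_bound[OF p(1)] X_weighted_bound[OF q(1)] p q by linarith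
    hence "\<eta> * l2n (\<lambda>t. ?a t + ?b t) + \<eta> + C * l2n ?d \<le> \<eta> * (2 * R) + \<eta> + C * l2n ?d"
      using \<eta> by simp
    also have "\<eta> * (2 * R) + \<eta> = \<eta> * (2 * R + 1)" by (simp add: distrib_left)
    also have "\<dots> = \<epsilon>" using R by (simp add: \<eta>_def)
    finally show ?thesis by simp
  qed
  thus ?thesis using that[OF C] by blast
qed

text \<open>By the mean value theorem the remainder is an increment of the gradient paired with
  \<open>fst q\<close>. The \<open>L2\<close> norm of \<open>fst q\<close> supplies the factor
  \<open>X.nrm q\<close>, and the increment is at most \<open>\<epsilon> / A\<close> in
  \<open>L2\<close>.\<close>

lemma Pot_remainder:
  assumes \<epsilon>: "\<epsilon> > 0"
  shows "\<exists>\<delta>>0. \<forall>p\<in>XS. \<forall>q\<in>XS. X.nrm p \<le> R \<and> X.nrm q \<le> \<delta> \<longrightarrow> \<bar>Pot (p + q) - Pot p - F p q\<bar> \<le> \<epsilon> * X.nrm q"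
proof (cases "R \<ge> 0")
  case False
  have "\<not> X.nrm p \<le> R" if "p \<in> XS" for p using X.nrm_nonneg[OF that] False by linarith
  thus ?thesis by (intro exI[of _ 1]) simp
next
  case R: True
  obtain S where S: "S > 0" "\<And>p. p \<in> XS \<Longrightarrow> AE t in lborel. norm (fst p t) \<le> S * X.nrm p" using X_sup_bound by blast
  obtain A where A: "A > 0" "\<And>p. p \<in> XS \<Longrightarrow> l2n (fst p) \<le> A * X.nrm p" using X_L2_bound by blast
  \<comment> \<open>\<open>\<eta> * (2 * R + 2)\<close> is half of \<open>\<epsilon> / A\<close>:
    the weighted functions contribute \<open>2 * R + 1\<close> and the normalised indicator
    1.\<close>
  define \<eta> where "\<eta> = \<epsilon> / (2 * A * (2 * R + 2))"
  have \<eta>: "\<eta> > 0" using \<epsilon> R A by (simp add: \<eta>_def)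
  have M: "S * (R + 1) \<ge> 0" using S R by simp
  obtain T C where T: "T > 0" and C: "C \<ge> 0"
    and mod: "\<And>t (x :: real^'n) y. \<lbrakk>norm x \<le> S * (R + 1); norm y \<le> S * (R + 1)\<rbrakk> \<Longrightarrow> norm (g t x - g t y)
       \<le> \<eta> * (sqrt (l t) * (norm x + norm y)) * indicator (- {-T..T}) t + \<eta> / sqrt (2 * T) * indicator {-T..T} t + C * norm (x - y)"
    using g_modulus[OF l_lim \<eta> M] by blast
  \<comment> \<open>The bound 1 keeps the intermediate values in the ball of radius
    \<open>S * (R + 1)\<close>; the other entry makes \<open>A * (C * (A * \<delta>))\<close> at
    most \<open>\<epsilon> / 2\<close>.\<close>
  define \<delta> where "\<delta> = min 1 (\<epsilon> / (2 * (A * C * A + 1)))"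
  have ACA: "0 \<le> A * C * A" using A C by simp
  have \<delta>: "\<delta> > 0" using \<epsilon> ACA by (simp add: \<delta>_def)
  have "\<bar>Pot (p + q) - Pot p - F p q\<bar> \<le> \<epsilon> * X.nrm q" if p: "p \<in> XS" "X.nrm p \<le> R" and q: "q \<in> XS" "X.nrm q \<le> \<delta>" for p q
  proof -
    let ?a = "\<lambda>t. sqrt (l t) * norm (fst p t)" and ?b = "\<lambda>t. sqrt (l t) * norm (fst q t)"
    let ?J = "\<lambda>t. indicator {-T..T} t / sqrt (2 * T) :: real"
    define H where "H t = ((\<eta> *\<^sub>R (2 *\<^sub>R ?a t + ?b t)) + \<eta> *\<^sub>R ?J t) + C *\<^sub>R norm (fst q t)" for t
    note La = weighted_L2(1)[OF p(1)] and Lb = weighted_L2(1)[OF q(1)] and LJ = unit_bump[OF T]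
    have Lq: "L2 (fst q)" by (rule XS_L2[OF q(1)])
    have Lab: "L2 (\<lambda>t. \<eta> *\<^sub>R (2 *\<^sub>R ?a t + ?b t))" by (intro L2_scale L2_add La Lb)
    have LJ': "L2 (\<lambda>t. \<eta> *\<^sub>R ?J t)" by (intro L2_scale LJ)
    have Lq': "L2 (\<lambda>t. C *\<^sub>R norm (fst q t))" by (intro L2_scale L2_norm Lq)
    have LH: "L2 H" unfolding H_def by (intro L2_add[OF L2_add[OF Lab LJ'] Lq'])
    have pq: "p + q \<in> XS" using p q by simp
    have nq1: "X.nrm q \<le> 1" using q by (simp add: \<delta>_def)
    have sup: "AE t in lborel. norm (fst p t) \<le> S * R \<and> norm (fst q t) \<le> S * 1"
    proof -
      have "S * X.nrm p \<le> S * R" "S * X.nrm q \<le> S * 1" using p nq1 S by auto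
      thus ?thesis using S(2)[OF p(1)] S(2)[OF q(1)] by (auto elim: eventually_elim2)
    qed
    have b: "AE t in lborel. norm (W t (fst (p + q) t) - W t (fst p t) - g t (fst p t) \<bullet> fst q t) \<le> norm (fst q t) * norm (H t)"
      using sup
    proof eventually_elim
      case (elim t)
      let ?x = "fst p t" and ?y = "fst q t"
      \<comment> \<open>The intermediate point depends on \<open>t\<close> with no information on
        measurability, so the majorant \<open>H\<close> is chosen free of it.\<close>
      obtain \<theta> where \<theta>: "0 < \<theta>" "\<theta> < 1" "W t (?x + ?y) - W t ?x = g t (?x + \<theta> *\<^sub>R ?y) \<bullet> ?y" using W_mvt by blast
      have ty: "norm (\<theta> *\<^sub>R ?y) \<le> norm ?y" using \<theta> by (simp add: mult_left_le_one_le)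
      have nx: "norm (?x + \<theta> *\<^sub>R ?y) \<le> norm ?x + norm ?y" using norm_triangle_ineq[of ?x "\<theta> *\<^sub>R ?y"] ty by linarith
      have bx: "norm (?x + \<theta> *\<^sub>R ?y) \<le> S * (R + 1)" "norm ?x \<le> S * (R + 1)"
        using nx elim S(1) unfolding distrib_left by linarith+
      have e1: "\<eta> * (sqrt (l t) * (norm (?x + \<theta> *\<^sub>R ?y) + norm ?x)) * indicator (- {-T..T}) t \<le> \<eta> * (2 * ?a t + ?b t)"
      proof -
        have "sqrt (l t) * (norm (?x + \<theta> *\<^sub>R ?y) + norm ?x) \<le> sqrt (l t) * (2 * norm ?x + norm ?y)"
          using nx l_pos[of t] by (intro mult_left_mono) auto
        also have "\<dots> = 2 * ?a t + ?b t" by (simp add: algebra_simps)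
        finally have "\<eta> * (sqrt (l t) * (norm (?x + \<theta> *\<^sub>R ?y) + norm ?x)) \<le> \<eta> * (2 * ?a t + ?b t)"
          using \<eta> by (intro mult_left_mono) auto
        moreover have "0 \<le> \<eta> * (2 * ?a t + ?b t)" using \<eta> l_pos[of t] by simp
        ultimately show ?thesis by (simp add: indicator_def)
      qed
      have e2: "C * norm ((?x + \<theta> *\<^sub>R ?y) - ?x) \<le> C * norm ?y" using ty C by (simp add: mult_left_mono)
      have "norm (g t (?x + \<theta> *\<^sub>R ?y) - g t ?x) \<le> H t"
        using mod[OF bx, of t] e1 e2 by (simp add: H_def)
      hence gH: "norm (g t (?x + \<theta> *\<^sub>R ?y) - g t ?x) \<le> norm (H t)" by simp
      have "W t (fst (p + q) t) - W t ?x - g t ?x \<bullet> ?y = (g t (?x + \<theta> *\<^sub>R ?y) - g t ?x) \<bullet> ?y"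
        using \<theta> by (simp add: inner_diff_left)
      also have "norm \<dots> \<le> norm (g t (?x + \<theta> *\<^sub>R ?y) - g t ?x) * norm ?y"
        by (simp add: Cauchy_Schwarz_ineq2)
      also have "\<dots> \<le> norm (H t) * norm ?y" using gH by (intro mult_right_mono) auto
      finally show ?case by (simp add: mult.commute)
    qed
    have iW: "integrable lborel (\<lambda>t. W t (fst (p + q) t) - W t (fst p t) - g t (fst p t) \<bullet> fst q t)"
      by (intro Bochner_Integration.integrable_diff X_growth F_integrable p q pq)
    have "Pot (p + q) - Pot p - F p q = (\<integral>t. W t (fst (p + q) t) - W t (fst p t) - g t (fst p t) \<bullet> fst q t \<partial>lborel)"
      unfolding Pot_def F_def
      by (simp only: Bochner_Integration.integral_diff Bochner_Integration.integrable_diff X_growth(2)[OF pq] X_growth(2)[OF p(1)] F_integrable[OF p(1) q(1)])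
    also have "\<bar>\<dots>\<bar> \<le> (\<integral>t. norm (W t (fst (p + q) t) - W t (fst p t) - g t (fst p t) \<bullet> fst q t) \<partial>lborel)"
      using integral_norm_bound[of lborel "\<lambda>t. W t (fst (p + q) t) - W t (fst p t) - g t (fst p t) \<bullet> fst q t"]
      unfolding real_norm_def .
    also have "\<dots> \<le> (\<integral>t. norm (fst q t) * norm (H t) \<partial>lborel)"
      by (intro integral_mono_AE integrable_norm iW L2_norm_mult_integrable Lq LH b)
    also have "\<dots> \<le> l2n (fst q) * l2n H" by (intro l2n_holder Lq LH)
    also have "\<dots> \<le> (A * X.nrm q) * (\<epsilon> / A)"
    proof (rule mult_mono)
      have "l2n H \<le> (l2n (\<lambda>t. \<eta> *\<^sub>R (2 *\<^sub>R ?a t + ?b t)) + l2n (\<lambda>t. \<eta> *\<^sub>R ?J t)) + l2n (\<lambda>t. C *\<^sub>R norm (fst q t))"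
        unfolding H_def by (rule order_trans[OF l2n_triangle[OF L2_add[OF Lab LJ'] Lq'] add_right_mono[OF l2n_triangle[OF Lab LJ']]])
      also have "\<dots> = \<eta> * l2n (\<lambda>t. 2 *\<^sub>R ?a t + ?b t) + \<eta> + C * l2n (fst q)"
        unfolding l2n_scale LJ(2) using \<eta> C by simp
      also have "\<dots> \<le> \<eta> * (2 * R + 1) + \<eta> + C * (A * \<delta>)"
      proof -
        have "l2n (\<lambda>t. 2 *\<^sub>R ?a t + ?b t) \<le> 2 * l2n ?a + l2n ?b"
          using l2n_triangle[OF L2_scale[OF La, of 2] Lb] unfolding l2n_scale by simp
        hence "l2n (\<lambda>t. 2 *\<^sub>R ?a t + ?b t) \<le> 2 * R + 1"
          using X_weighted_bound[OF p(1)] X_weighted_bound[OF q(1)] p nq1 by linarith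
        moreover have "l2n (fst q) \<le> A * \<delta>" using A(2)[OF q(1)] mult_left_mono[OF q(2), of A] A(1) by linarith
        ultimately show ?thesis using \<eta> C by (intro add_mono mult_left_mono) auto
      qed
      also have "\<dots> \<le> \<epsilon> / A"
      proof -
        have "A * (C * (A * \<delta>)) \<le> (A * C * A + 1) * \<delta>" using \<delta> by (simp add: algebra_simps)
        also have "\<dots> \<le> (A * C * A + 1) * (\<epsilon> / (2 * (A * C * A + 1)))" using ACA by (intro mult_left_mono) (auto simp: \<delta>_def)
        also have "\<dots> = \<epsilon> / 2" using ACA by (simp add: field_simps)
        finally have 1: "A * (C * (A * \<delta>)) \<le> \<epsilon> / 2" .
        have "a * (\<epsilon> / (2 * a * k) * k) = \<epsilon> / 2" if "a \<noteq> 0" "k \<noteq> 0" for a k :: real using that by simp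
        hence 2: "A * (\<eta> * (2 * R + 2)) = \<epsilon> / 2" unfolding \<eta>_def using A R by force
        have "A * (\<eta> * (2 * R + 1) + \<eta> + C * (A * \<delta>)) \<le> \<epsilon>" using 1 2 by (simp add: algebra_simps)
        thus ?thesis using A(1) by (simp add: pos_le_divide_eq mult.commute)
      qed
      finally show "l2n H \<le> \<epsilon> / A" .
    qed (use A q in auto)
    also have "\<dots> = \<epsilon> * X.nrm q" using A by simp
    finally show ?thesis .
  qed
  thus ?thesis using \<delta> by blast
qed

text \<open>Local compactness handles \<open>{-T..T}\<close>. Outside,
  \<open>1 \<le> \<eta> * sqrt (l t)\<close> converts the norm of a difference into \<eta> times
  weighted norms, which the energy bounds uniformly along the sequence.\<close>

lemma X_compact:
  assumes f: "\<And>k::nat. f k \<in> XS" and R: "\<And>k. X.nrm (f k) \<le> R"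
  obtains r where "strict_mono (r :: nat \<Rightarrow> nat)"
    "\<And>\<epsilon>. \<epsilon> > 0 \<Longrightarrow> \<exists>N. \<forall>i\<ge>N. \<forall>j\<ge>N. l2n (\<lambda>t. fst (f (r i)) t - fst (f (r j)) t) < \<epsilon>"
proof -
  obtain A where A: "A > 0" "\<And>p. p \<in> XS \<Longrightarrow> l2n (fst p) \<le> A * X.nrm p" using X_L2_bound by blast
  have R0: "R \<ge> 0" using R[of 0] X.nrm_nonneg[OF f[of 0]] by linarith
  have b: "l2n (fst (f k)) \<le> max (A * R) R" "l2n (snd (f k)) \<le> max (A * R) R" for k
  proof -
    have "A * X.nrm (f k) \<le> A * R" using R[of k] A(1) by simp
    thus "l2n (fst (f k)) \<le> max (A * R) R" using A(2)[OF f[of k]] by linarith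
    show "l2n (snd (f k)) \<le> max (A * R) R" using XB_bounds(2)[OF f[of k]] R[of k] unfolding X.nrm_def by linarith
  qed
  have H: "frac_H \<alpha> (fst (f k)) (snd (f k))" for k using f by (simp add: XS_def)
  obtain r where r: "strict_mono (r :: nat \<Rightarrow> nat)"
    and loc: "\<And>T \<epsilon>. \<epsilon> > 0 \<Longrightarrow> \<exists>N. \<forall>i\<ge>N. \<forall>j\<ge>N. l2n (\<lambda>t. indicator {-T..T} t *\<^sub>R (fst (f (r i)) t - fst (f (r j)) t)) < \<epsilon>"
    by (rule frac_H_locally_compact[OF H b]) (rule that)
  have "\<exists>N. \<forall>i\<ge>N. \<forall>j\<ge>N. l2n (\<lambda>t. fst (f (r i)) t - fst (f (r j)) t) < \<epsilon>" if \<epsilon>: "\<epsilon> > 0" for \<epsilon>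
  proof -
    \<comment> \<open>The tail is at most \<open>\<eta> * (2 * R)\<close>, so half of \<epsilon>
      suffices for it; the added 1 covers \<open>R = 0\<close>.\<close>
    define \<eta> where "\<eta> = \<epsilon> / (2 * (2 * R + 1))"
    have \<eta>: "\<eta> > 0" using \<epsilon> R0 by (simp add: \<eta>_def)
    obtain T where T: "\<And>t. T < \<bar>t\<bar> \<Longrightarrow> (1 / \<eta>)\<^sup>2 \<le> l t" using l_ev by blast
    have far: "1 \<le> \<eta> * sqrt (l t)" if "T < \<bar>t\<bar>" for t
    proof -
      have "1 / \<eta> \<le> sqrt (l t)" by (rule real_le_rsqrt[OF T[OF that]])
      thus ?thesis using \<eta> by (simp add: field_simps)
    qed
    obtain N where N: "\<And>i j. i \<ge> N \<Longrightarrow> j \<ge> N \<Longrightarrow> l2n (\<lambda>t. indicator {-T..T} t *\<^sub>R (fst (f (r i)) t - fst (f (r j)) t)) < \<epsilon> / 2"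
      using loc[of "\<epsilon> / 2" T] \<epsilon> by auto
    have "l2n (\<lambda>t. fst (f (r i)) t - fst (f (r j)) t) < \<epsilon>" if ij: "i \<ge> N" "j \<ge> N" for i j
    proof -
      let ?p = "f (r i)" and ?q = "f (r j)"
      let ?I = "\<lambda>t. indicator {-T..T} t *\<^sub>R (fst ?p t - fst ?q t)"
      let ?a = "\<lambda>t. sqrt (l t) * norm (fst ?p t)" and ?b = "\<lambda>t. sqrt (l t) * norm (fst ?q t)"
      note La = weighted_L2(1)[OF f[of "r i"]] and Lb = weighted_L2(1)[OF f[of "r j"]]
      have Lab: "L2 (\<lambda>t. \<eta> *\<^sub>R (?a t + ?b t))" by (intro L2_scale L2_add La Lb)
      have Ld: "L2 (\<lambda>t. fst ?p t - fst ?q t)" by (intro L2_diff XS_L2 f)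
      have LI: "L2 ?I"
      proof (rule l2n_mono(1)[OF _ Ld])
        show "?I \<in> borel_measurable lborel" using L2_measurable[OF Ld] by measurable
      qed (auto simp: indicator_def)
      have "l2n (\<lambda>t. fst ?p t - fst ?q t) \<le> l2n (\<lambda>t. norm (?I t) + \<eta> *\<^sub>R (?a t + ?b t))"
      proof (rule l2n_mono(2)[OF L2_measurable[OF Ld] L2_add[OF L2_norm[OF LI] Lab]])
        have "norm (fst ?p t - fst ?q t) \<le> norm (?I t) + \<eta> *\<^sub>R (?a t + ?b t)" for t
        proof (cases "t \<in> {-T..T}")
          case True
          have "0 \<le> \<eta> *\<^sub>R (?a t + ?b t)" using \<eta> l_pos[of t] by simp
          thus ?thesis using True by simp
        next
          case False
          hence "1 \<le> \<eta> * sqrt (l t)" by (intro far) auto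
          hence le: "1 * (norm (fst ?p t) + norm (fst ?q t)) \<le> \<eta> * sqrt (l t) * (norm (fst ?p t) + norm (fst ?q t))"
            by (intro mult_right_mono) auto
          have "norm (fst ?p t - fst ?q t) \<le> 1 * (norm (fst ?p t) + norm (fst ?q t))"
            using norm_triangle_ineq4[of "fst ?p t" "fst ?q t"] by simp
          also note le
          also have "\<eta> * sqrt (l t) * (norm (fst ?p t) + norm (fst ?q t)) = \<eta> *\<^sub>R (?a t + ?b t)" by (simp add: algebra_simps)
          also have "\<dots> \<le> norm (?I t) + \<eta> *\<^sub>R (?a t + ?b t)" by simp
          finally show ?thesis .
        qed
        thus "AE t in lborel. norm (fst ?p t - fst ?q t) \<le> norm (norm (?I t) + \<eta> *\<^sub>R (?a t + ?b t))"
          by (intro always_eventually allI) (simp add: order_trans[OF _ abs_ge_self])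
      qed
      also have "\<dots> \<le> l2n ?I + l2n (\<lambda>t. \<eta> *\<^sub>R (?a t + ?b t))"
        using l2n_triangle[OF L2_norm[OF LI] Lab] by (simp only: l2n_norm)
      also have "l2n (\<lambda>t. \<eta> *\<^sub>R (?a t + ?b t)) = \<eta> * l2n (\<lambda>t. ?a t + ?b t)" unfolding l2n_scale using \<eta> by simp
      also have "l2n (\<lambda>t. ?a t + ?b t) \<le> 2 * R"
        using l2n_triangle[OF La Lb] X_weighted_bound[OF f[of "r i"]] X_weighted_bound[OF f[of "r j"]] R[of "r i"] R[of "r j"] by linarith
      hence "\<eta> * l2n (\<lambda>t. ?a t + ?b t) \<le> \<eta> * (2 * R + 1)" using \<eta> by (intro mult_left_mono) auto
      also have "\<eta> * (2 * R + 1) = \<epsilon> / 2" using R0 by (simp add: \<eta>_def field_simps)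
      finally show ?thesis using N[OF ij] by simp
    qed
    thus ?thesis by blast
  qed
  thus ?thesis using that[OF r] by blast
qed

text \<open>A small energy norm makes the function uniformly small, so (W2) applies at almost every
  time and the potential is dominated by half of the quadratic part.\<close>

lemma Pot_small:
  obtains r where "r > 0" "\<And>p. \<lbrakk>p \<in> XS; X.nrm p \<le> r\<rbrakk> \<Longrightarrow> XB p p / 4 \<le> XB p p / 2 - Pot p"
proof -
  obtain S where S: "S > 0" "\<And>p. p \<in> XS \<Longrightarrow> AE t in lborel. norm (fst p t) \<le> S * X.nrm p" using X_sup_bound by blast
  obtain A where A: "A > 0" "\<And>p. p \<in> XS \<Longrightarrow> l2n (fst p) \<le> A * X.nrm p" using X_L2_bound by blast
  \<comment> \<open>Chosen so that \<open>\<epsilon> * (A * X.nrm p)^2\<close> is exactly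
    \<open>XB p p / 4\<close>.\<close>
  define \<epsilon> where "\<epsilon> = 1 / (4 * A\<^sup>2)"
  have \<epsilon>: "\<epsilon> > 0" using A by (simp add: \<epsilon>_def)
  obtain \<delta> where \<delta>: "\<delta> > 0" "\<And>t x. norm x < \<delta> \<Longrightarrow> W t x \<le> \<epsilon> * (norm x)\<^sup>2" using W_small[OF \<epsilon>] by blast
  have "XB p p / 4 \<le> XB p p / 2 - Pot p" if p: "p \<in> XS" "X.nrm p \<le> \<delta> / (2 * S)" for p
  proof -
    have "S * X.nrm p < \<delta>" using p S \<delta> by (simp add: field_simps)
    hence "AE t in lborel. W t (fst p t) \<le> \<epsilon> * (norm (fst p t))\<^sup>2"
      using S(2)[OF p(1)] by (auto elim!: eventually_mono intro: \<delta>(2))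
    hence "Pot p \<le> (\<integral>t. \<epsilon> * (norm (fst p t))\<^sup>2 \<partial>lborel)"
      unfolding Pot_def by (intro integral_mono_AE X_growth(2) p integrable_mult_right L2_integrable XS_L2)
    also have "\<dots> = \<epsilon> * (l2n (fst p))\<^sup>2" by (simp add: l2n_sq)
    also have "\<dots> \<le> \<epsilon> * (A * X.nrm p)\<^sup>2" using A(2)[OF p(1)] \<epsilon> by (intro mult_left_mono power_mono) auto
    also have "\<dots> = XB p p / 4" using A p by (simp add: power_mult_distrib X.nrm_sq \<epsilon>_def)
    finally show ?thesis by simp
  qed
  thus ?thesis using that[of "\<delta> / (2 * S)"] \<delta> S by simp
qed

text \<open>Along the ray through a test function the quadratic part grows like \<open>s^2\<close>,
  while the potential grows at least like \<open>s powr \<mu>\<close> with \<mu> > 2.\<close>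

lemma Pot_large: "\<exists>e\<in>XS. XB e e / 2 - Pot e < 0"
proof -
  obtain \<phi> :: "real \<Rightarrow> real^'n" where \<phi>: "test_fun \<phi>" "\<phi> (1/2) \<noteq> 0" using test_fun_exists by blast
  obtain \<phi>' where p: "test_pair \<phi> \<phi>'" using test_fun_pair[OF \<phi>(1)] .
  obtain R where c: "continuous_on UNIV \<phi>" and z: "\<And>t. R < \<bar>t\<bar> \<Longrightarrow> \<phi> t = 0" using test_pair_data[OF p] by metis
  define e where "e = (\<phi>, frac_conv \<phi>')"
  have qc: "continuous_on UNIV (\<lambda>t. (L t *v \<phi> t) \<bullet> \<phi> t)" by (intro continuous_intros L_continuous_app c)
  obtain M where M: "\<And>t. norm ((L t *v \<phi> t) \<bullet> \<phi> t) \<le> M"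
    using bounded_continuous_support[OF qc, of R] z by auto
  have "integrable lborel (\<lambda>t. (L t *v \<phi> t) \<bullet> \<phi> t)"
  proof (rule Bochner_Integration.integrable_bound[OF integrable_mult_right[OF integrable_indicator_Icc[of "-R" R], of M]])
    show "(\<lambda>t. (L t *v \<phi> t) \<bullet> \<phi> t) \<in> borel_measurable lborel" using qc by (simp add: borel_measurable_continuous_onI)
    have "norm ((L t *v \<phi> t) \<bullet> \<phi> t) \<le> norm (M * indicator {-R..R} t)" for t
      using M[of t] z[of t] by (cases "t \<in> {-R..R}") auto
    thus "AE t in lborel. norm ((L t *v \<phi> t) \<bullet> \<phi> t) \<le> norm (M * indicator {-R..R} t)" by simp
  qed
  hence eX: "e \<in> XS" using frac_H_test[OF p] by (simp add: XS_def e_def)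
  have Wi: "integrable lborel (\<lambda>t. W t (\<phi> t))" using X_growth(2)[OF eX] by (simp add: e_def)
  have Pe: "Pot e > 0"
  proof (rule ccontr)
    assume "\<not> Pot e > 0"
    hence "(\<integral>t. W t (\<phi> t) \<partial>lborel) = 0" using W_nonneg_AR by (simp add: Pot_def e_def order_antisym)
    hence "AE t in lborel. W t (\<phi> t) = 0" using integral_nonneg_eq_0_iff_AE[OF Wi] W_nonneg_AR by simp
    hence "AE t in lborel. \<phi> t = 0" by eventually_elim (metis W_pos less_irrefl)
    \<comment> \<open>A nonempty open set is not null, so a nonzero continuous function cannot have
      zero potential.\<close>
    have op: "open {t. \<phi> t \<noteq> 0}" using c by (intro open_Collect_neq) auto
    have "{t. \<phi> t \<noteq> 0} \<in> null_sets lborel"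
      using \<open>AE t in lborel. \<phi> t = 0\<close> op by (subst AE_iff_null_sets) auto
    hence "negligible {t. \<phi> t \<noteq> 0}" by (simp add: negligible_iff_null_sets null_sets_completionI)
    with op show False using open_not_negligible[of "{t. \<phi> t \<noteq> 0}"] \<phi>(2) by blast
  qed
  \<comment> \<open>Solves \<open>s powr (\<mu> - 2) * Pot e = XB e e / 2 + 1\<close>, raised to at
    least 1 because the scaling inequality holds only there.\<close>
  define s where "s = max 1 (((XB e e / 2 + 1) / Pot e) powr (1 / (\<mu> - 2)))"
  have n: "XB e e \<ge> 0" by (rule XB_bounds(1)[OF eX])
  have s: "s \<ge> 1" "((XB e e / 2 + 1) / Pot e) powr (1 / (\<mu> - 2)) \<le> s" by (auto simp: s_def)
  have "(XB e e / 2 + 1) / Pot e = (((XB e e / 2 + 1) / Pot e) powr (1 / (\<mu> - 2))) powr (\<mu> - 2)"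
    using \<mu> n Pe by (simp add: powr_powr)
  also have "\<dots> \<le> s powr (\<mu> - 2)" using s \<mu> by (intro powr_mono2) auto
  finally have big: "XB e e / 2 + 1 \<le> s powr (\<mu> - 2) * Pot e" using Pe by (simp add: pos_divide_le_eq)
  have seX: "s *\<^sub>R e \<in> XS" using eX by simp
  have "s powr \<mu> * Pot e \<le> Pot (s *\<^sub>R e)"
  proof -
    have "s powr \<mu> * Pot e = (\<integral>t. s powr \<mu> * W t (\<phi> t) \<partial>lborel)" by (simp add: Pot_def e_def)
    also have "\<dots> \<le> (\<integral>t. W t (s *\<^sub>R \<phi> t) \<partial>lborel)"
      using X_growth(2)[OF seX] by (intro integral_mono W_scale s integrable_mult_right Wi) (simp add: e_def)
    finally show ?thesis by (simp add: Pot_def e_def)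
  qed
  moreover have "s powr \<mu> = s\<^sup>2 * s powr (\<mu> - 2)"
  proof -
    have "s\<^sup>2 = s powr 2" using s by (simp add: powr_numeral)
    thus ?thesis by (simp flip: powr_add)
  qed
  moreover have "XB (s *\<^sub>R e) (s *\<^sub>R e) = s\<^sup>2 * XB e e" using eX by (simp add: X.bil power2_eq_square)
  ultimately have "XB (s *\<^sub>R e) (s *\<^sub>R e) / 2 - Pot (s *\<^sub>R e) \<le> s\<^sup>2 * (XB e e / 2 - s powr (\<mu> - 2) * Pot e)"
    by (simp add: algebra_simps)
  also have "\<dots> < 0" using big s by (intro mult_pos_neg) auto
  finally show ?thesis using seX by blast
qed

text \<open>On the sphere of radius \<open>r\<close> the energy is at least \<open>r^2 / 4\<close>.
  Compactness of the derivative of the potential combines an \<open>L2\<close>-Cauchy subsequence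
  with the modulus of the gradient.\<close>

lemma critical_point: "\<exists>p\<in>XS. 0 < XB p p / 2 - Pot p \<and> (\<forall>q\<in>XS. XB p q = F p q)"
proof -
  obtain A where A: "A > 0" "\<And>p. p \<in> XS \<Longrightarrow> l2n (fst p) \<le> A * X.nrm p" using X_L2_bound by blast
  have Fest: "\<bar>F p v - F q v\<bar> \<le> \<epsilon> * X.nrm v"
    if "p \<in> XS" "q \<in> XS" "v \<in> XS" "l2n (\<lambda>t. g t (fst p t) - g t (fst q t)) \<le> \<epsilon> / A" for p q v \<epsilon>
  proof -
    have "\<bar>F p v - F q v\<bar> \<le> l2n (\<lambda>t. g t (fst p t) - g t (fst q t)) * l2n (fst v)" by (rule F_diff_bound[OF that(1-3)])
    also have "\<dots> \<le> (\<epsilon> / A) * (A * X.nrm v)"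
      using that A order_trans[OF l2n_nonneg that(4)] by (intro mult_mono) auto
    finally show ?thesis using A by simp
  qed
  obtain r where r: "r > 0" and sm: "\<And>p. \<lbrakk>p \<in> XS; X.nrm p \<le> r\<rbrakk> \<Longrightarrow> XB p p / 4 \<le> XB p p / 2 - Pot p"
    using Pot_small by blast
  obtain e where e: "e \<in> XS" "XB e e / 2 - Pot e < 0" using Pot_large by blast
  \<comment> \<open>The functional is nonnegative on the ball of radius \<open>r\<close>, so a point
    of negative energy lies beyond it.\<close>
  have er: "X.nrm e > r"
  proof (rule ccontr)
    assume "\<not> X.nrm e > r"
    hence "XB e e / 4 \<le> XB e e / 2 - Pot e" using e by (intro sm) auto
    thus False using e XB_bounds(1)[OF e(1)] by linarith
  qed
  show ?thesis
  proof (rule X.mountain_pass_compact[where \<mu> = \<mu> and r = r and \<rho> = "r\<^sup>2 / 4" and e = e])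
    show "F u (v + w) = F u v + F u w" if "u \<in> XS" "v \<in> XS" "w \<in> XS" for u v w
      using F_integrable[OF that(1,2)] F_integrable[OF that(1,3)] by (simp add: F_def inner_add_right)
    show "F u (c *\<^sub>R v) = c * F u v" for u v c by (simp add: F_def)
    show "\<exists>C. \<forall>v\<in>XS. \<bar>F u v\<bar> \<le> C * X.nrm v" if u: "u \<in> XS" for u
    proof (intro exI ballI)
      fix v assume v: "v \<in> XS"
      have "\<bar>F u v\<bar> \<le> l2n (\<lambda>t. g t (fst u t)) * l2n (fst v)"
        unfolding F_def by (intro l2n_inner X_growth XS_L2 u v)
      also have "\<dots> \<le> l2n (\<lambda>t. g t (fst u t)) * (A * X.nrm v)" by (intro mult_left_mono A v) simp
      finally show "\<bar>F u v\<bar> \<le> l2n (\<lambda>t. g t (fst u t)) * A * X.nrm v" by simp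
    qed
  next
    fix R \<epsilon> :: real assume \<epsilon>: "\<epsilon> > 0"
    show "\<exists>\<delta>>0. \<forall>u\<in>XS. \<forall>u'\<in>XS. X.nrm u \<le> R \<and> X.nrm u' \<le> R \<and> X.nrm (u - u') \<le> \<delta> \<longrightarrow> (\<forall>v\<in>XS. \<bar>F u v - F u' v\<bar> \<le> \<epsilon> * X.nrm v)"
    proof -
      have e2: "\<epsilon> / A / 2 > 0" using \<epsilon> A by simp
      \<comment> \<open>The absolute value enters because the radius is arbitrary here, while the
        modulus is stated for nonnegative radii.\<close>
      obtain C where C: "C \<ge> 0" "\<And>p q. \<lbrakk>p \<in> XS; q \<in> XS; X.nrm p \<le> \<bar>R\<bar>; X.nrm q \<le> \<bar>R\<bar>\<rbrakk> \<Longrightarrow>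
        l2n (\<lambda>t. g t (fst p t) - g t (fst q t)) \<le> \<epsilon> / A / 2 + C * l2n (\<lambda>t. fst p t - fst q t)"
        using g_modulus_L2[OF e2 abs_ge_zero[of R]] by blast
      define \<delta> where "\<delta> = \<epsilon> / A / 2 / (C * A + 1)"
      have CA: "C * A \<ge> 0" using C A by simp
      have \<delta>: "\<delta> > 0" using \<epsilon> A CA by (simp add: \<delta>_def)
      have "\<bar>F u v - F u' v\<bar> \<le> \<epsilon> * X.nrm v"
        if u: "u \<in> XS" "u' \<in> XS" "X.nrm u \<le> R" "X.nrm u' \<le> R" "X.nrm (u - u') \<le> \<delta>" "v \<in> XS" for u u' v
      proof (rule Fest[OF u(1,2,6)])
        have d: "u - u' \<in> XS" using u by simp
        have "l2n (\<lambda>t. fst u t - fst u' t) \<le> A * X.nrm (u - u')" using A(2)[OF d] by (simp add: fun_diff_def)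
        also have "\<dots> \<le> A * \<delta>" using u A by simp
        finally have "C * l2n (\<lambda>t. fst u t - fst u' t) \<le> C * (A * \<delta>)" using C by (intro mult_left_mono)
        also have "\<dots> \<le> (C * A + 1) * \<delta>" using \<delta> by (simp add: algebra_simps)
        also have "\<dots> = \<epsilon> / A / 2" using CA by (simp add: \<delta>_def)
        finally show "l2n (\<lambda>t. g t (fst u t) - g t (fst u' t)) \<le> \<epsilon> / A"
          using C(2)[OF u(1,2)] u(3,4) by linarith
      qed
      thus ?thesis using \<delta> by blast
    qed
    show "\<exists>\<delta>>0. \<forall>u\<in>XS. \<forall>v\<in>XS. X.nrm u \<le> R \<and> X.nrm v \<le> \<delta> \<longrightarrow> \<bar>Pot (u + v) - Pot u - F u v\<bar> \<le> \<epsilon> * X.nrm v"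
      by (rule Pot_remainder[OF \<epsilon>])
  next
    fix R and f :: "nat \<Rightarrow> (real \<Rightarrow> real^'n) \<times> (real \<Rightarrow> real^'n)"
    assume f: "\<And>k. f k \<in> XS" "\<And>k. X.nrm (f k) \<le> R"
    have R0: "R \<ge> 0" using f(2)[of 0] X.nrm_nonneg[OF f(1)[of 0]] by linarith
    obtain s where s: "strict_mono (s :: nat \<Rightarrow> nat)"
      and sc: "\<And>\<epsilon>. \<epsilon> > 0 \<Longrightarrow> \<exists>N. \<forall>i\<ge>N. \<forall>j\<ge>N. l2n (\<lambda>t. fst (f (s i)) t - fst (f (s j)) t) < \<epsilon>"
      by (rule X_compact[OF f]) (rule that)
    have "\<exists>N. \<forall>i\<ge>N. \<forall>j\<ge>N. \<forall>v\<in>XS. \<bar>F (f (s i)) v - F (f (s j)) v\<bar> \<le> \<epsilon> * X.nrm v" if \<epsilon>: "\<epsilon> > 0" for \<epsilon>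
    proof -
      have e2: "\<epsilon> / A / 2 > 0" using \<epsilon> A by simp
      obtain C where C: "C \<ge> 0" "\<And>p q. \<lbrakk>p \<in> XS; q \<in> XS; X.nrm p \<le> R; X.nrm q \<le> R\<rbrakk> \<Longrightarrow>
        l2n (\<lambda>t. g t (fst p t) - g t (fst q t)) \<le> \<epsilon> / A / 2 + C * l2n (\<lambda>t. fst p t - fst q t)"
        using g_modulus_L2[OF e2 R0] by blast
      have pos: "\<epsilon> / A / 2 / (C + 1) > 0" by (rule divide_pos_pos[OF e2]) (use C in simp)
      from sc[OF this] obtain N where N: "\<And>i j. i \<ge> N \<Longrightarrow> j \<ge> N \<Longrightarrow> l2n (\<lambda>t. fst (f (s i)) t - fst (f (s j)) t) < \<epsilon> / A / 2 / (C + 1)"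
        by blast
      have "\<bar>F (f (s i)) v - F (f (s j)) v\<bar> \<le> \<epsilon> * X.nrm v" if ij: "i \<ge> N" "j \<ge> N" and v: "v \<in> XS" for i j v
      proof (rule Fest[OF f(1) f(1) v])
        have "C * l2n (\<lambda>t. fst (f (s i)) t - fst (f (s j)) t) \<le> C * (\<epsilon> / A / 2 / (C + 1))"
          using N[OF ij] C by (intro mult_left_mono) auto
        also have "\<dots> \<le> (C + 1) * (\<epsilon> / A / 2 / (C + 1))" by (rule mult_right_mono) (use pos in linarith)+
        also have "\<dots> = \<epsilon> / A / 2" using C by simp
        finally show "l2n (\<lambda>t. g t (fst (f (s i)) t) - g t (fst (f (s j)) t)) \<le> \<epsilon> / A"
          using C(2)[OF f(1) f(1) f(2) f(2), of "s i" "s j"] by linarith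
      qed
      thus ?thesis by blast
    qed
    thus "\<exists>s :: nat \<Rightarrow> nat. strict_mono s \<and> (\<forall>\<epsilon>>0. \<exists>N. \<forall>i\<ge>N. \<forall>j\<ge>N. \<forall>v\<in>XS. \<bar>F (f (s i)) v - F (f (s j)) v\<bar> \<le> \<epsilon> * X.nrm v)"
      using s by blast
  next
    show "\<mu> * Pot u \<le> F u u" if u: "u \<in> XS" for u
    proof -
      have "\<mu> * Pot u = (\<integral>t. \<mu> * W t (fst u t) \<partial>lborel)" by (simp add: Pot_def)
      also have "\<dots> \<le> F u u" unfolding F_def
        using W_nonneg_AR by (intro integral_mono integrable_mult_right X_growth(2) F_integrable u) (simp add: inner_commute)
      finally show ?thesis .
    qed
    show "r\<^sup>2 / 4 \<le> XB u u / 2 - Pot u" if "u \<in> XS" "X.nrm u = r" for u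
      using sm[OF that(1)] that X.nrm_sq[OF that(1)] by simp
    show "Pot 0 = 0" by (simp add: Pot_def)
  qed (use \<mu> r e er in auto)
qed

lemma weak_solution:
  "\<exists>u Du. frac_H \<alpha> u Du \<and> in_X \<alpha> L u \<and> \<not> (AE t in lborel. u t = 0) \<and>
     (\<forall>v Dv. frac_H \<alpha> v Dv \<and> in_X \<alpha> L v \<longrightarrow>
        integrable lborel (\<lambda>t. Du t \<bullet> Dv t + (L t *v u t) \<bullet> v t) \<and>
        integrable lborel (\<lambda>t. g t (u t) \<bullet> v t) \<and>
        integral\<^sup>L lborel (\<lambda>t. Du t \<bullet> Dv t + (L t *v u t) \<bullet> v t) = integral\<^sup>L lborel (\<lambda>t. g t (u t) \<bullet> v t))"
proof -
  obtain p where p: "p \<in> XS" "0 < XB p p / 2 - Pot p" "\<And>q. q \<in> XS \<Longrightarrow> XB p q = F p q"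
    using critical_point by blast
  \<comment> \<open>If the function vanishes almost everywhere, testing the equation with
    \<open>p\<close> itself gives \<open>XB p p = 0\<close>, and the nonnegative potential leaves no
    room for positive energy. The derivative component is never compared with zero directly.\<close>
  have nz: "\<not> (AE t in lborel. fst p t = 0)"
  proof
    assume "AE t in lborel. fst p t = 0"
    hence "AE t in lborel. g t (fst p t) \<bullet> fst p t = 0" by eventually_elim simp
    hence "F p p = 0" unfolding F_def by (rule integral_eq_zero_AE)
    hence "XB p p = 0" using p by simp
    moreover have "Pot p \<ge> 0" unfolding Pot_def using W_nonneg_AR by (intro integral_nonneg_AE) auto
    ultimately show False using p(2) by simp
  qed
  have test: "integrable lborel (\<lambda>t. snd p t \<bullet> Dv t + (L t *v fst p t) \<bullet> v t) \<and>
        integrable lborel (\<lambda>t. g t (fst p t) \<bullet> v t) \<and>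
        integral\<^sup>L lborel (\<lambda>t. snd p t \<bullet> Dv t + (L t *v fst p t) \<bullet> v t) = integral\<^sup>L lborel (\<lambda>t. g t (fst p t) \<bullet> v t)"
    if "frac_H \<alpha> v Dv" "in_X \<alpha> L v" for v Dv
  proof -
    \<comment> \<open>\<open>in_X\<close> may be witnessed by another derivative, but its
      integrability condition involves only \<open>v\<close>, so the given \<open>Dv\<close> can be
      used.\<close>
    have q: "(v, Dv) \<in> XS" using that by (simp add: XS_def in_X_def)
    show ?thesis using X_integrable[OF p(1) q] F_integrable[OF p(1) q] p(3)[OF q] by (simp add: XB_def F_def)
  qed
  have H: "frac_H \<alpha> (fst p) (snd p)" and I: "in_X \<alpha> L (fst p)" using p(1) by (auto simp: XS_def in_X_def)
  from test have "\<forall>v Dv. frac_H \<alpha> v Dv \<and> in_X \<alpha> L v \<longrightarrow>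
        integrable lborel (\<lambda>t. snd p t \<bullet> Dv t + (L t *v fst p t) \<bullet> v t) \<and>
        integrable lborel (\<lambda>t. g t (fst p t) \<bullet> v t) \<and>
        integral\<^sup>L lborel (\<lambda>t. snd p t \<bullet> Dv t + (L t *v fst p t) \<bullet> v t) = integral\<^sup>L lborel (\<lambda>t. g t (fst p t) \<bullet> v t)"
    by blast
  note T = this
  show ?thesis by (rule exI[of _ "fst p"], rule exI[of _ "snd p"]) (intro conjI H I nz T)
qed

end

theorem theorem1p1:
  fixes \<alpha> :: real and L :: "real \<Rightarrow> real^'n^'n" and W :: "real \<Rightarrow> real^'n \<Rightarrow> real"
  assumes "1/2 < \<alpha>" and "\<alpha> < 1"
    and "continuous_on UNIV L"
    and "\<forall>t. transpose (L t) = L t"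
    and "\<forall>t x. x \<noteq> 0 \<longrightarrow> 0 < (L t *v x) \<bullet> x"
    and "\<exists>l. continuous_on UNIV l \<and> (\<forall>t. 0 < l t) \<and> filterlim l at_top at_infinity
             \<and> (\<forall>t x. l t * (norm x)\<^sup>2 \<le> (L t *v x) \<bullet> x)"
    and "C1_pair W"
    and "\<exists>\<mu>>2. \<forall>t x. x \<noteq> 0 \<longrightarrow> 0 < \<mu> * W t x \<and> \<mu> * W t x \<le> x \<bullet> nablaW W t x"
    and "\<forall>\<epsilon>>0. \<exists>\<delta>>0. \<forall>t x. 0 < norm x \<and> norm x < \<delta> \<longrightarrow> norm (nablaW W t x) \<le> \<epsilon> * norm x"
    and "\<exists>Wb :: real^'n \<Rightarrow> real. continuous_on UNIV Wb \<and>
             (\<forall>t x. \<bar>W t x\<bar> + norm (nablaW W t x) \<le> \<bar>Wb x\<bar>)"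
  shows "\<exists>u Du. frac_H \<alpha> u Du \<and> in_X \<alpha> L u \<and> \<not> (AE t in lborel. u t = 0) \<and>
           (\<forall>v Dv. frac_H \<alpha> v Dv \<and> in_X \<alpha> L v \<longrightarrow>
              integrable lborel (\<lambda>t. Du t \<bullet> Dv t + (L t *v u t) \<bullet> v t) \<and>
              integrable lborel (\<lambda>t. nablaW W t (u t) \<bullet> v t) \<and>
              integral\<^sup>L lborel (\<lambda>t. Du t \<bullet> Dv t + (L t *v u t) \<bullet> v t)
                = integral\<^sup>L lborel (\<lambda>t. nablaW W t (u t) \<bullet> v t))"
proof -
  obtain l where l: "continuous_on UNIV l" "\<And>t. 0 < l t" "filterlim l at_top at_infinity"
    "\<And>t x. l t * (norm x)\<^sup>2 \<le> (L t *v x) \<bullet> x" using assms(6) by blast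
  obtain \<mu> where \<mu>: "\<mu> > 2" "\<And>t x. x \<noteq> 0 \<Longrightarrow> 0 < \<mu> * W t x \<and> \<mu> * W t x \<le> x \<bullet> nablaW W t x" using assms(8) by blast
  interpret frac_hamiltonian \<alpha> W \<mu> L l
  proof unfold_locales
    show "\<exists>\<delta>>0. \<forall>t x. 0 < norm x \<and> norm x < \<delta> \<longrightarrow> norm (nablaW W t x) \<le> \<epsilon> * norm x" if "\<epsilon> > 0" for \<epsilon>
      using spec[OF assms(9), of \<epsilon>] that by (rule mp)
    show "0 < \<mu> * W t x \<and> \<mu> * W t x \<le> x \<bullet> nablaW W t x" if "x \<noteq> 0" for t x
      by (rule \<mu>(2)[OF that])
    show "transpose (L t) = L t" for t using assms(4) ..
  qed (rule assms(1,2,3,7,10) \<mu>(1) l)+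
  show ?thesis by (rule weak_solution)
qed

end
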